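(* Assume that $\log\min_{|e|=1}\omega(0,e)\in L^d(\mathbb{P})$, that $\int_0^\infty s\,\sigma_0(ds)\in L^d(\mathbf{P})$, and that the origin lies in the convex hull of the support of the law under $\mathbb{P}$ of $\sum_{|e|=1}\omega(0,e)e$. Then for each $\lambda\ge 0$ there exists a nonrandom function $\alpha_\lambda:\mathbb{R}^d\to[0,\infty)$ such that for all $x\in\mathbb{Z}^d$, $$\lim_{n\to\infty}\frac1n a_\lambda(0,nx,\omega,\sigma)=\lim_{n\to\infty}\frac1n\,\mathbb{E}\otimes\mathbf{E}[a_\lambda(0,nx,\omega,\sigma)]=\inf_{n\ge1}\frac1n\,\mathbb{E}\otimes\mathbf{E}[a_\lambda(0,nx,\omega,\sigma)]=\alpha_\lambda(x)$$ holds $\mathbb{P}\otimes\mathbf{P}$-a.s. and in $L^1(\mathbb{P}\otimes\mathbf{P})$. Moreover, for any $q>0$ and $x,y\in\mathbb{R}^d$, $$\alpha_\lambda(qx)=q\,\alpha_\lambda(x),\qquad \alpha_\lambda(x+y)\le\alpha_\lambda(x)+\alpha_\lambda(y),$$ and $$|x|\bigl(-\log\mathbf{E}[\exp\{-\theta_{\lambda,\sigma}(0)\}]\bigr)\le\alpha_\lambda(x)\le|x|\Bigl(\max_{|e|=1}\mathbb{E}[-\log\omega(0,e)]+\mathbf{E}[\theta_{\lambda,\sigma}(0)]\Bigr).$$ Furthermore, $\alpha_\lambda(x)$ is concave increasing in $\lambda\ge0$ and convex in $x\in\mathbb{R}^d$. In particular, it is jointly continuous in $\lambda\ge0$ and 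$x\in\mathbb{R}^d$.
   Context: Fix $d\ge1$; $|x|=|x_1|+\dots+|x_d|$ is the $l^1$-norm on $\mathbb{R}^d$. Let $\mathcal{P}_1$ be the space of probability measures on $\{e\in\mathbb{Z}^d:|e|=1\}$ and $\Omega=\mathcal{P}_1^{\mathbb{Z}^d}$ with the product $\sigma$-field and an i.i.d. (product) probability measure $\mathbb{P}$. For an environment $\omega=(\omega(x,\cdot))_{x\in\mathbb{Z}^d}\in\Omega$, $P_\omega^x$ is the law of the Markov chain $X=(X_n)_{n\ge0}$ on $\mathbb{Z}^d$ with $P_\omega^x(X_0=x)=1$ and $P_\omega^x(X_{n+1}=y+e\mid X_n=y)=\omega(y,e)$. Let $\mathcal{P}_2$ be the space of Borel probability measures on $(0,\infty)$ and $\Sigma=\mathcal{P}_2^{\mathbb{Z}^d}$ with the canonical $\sigma$-field and an i.i.d. (product) probability measure $\mathbf{P}$. For $\sigma=(\sigma_x)_{x\in\mathbb{Z}^d}\in\Sigma$, under $P^{\mathrm{HT}}_\sigma$ the holding times $\tau=(\tau_n(x))_{n\ge0,x\in\mathbb{Z}^d}$ are independent and $\tau_n(x)$ has law $\sigma_x$ for all $n$. The continuous-time process $(Z_t)_{t\ge0}$ is $Z_t=X_n$ if $\sum_{m=0}^{n-1}\tau_m(X_m)\le t<\sum_{m=0}^{n}\tau_m(X_m)$ (empty sum $=0$), and $Z_t=\Delta$ (a graveyard state) if $t\ge\sum_{m=0}^\infty\tau_m(X_m)$. Put $\tilde P^x_{\omega,\sigma}=P^x_\omega\otimes P^{\mathrm{HT}}_\sigma$.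 Expectations with respect to $\mathbb{P},\mathbf{P},\tilde P^x_{\omega,\sigma}$ are $\mathbb{E},\mathbf{E},\tilde E^x_{\omega,\sigma}$. For $\lambda\ge0$ and $z\in\mathbb{Z}^d$, $\theta_{\lambda,\sigma}(z)=-\log\int_0^\infty e^{-\lambda s}\sigma_z(ds)$. With $H^Z(y)=\inf\{t\ge0:Z_t=y\}$, set $e_\lambda(x,y,\omega,\sigma)=\tilde E^x_{\omega,\sigma}[\exp\{-\lambda H^Z(y)\}\mathbf{1}_{\{H^Z(y)<\infty\}}]$ and $a_\lambda(x,y,\omega,\sigma)=-\log e_\lambda(x,y,\omega,\sigma)$ for $x,y\in\mathbb{Z}^d$. *)

theory Defs
  imports "HOL-Probability.Probability"
begin

section \<open>Lattice sites\<close>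

text \<open>The dimension is the cardinality of the index type \<open>'d\<close>; sites are integer vectors.\<close>

type_synonym 'd site = "(int, 'd) vec"

definition embed :: "'d::finite site \<Rightarrow> real ^ 'd" where
  "embed x = (\<chi> i. real_of_int (x $ i))"

definition l1norm :: "real ^ 'd::finite \<Rightarrow> real" where
  "l1norm x = (\<Sum>i\<in>UNIV. \<bar>x $ i\<bar>)"

definition unit_steps :: "'d::finite site set" where
  "unit_steps = {e. l1norm (embed e) = 1}"


section \<open>Extended-real conventions\<close>

text \<open>Logarithm on \<open>[0,\<infinity>)\<close> with \<open>log 0 = -\<infinity>\<close>; the library's \<open>ln\<close> has \<open>ln 0 = 0\<close>.\<close>

definition elog :: "real \<Rightarrow> ereal" where
  "elog p = (if p = 0 then - \<infinity> else ereal (ln p))"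

text \<open>Integral of the positive part minus integral of the negative part
  (\<open>e2ennreal\<close> sends negative numbers to \<open>0\<close>).\<close>

definition expect :: "'a measure \<Rightarrow> ('a \<Rightarrow> ereal) \<Rightarrow> ereal" where
  "expect M f =
     enn2ereal (\<integral>\<^sup>+w. e2ennreal (f w) \<partial>M) - enn2ereal (\<integral>\<^sup>+w. e2ennreal (- f w) \<partial>M)"

definition in_Lp :: "nat \<Rightarrow> 'a measure \<Rightarrow> ('a \<Rightarrow> ereal) \<Rightarrow> bool" where
  "in_Lp p M f \<longleftrightarrow> f \<in> borel_measurable M \<and> (\<integral>\<^sup>+w. e2ennreal (\<bar>f w\<bar> ^ p) \<partial>M) < \<infinity>"

definition tendsto_L1 :: "'a measure \<Rightarrow> (nat \<Rightarrow> 'a \<Rightarrow> ereal) \<Rightarrow> ('a \<Rightarrow> ereal) \<Rightarrow> bool" where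
  "tendsto_L1 M f g \<longleftrightarrow>
     (\<forall>n. in_Lp 1 M (f n)) \<and> in_Lp 1 M g \<and>
     (\<lambda>n. \<integral>\<^sup>+w. e2ennreal \<bar>f n w - g w\<bar> \<partial>M) \<longlonglongrightarrow> 0"

text \<open>Topological support: the complement of the largest open null set.\<close>

definition msupport :: "'a::topological_space measure \<Rightarrow> 'a set" where
  "msupport M = {x. \<forall>U. open U \<longrightarrow> x \<in> U \<longrightarrow> emeasure M U > 0}"


section \<open>Environments and holding-time laws\<close>

text \<open>The probability of the step \<open>e\<close> at the site \<open>x\<close> in the environment \<open>\<omega>\<close>, written
  \<open>\<omega>(x,e)\<close> in mathematical notation, is \<open>measure (\<omega> x) {e}\<close>.\<close>

definition P1 :: "'d::finite site measure measure" where
  "P1 = prob_algebra (count_space unit_steps)"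

definition env_law :: "'d::finite site measure measure \<Rightarrow> ('d site \<Rightarrow> 'd site measure) measure" where
  "env_law \<nu> = PiM UNIV (\<lambda>_. \<nu>)"

definition P2 :: "real measure measure" where
  "P2 = prob_algebra (restrict_space borel {0<..})"

definition hold_law :: "real measure measure \<Rightarrow> ('d::finite site \<Rightarrow> real measure) measure" where
  "hold_law \<mu> = PiM UNIV (\<lambda>_. \<mu>)"

definition drift :: "('d::finite site \<Rightarrow> 'd site measure) \<Rightarrow> real ^ 'd" where
  "drift \<omega> = (\<Sum>e\<in>unit_steps. measure (\<omega> 0) {e} *\<^sub>R embed e)"

definition theta :: "real \<Rightarrow> ('d::finite site \<Rightarrow> real measure) \<Rightarrow> 'd site \<Rightarrow> real" where
  "theta lam \<sigma> z = - ln (\<integral>s. exp (- lam * s) \<partial>\<sigma> z)"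


section \<open>The random walk in a fixed environment\<close>

text \<open>Conditional law of \<open>X\<^sub>n\<close> given \<open>X\<^sub>0, \<dots>, X\<^sub>n\<^sub>-\<^sub>1\<close> for the chain started at \<open>x\<close>.\<close>

definition step_kernel ::
  "('d::finite site \<Rightarrow> 'd site measure) \<Rightarrow> 'd site \<Rightarrow> nat \<Rightarrow> (nat \<Rightarrow> 'd site) \<Rightarrow> 'd site measure" where
  "step_kernel \<omega> x n X =
     (case n of
        0 \<Rightarrow> return (count_space UNIV) x
      | Suc m \<Rightarrow> distr (\<omega> (X m)) (count_space UNIV) (\<lambda>e. X m + e))"

text \<open>Path law given by the Ionescu-Tulcea theorem.\<close>

definition walk_law ::
  "('d::finite site \<Rightarrow> 'd site measure) \<Rightarrow> 'd site \<Rightarrow> (nat \<Rightarrow> 'd site) measure" where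
  "walk_law \<omega> x =
     projective_family.lim UNIV
       (Ionescu_Tulcea.CI (step_kernel \<omega> x) (\<lambda>_. count_space UNIV))
       (\<lambda>_. count_space UNIV)"

lemma Ionescu_Tulcea_step_kernel:
  fixes \<omega> :: "'d::finite site \<Rightarrow> 'd site measure"
  assumes "\<And>y. \<omega> y \<in> space P1"
  shows "Ionescu_Tulcea (step_kernel \<omega> x) (\<lambda>_. count_space UNIV)"
proof -
  have \<omega>: "sets (\<omega> y) = sets (count_space unit_steps)" "prob_space (\<omega> y)" for y
    using assms[of y] by (auto simp: P1_def space_prob_algebra)
  have prob: "prob_space (distr (\<omega> y) (count_space UNIV) (\<lambda>e. y + e))" for y
    by (rule prob_space.prob_space_distr[OF \<omega>(2)])
       (simp add: measurable_cong_sets[OF \<omega>(1) refl])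
  have kernel: "(\<lambda>y. distr (\<omega> y) (count_space UNIV) (\<lambda>e. y + e))
      \<in> measurable (count_space UNIV) (subprob_algebra (count_space UNIV))"
    by (simp add: space_subprob_algebra prob_space_imp_subprob_space prob)
  show ?thesis
  proof (rule Ionescu_Tulcea.intro)
    fix n
    show "step_kernel \<omega> x n
        \<in> measurable (PiM {0..<n} (\<lambda>_. count_space UNIV)) (subprob_algebra (count_space UNIV))"
    proof (cases n)
      case 0
      have "step_kernel \<omega> x 0 = (\<lambda>_. return (count_space UNIV) x)"
        by (simp add: fun_eq_iff step_kernel_def)
      moreover have "return (count_space UNIV) x \<in> space (subprob_algebra (count_space UNIV))"
        by (simp add: space_subprob_algebra prob_space_imp_subprob_space prob_space_return)
      ultimately show ?thesis
        unfolding 0 by (simp only: measurable_const)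
    next
      case (Suc m)
      have "(\<lambda>X. X m) \<in> measurable (PiM {0..<n} (\<lambda>_. count_space UNIV :: 'd site measure)) (count_space UNIV)"
        using Suc by (intro measurable_component_singleton) auto
      from measurable_compose[OF this kernel] show ?thesis
        unfolding Suc step_kernel_def nat.case .
    qed
  next
    fix n and X :: "nat \<Rightarrow> 'd site"
    show "prob_space (step_kernel \<omega> x n X)"
      by (cases n) (simp_all add: step_kernel_def prob prob_space_return)
  qed
qed

lemma sets_walk_law:
  fixes \<omega> :: "'d::finite site \<Rightarrow> 'd site measure"
  assumes "\<And>y. \<omega> y \<in> space P1"
  shows "sets (walk_law \<omega> x) = sets (PiM UNIV (\<lambda>_. count_space UNIV))"
proof -
  interpret Ionescu_Tulcea "step_kernel \<omega> x" "\<lambda>_. count_space UNIV"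
    by (rule Ionescu_Tulcea_step_kernel[OF assms])
  show ?thesis
    by (simp add: walk_law_def)
qed

lemma emeasure_step_kernel_Suc:
  fixes \<omega> :: "'d::finite site \<Rightarrow> 'd site measure"
  assumes "\<omega> (X n) \<in> space P1"
  shows "emeasure (step_kernel \<omega> x (Suc n) X) {y} = emeasure (\<omega> (X n)) {y - X n}"
proof -
  have sets: "sets (\<omega> (X n)) = sets (count_space unit_steps)"
    using assms by (simp add: P1_def space_prob_algebra)
  have space: "space (\<omega> (X n)) = unit_steps"
    by (simp add: sets_eq_imp_space_eq[OF sets])
  have "emeasure (step_kernel \<omega> x (Suc n) X) {y} = emeasure (\<omega> (X n)) ((\<lambda>e. X n + e) -` {y} \<inter> unit_steps)"
    by (simp add: step_kernel_def emeasure_distr space measurable_cong_sets[OF sets refl])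
  also have "(\<lambda>e. X n + e) -` {y} \<inter> unit_steps = {y - X n} \<inter> unit_steps"
    by (simp add: set_eq_iff eq_diff_eq add.commute)
  also have "emeasure (\<omega> (X n)) \<dots> = emeasure (\<omega> (X n)) {y - X n}"
  proof (cases "y - X n \<in> unit_steps")
    case False
    then have "{y - X n} \<notin> sets (\<omega> (X n))"
      by (simp add: sets)
    with False show ?thesis
      by (simp add: emeasure_notin_sets)
  qed simp
  finally show ?thesis .
qed

text \<open>The finite-dimensional distributions are those of the Markov chain with
  \<open>X\<^sub>0 = x\<close> and transition probabilities \<open>\<omega>(y,e)\<close>.\<close>

lemma emeasure_walk_law_cylinder:
  fixes \<omega> :: "'d::finite site \<Rightarrow> 'd site measure"
  assumes \<omega>: "\<And>y. \<omega> y \<in> space P1"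
  shows "emeasure (walk_law \<omega> x) {X. \<forall>i\<le>n. X i = p i}
    = (if p 0 = x then \<Prod>i<n. emeasure (\<omega> (p i)) {p (Suc i) - p i} else 0)"
proof -
  let ?M = "\<lambda>_::nat. count_space UNIV :: 'd site measure"
  interpret IT: Ionescu_Tulcea "step_kernel \<omega> x" ?M
    by (rule Ionescu_Tulcea_step_kernel[OF \<omega>])
  define A where "A n = (PiE {0..<Suc n} (\<lambda>i. {p i}))" for n
  have A_iff: "Y \<in> A k \<longleftrightarrow> (\<forall>i<Suc k. Y i = p i) \<and> (\<forall>i\<ge>Suc k. Y i = undefined)" for Y k
    by (simp add: A_def PiE_iff extensional_def Ball_def not_less)
  have A_sets: "A n \<in> sets (PiM {0..<Suc n} ?M)" for n
    unfolding A_def by (intro sets_PiM_I_finite) auto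
  have cyl: "{X. \<forall>i\<le>n. X i = p i} = prod_emb UNIV ?M {0..<Suc n} (A n)"
  proof (rule set_eqI)
    fix X :: "nat \<Rightarrow> 'd site"
    have "X \<in> prod_emb UNIV ?M {0..<Suc n} (A n) \<longleftrightarrow> restrict X {0..<Suc n} \<in> A n"
      unfolding prod_emb_iff by simp
    also have "\<dots> \<longleftrightarrow> X \<in> {X. \<forall>i\<le>n. X i = p i}"
      unfolding A_iff restrict_def by (simp add: less_Suc_eq_le)
    finally show "X \<in> {X. \<forall>i\<le>n. X i = p i} \<longleftrightarrow> X \<in> prod_emb UNIV ?M {0..<Suc n} (A n)" ..
  qed
  have "emeasure (walk_law \<omega> x) {X. \<forall>i\<le>n. X i = p i} = emeasure (IT.CI {0..<Suc n}) (A n)"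
    unfolding walk_law_def cyl by (rule IT.lim[OF finite_atLeastLessThan A_sets])
  also have "\<dots> = emeasure (IT.C 0 (Suc n) (\<lambda>_. undefined)) (A n)"
  proof -
    have "prod_emb {0..<Suc n} ?M {0..<Suc n} (A n) = A n"
      by (rule prod_emb_id) (auto simp: A_def PiE_iff)
    then show ?thesis
      by (simp only: IT.emeasure_CI[OF order.refl A_sets])
  qed
  also have "\<dots> = (if p 0 = x then \<Prod>i<n. emeasure (\<omega> (p i)) {p (Suc i) - p i} else 0)"
  proof (induction n)
    case 0
    let ?u = "\<lambda>_::nat. undefined :: 'd site"
    have u: "?u \<in> space (PiM {0..<0} ?M)"
      by (simp add: space_PiM)
    have "emeasure (IT.C 0 (Suc 0) ?u) (A 0) = emeasure (IT.eP 0 ?u) (A 0)"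
      unfolding IT.C.simps add_0 bind_return[OF IT.measurable_eP u] ..
    also have "\<dots> = emeasure (step_kernel \<omega> x 0 ?u) (fun_upd ?u 0 -` A 0 \<inter> space (?M 0))"
      by (rule IT.emeasure_eP[OF u A_sets])
    also have "fun_upd ?u 0 -` A 0 \<inter> space (?M 0) = {p 0}"
      by (simp add: set_eq_iff A_iff)
    finally show ?case
      by (simp add: step_kernel_def indicator_def)
  next
    case (Suc n)
    let ?u = "\<lambda>_::nat. undefined :: 'd site"
    let ?c = "emeasure (\<omega> (p n)) {p (Suc n) - p n}"
    have u: "?u \<in> space (PiM {0..<0} ?M)"
      by (simp add: space_PiM)
    have eP: "emeasure (IT.eP (Suc n) X) (A (Suc n)) = ?c * indicator (A n) X"
      if X: "X \<in> space (PiM {0..<Suc n} ?M)" for X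
    proof -
      have ext: "X i = undefined" if "Suc n \<le> i" for i
        using X that by (simp add: space_PiM PiE_iff extensional_def)
      have "fun_upd X (Suc n) y \<in> A (Suc n) \<longleftrightarrow> X \<in> A n \<and> y = p (Suc n)" for y
      proof
        assume L: "fun_upd X (Suc n) y \<in> A (Suc n)"
        have "X i = p i" if "i < Suc n" for i
          using L[unfolded A_iff, THEN conjunct1, rule_format, of i] that by simp
        moreover have "y = p (Suc n)"
          using L[unfolded A_iff, THEN conjunct1, rule_format, of "Suc n"] by simp
        ultimately show "X \<in> A n \<and> y = p (Suc n)"
          using ext by (simp add: A_iff)
      next
        assume "X \<in> A n \<and> y = p (Suc n)"
        then show "fun_upd X (Suc n) y \<in> A (Suc n)"
          by (simp add: A_iff less_Suc_eq)
      qed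
      then have upd: "fun_upd X (Suc n) -` A (Suc n) \<inter> space (?M (Suc n)) = (if X \<in> A n then {p (Suc n)} else {})"
        by (simp add: set_eq_iff)
      show ?thesis
      proof (cases "X \<in> A n")
        case True
        then have "X n = p n"
          by (simp add: A_iff)
        then show ?thesis
          unfolding IT.emeasure_eP[OF X A_sets] upd
          using emeasure_step_kernel_Suc[where \<omega> = \<omega> and X = X and n = n and x = x and y = "p (Suc n)", OF \<omega>] True by simp
      next
        case False
        then show ?thesis
          unfolding IT.emeasure_eP[OF X A_sets] upd by simp
      qed
    qed
    have "emeasure (IT.C 0 (Suc (Suc n)) ?u) (A (Suc n))
        = (\<integral>\<^sup>+X. emeasure (IT.eP (Suc n) X) (A (Suc n)) \<partial>IT.C 0 (Suc n) ?u)"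
    proof -
      have "space (IT.C 0 (Suc n) ?u) \<noteq> {}"
        unfolding IT.space_C[OF u] by (simp add: space_PiM PiE_eq_empty_iff)
      moreover have "IT.eP (Suc n)
          \<in> measurable (IT.C 0 (Suc n) ?u) (subprob_algebra (PiM {0..<Suc (Suc n)} ?M))"
        using IT.measurable_eP[of "Suc n"]
        unfolding measurable_cong_sets[OF IT.sets_C[OF u] refl] add_0 .
      ultimately show ?thesis
        unfolding IT.C.simps(2)[of 0 "Suc n"] add_0
        by (rule emeasure_bind[OF _ _ A_sets])
    qed
    also have "\<dots> = (\<integral>\<^sup>+X. ?c * indicator (A n) X \<partial>IT.C 0 (Suc n) ?u)"
      by (intro nn_integral_cong eP) (simp only: IT.space_C[OF u] add_0)
    also have "\<dots> = ?c * emeasure (IT.C 0 (Suc n) ?u) (A n)"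
      by (rule nn_integral_cmult_indicator) (simp only: IT.sets_C[OF u] A_sets add_0)
    finally show ?case
      unfolding Suc.IH by (simp add: mult.commute)
  qed
  finally show ?thesis .
qed


section \<open>The continuous-time process and its hitting times\<close>

text \<open>The holding time \<open>\<tau>\<^sub>n(x)\<close> is \<open>\<tau> (n, x)\<close>.\<close>

definition HT_law :: "('d::finite site \<Rightarrow> real measure) \<Rightarrow> (nat \<times> 'd site \<Rightarrow> real) measure" where
  "HT_law \<sigma> = PiM UNIV (\<lambda>(n, x). \<sigma> x)"

definition joint_law ::
  "('d::finite site \<Rightarrow> 'd site measure) \<Rightarrow> ('d site \<Rightarrow> real measure) \<Rightarrow> 'd site
     \<Rightarrow> ((nat \<Rightarrow> 'd site) \<times> (nat \<times> 'd site \<Rightarrow> real)) measure" where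
  "joint_law \<omega> \<sigma> x = walk_law \<omega> x \<Otimes>\<^sub>M HT_law \<sigma>"

definition jump_time :: "(nat \<Rightarrow> 'd site) \<Rightarrow> (nat \<times> 'd site \<Rightarrow> real) \<Rightarrow> nat \<Rightarrow> real" where
  "jump_time X \<tau> n = (\<Sum>m<n. \<tau> (m, X m))"

text \<open>\<open>None\<close> is the graveyard state.  As the holding times are positive, the index is unique, and
  there is none exactly when \<open>t \<ge> \<Sum>\<^sub>m \<tau>\<^sub>m(X\<^sub>m)\<close>.\<close>

definition Z_process ::
  "(nat \<Rightarrow> 'd site) \<Rightarrow> (nat \<times> 'd site \<Rightarrow> real) \<Rightarrow> real \<Rightarrow> 'd site option" where
  "Z_process X \<tau> t =
     (if \<exists>n. jump_time X \<tau> n \<le> t \<and> t < jump_time X \<tau> (Suc n)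
      then Some (X (THE n. jump_time X \<tau> n \<le> t \<and> t < jump_time X \<tau> (Suc n)))
      else None)"

definition hitting_time ::
  "(nat \<Rightarrow> 'd site) \<Rightarrow> (nat \<times> 'd site \<Rightarrow> real) \<Rightarrow> 'd site \<Rightarrow> ereal" where
  "hitting_time X \<tau> y = Inf {ereal t | t. 0 \<le> t \<and> Z_process X \<tau> t = Some y}"

definition e_fun ::
  "real \<Rightarrow> 'd::finite site \<Rightarrow> 'd site \<Rightarrow> ('d site \<Rightarrow> 'd site measure) \<Rightarrow> ('d site \<Rightarrow> real measure) \<Rightarrow> real" where
  "e_fun lam x y \<omega> \<sigma> =
     (\<integral>(X, \<tau>). (if hitting_time X \<tau> y < \<infinity>
                 then exp (- lam * real_of_ereal (hitting_time X \<tau> y)) else 0)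
       \<partial>joint_law \<omega> \<sigma> x)"

definition a_fun ::
  "real \<Rightarrow> 'd::finite site \<Rightarrow> 'd site \<Rightarrow> ('d site \<Rightarrow> 'd site measure) \<Rightarrow> ('d site \<Rightarrow> real measure) \<Rightarrow> ereal" where
  "a_fun lam x y \<omega> \<sigma> = - elog (e_fun lam x y \<omega> \<sigma>)"

end

theory Submission
  imports Defs
begin

text \<open>
  The hitting time of \<open>Z\<close> is the jump time at the first visit of the embedded walk, so integrating out
  the holding times turns \<open>e_fun\<close> into the limit of a finite recursion (\<open>hit_upto\<close>) in which every visit to
  \<open>x\<close> costs a factor \<open>\<integral> exp (- lam s) \<partial>\<sigma> x\<close>.  The recursion yields measurability, translation covariance and
  \<open>e(x,y) e(y,z) \<le> e(x,z)\<close>; going straight from \<open>0\<close> to \<open>x\<close> shows that \<open>a(0,x)\<close> is integrable.  As the shifts of an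
  i.i.d. environment are mixing, a Kingman theorem for mixing maps, proved by the Katznelson--Weiss
  covering argument, gives the limits in lattice directions.

  On all of \<open>\<real>\<^sup>d\<close> the exponent is \<open>lim n\<^sup>-\<^sup>1 E[a(0, \<lfloor>n x\<rfloor>)]\<close>, which exists because \<open>n \<mapsto> E[a(0, \<lfloor>n x\<rfloor>)]\<close> is
  subadditive up to a constant; homogeneity, subadditivity and concavity pass to this limit.  The lower
  bound is Jensen's inequality together with the fact that a path from \<open>0\<close> to \<open>x\<close> visits at least \<open>|x|\<close>
  distinct sites, whose holding-time factors are independent.
\<close>

section \<open>Mixing transformations and a subadditive ergodic theorem\<close>

text \<open>Ergodicity would be too weak a notion here: the upper half of the subadditive theorem
  works with \<open>T ^^ k\<close>, and the environment is a pair of independent fields, while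
  ergodicity passes neither to powers nor to products. Mixing passes to both and can be checked on
  cylinders. The quenched facts are taken from the recursion rather than from stopping-time
  arguments: composing two crossings is an induction comparing two solutions of the same one-step
  equation. Defining the exponent by rounding makes it available at every real point without an
  extension from rational directions. Each algebraic property then compares two lattice sequences
  with the same direction, and the price of changing sequence is bounded because the mean cost is
  Lipschitz with constant \<open>step_bound\<close>. The rounding defect also leaves an infimum
  formula with an additive constant, which survives at the endpoint of the parameter range, where a
  concave function may jump. In lattice directions nothing is rounded, so there the infimum holds
  without the constant.\<close>

lemma almost_subadditive_tendsto:
  fixes h :: "nat \<Rightarrow> real"
  assumes sub: "\<And>m n. h (m + n) \<le> h m + h n + K"
    and nonneg: "\<And>n. 0 \<le> h n" and K: "0 \<le> K"
  shows "(\<lambda>n. h n / n) \<longlonglongrightarrow> (INF n\<in>{1..}. (h n + K) / n)" (is "_ \<longlonglongrightarrow> ?L")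
proof (rule LIMSEQ_I)
  fix r :: real assume r: "0 < r"
  have bdd: "bdd_below ((\<lambda>n. (h n + K) / real n) ` {1..})"
    by (rule bdd_belowI2[of _ 0]) (use nonneg K in auto)
  \<comment> \<open>Adding \<open>K\<close> absorbs the defect: \<open>h + K\<close> is subadditive.
    A nearly minimal ratio provides the block length \<open>k\<close>.\<close>
  have "\<exists>k\<in>{1..}. (h k + K) / real k < ?L + r / 2"
  proof (rule ccontr)
    assume "\<not> ?thesis"
    then have "?L + r / 2 \<le> ?L"
      by (intro cINF_greatest) (auto simp: not_less)
    with r show False by simp
  qed
  then obtain k :: nat where k: "k \<ge> 1" "(h k + K) / k < ?L + r / 2" by auto
  have step: "h (j * k + i) + K \<le> j * (h k + K) + (h i + K)" for i j
  proof (induction j)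
    case (Suc j)
    have "h (Suc j * k + i) \<le> h k + h (j * k + i) + K"
      using sub[of k "j * k + i"] by (simp add: algebra_simps)
    with Suc show ?case by (simp add: algebra_simps)
  qed simp
  \<comment> \<open>One bound for \<open>h\<close> at all remainders below \<open>k\<close>, so an
    incomplete block contributes at most \<open>B / n\<close>.\<close>
  define B where "B = (\<Sum>i<k. h i) + K"
  have B0: "0 \<le> B" using nonneg K by (auto simp: B_def intro!: add_nonneg_nonneg sum_nonneg)
  obtain N :: nat where N: "N > 2 * B / r" "N \<ge> 1"
    using reals_Archimedean2[of "max 1 (2 * B / r)"] by (metis max_less_iff_conj of_nat_1 of_nat_less_iff less_imp_le)
  show "\<exists>no. \<forall>n\<ge>no. norm (h n / n - ?L) < r"
  proof (intro exI allI impI)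
    \<comment> \<open>The second threshold makes \<open>K / n < r\<close>; it is needed because
      \<open>?L\<close> bounds \<open>(h n + K) / n\<close> from below, not
      \<open>h n / n\<close>.\<close>
    fix n assume n: "n \<ge> max N (nat \<lceil>2 * K / r\<rceil> + 1)"
    then have n1: "n \<ge> 1" "n \<ge> N" using N by auto
    have "h n \<le> (n div k) * (h k + K) + B"
    proof -
      have "h (n mod k) \<le> (\<Sum>i<k. h i)"
        using k nonneg by (intro member_le_sum) auto
      then show ?thesis
        using step[of "n div k" "n mod k"] K by (simp add: B_def)
    qed
    also have "real (n div k) \<le> n / k" by (rule of_nat_div_le_of_nat)
    then have "(n div k) * (h k + K) + B \<le> (n / k) * (h k + K) + B"
      using nonneg[of k] K by (intro add_right_mono mult_right_mono) auto
    finally have "h n / n \<le> ((n / k) * (h k + K) + B) / n"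
      using n1 by (simp add: divide_right_mono)
    also have "\<dots> = (h k + K) / k + B / n" using n1 k by (simp add: field_simps)
    also have "B / n \<le> B / N" using n1 N B0 by (intro divide_left_mono) auto
    also have "B / N < r / 2" using N r by (simp add: field_simps)
    finally have up: "h n / n < ?L + r" using k by simp
    have "?L \<le> (h n + K) / n" using n1 by (intro cINF_lower[OF bdd]) auto
    also have "\<dots> = h n / n + K / n" by (simp add: add_divide_distrib)
    also have "K / n < r"
    proof -
      have "real n > 2 * K / r" using n by linarith
      then have "K * 2 < r * n" using r by (simp add: field_simps)
      then have "K < r * n" using K by linarith
      then show ?thesis using r n1 by (simp add: field_simps)
    qed
    finally have "?L - r < h n / n" by simp
    with up show "norm (h n / n - ?L) < r" by auto
  qed
qed

lemma sum_shift_block: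
  fixes f :: "nat \<Rightarrow> real"
  assumes "n \<le> K"
  shows "(\<Sum>i<K. f i) = (\<Sum>i<n. f i) + (\<Sum>i<K - n. f (i + n))"
proof -
  have "(\<Sum>i\<in>{0..<K}. f i) = (\<Sum>i\<in>{0..<n}. f i) + (\<Sum>i\<in>{n..<K}. f i)"
    using assms by (simp add: sum.atLeastLessThan_concat)
  also have "{n..<K} = {0 + n..<(K - n) + n}" using assms by simp
  finally show ?thesis by (simp only: sum.shift_bounds_nat_ivl lessThan_atLeast0)
qed

section \<open>Measure-preserving maps and a covering bound along orbits\<close>

locale measure_preserving = prob_space M for M :: "'a measure" +
  fixes T :: "'a \<Rightarrow> 'a"
  assumes T_meas [measurable]: "T \<in> M \<rightarrow>\<^sub>M M" and distr_T: "distr M M T = M"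
begin

lemma iter_meas [measurable]: "T ^^ n \<in> M \<rightarrow>\<^sub>M M"
  by (rule measurable_compose_n) simp

lemma iter_space: "w \<in> space M \<Longrightarrow> (T ^^ n) w \<in> space M"
  using measurable_space[OF iter_meas] by blast

lemma distr_iter: "distr M M (T ^^ n) = M"
proof (induction n)
  case 0 show ?case by (simp add: distr_id[unfolded id_def[symmetric]] id_def distr_id)
next
  case (Suc n)
  have "distr M M (T ^^ Suc n) = distr (distr M M (T ^^ n)) M T"
    by (simp add: distr_distr comp_def)
  then show ?case using Suc distr_T by (simp add: o_def)
qed

lemma integral_iter: "h \<in> borel_measurable M \<Longrightarrow> (\<integral>w. h ((T ^^ n) w) \<partial>M) = (\<integral>w. (h w :: real) \<partial>M)"
  using integral_distr[of "T ^^ n" M M h] by (simp add: distr_iter)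

lemma integrable_iter: "integrable M h \<Longrightarrow> integrable M (\<lambda>w. h ((T ^^ n) w) :: real)"
  using integrable_distr_eq[of "T ^^ n" M M h] by (simp add: distr_iter borel_measurable_integrable)

lemma prob_vimage_iter: "A \<in> sets M \<Longrightarrow> prob ((T ^^ n) -` A \<inter> space M) = prob A"
  using measure_distr[of "T ^^ n" M M A] by (simp add: distr_iter)

lemma AE_iter:
  assumes P: "AE w in M. P w" shows "AE w in M. P ((T ^^ n) w)"
proof -
  have "AE w in distr M M (T ^^ n). P w" unfolding distr_iter by (rule P)
  then show ?thesis by (rule AE_distrD[OF iter_meas])
qed

text \<open>The Katznelson--Weiss argument: cut the orbit segment of length \<open>K\<close> into blocks on which the
  average exceeds \<open>c\<close>, single bad points (in \<open>B\<close>), and a final stretch of length at most \<open>N\<close>.\<close>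

lemma superadditive_covering:
  assumes u0: "\<And>w. w \<in> space M \<Longrightarrow> u 0 w = 0"
    and super: "\<And>m n w. w \<in> space M \<Longrightarrow> u m w + u n ((T ^^ m) w) \<le> u (m + n) w"
    and u1: "\<And>w. w \<in> space M \<Longrightarrow> - d w \<le> u 1 w" and d: "\<And>w. w \<in> space M \<Longrightarrow> 0 \<le> d w"
    and good: "\<And>w. w \<in> space M \<Longrightarrow> w \<notin> B \<Longrightarrow> \<exists>n\<in>{1..N}. c * real n \<le> u n w"
    and w: "w \<in> space M"
  shows "c * real K - (\<Sum>i<K. (indicator B ((T ^^ i) w) + of_bool (K \<le> i + N)) * (\<bar>c\<bar> + d ((T ^^ i) w)))
    \<le> (u K w :: real)"
  using w
proof (induction K arbitrary: w rule: less_induct)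
  case (less K)
  let ?t = "\<lambda>K w i. (indicator B ((T ^^ i) w) + of_bool (K \<le> i + N)) * (\<bar>c\<bar> + d ((T ^^ i) w)) :: real"
  have lower: "- (\<Sum>i<n. d ((T ^^ i) w)) \<le> u n w" if "w \<in> space M" for n w
    using that
  proof (induction n arbitrary: w)
    case 0 then show ?case using u0 by simp
  next
    case (Suc n)
    have "T w \<in> space M" using iter_space[OF Suc.prems, of 1] by simp
    note Suc.IH[OF this]
    moreover have "u 1 w + u n (T w) \<le> u (Suc n) w" using super[OF Suc.prems, of 1 n] by simp
    ultimately show ?case
      using u1[OF Suc.prems] unfolding sum.lessThan_Suc_shift by (simp add: funpow_swap1)
  qed
  have dpos: "0 \<le> d ((T ^^ i) w)" for i using d iter_space less.prems by blast
  have tpos: "0 \<le> ?t K w i" for i using dpos[of i] by (intro mult_nonneg_nonneg) auto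
  \<comment> \<open>Once an initial block is paid for, superadditivity and the induction hypothesis
    at the shifted point settle the rest of the segment.\<close>
  have block: "c * real K - (\<Sum>i<K. ?t K w i) \<le> u K w"
    if n: "1 \<le> n" "n \<le> K" and le: "c * real n - (\<Sum>i<n. ?t K w i) \<le> u n w" for n
  proof -
    have "c * real (K - n) - (\<Sum>i<K - n. ?t (K - n) ((T ^^ n) w) i) \<le> u (K - n) ((T ^^ n) w)"
      using n by (intro less.IH iter_space less.prems) auto
    \<comment> \<open>The tail weight depends only on the distance to the end of the segment, so
      cutting off the first \<open>n\<close> points does not change it.\<close>
    moreover have "?t (K - n) ((T ^^ n) w) i = ?t K w (i + n)" for i
      using n by (simp add: funpow_add le_diff_conv add.commute add.left_commute of_bool_def)
    moreover have "(\<Sum>i<K. ?t K w i) = (\<Sum>i<n. ?t K w i) + (\<Sum>i<K - n. ?t K w (i + n))"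
      by (rule sum_shift_block[OF n(2)])
    moreover have "u n w + u (K - n) ((T ^^ n) w) \<le> u K w"
      using super[OF less.prems, of n "K - n"] n by simp
    ultimately show ?thesis using le n by (simp add: algebra_simps of_nat_diff)
  qed
  consider "K = 0" | "K \<ge> 1" "w \<in> B" | n where "K \<ge> 1" "1 \<le> n" "n \<le> N" "c * real n \<le> u n w"
    using good[OF less.prems] by fastforce
  then show ?case
  proof cases
    case 1 then show ?thesis using u0 less.prems by simp
  next
    case 2
    \<comment> \<open>A bad point pays enough to cover both the demanded gain \<open>c\<close> and
      the possible loss \<open>d w\<close>.\<close>
    have "\<bar>c\<bar> + d w \<le> ?t K w 0"
      using 2 dpos[of 0] mult_right_mono[of 1 "indicator B w + of_bool (K \<le> N)" "\<bar>c\<bar> + d w"] by simp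
    then show ?thesis
      using 2 u1[OF less.prems] by (intro block[of 1]) auto
  next
    case (3 n)
    show ?thesis
    proof (cases "n \<le> K")
      case True
      have "0 \<le> (\<Sum>i<n. ?t K w i)" using tpos by (intro sum_nonneg) auto
      then show ?thesis using 3 True by (intro block[of n]) auto
    next
      case False
      \<comment> \<open>The good block would overrun the end. Then \<open>K < n \<le> N\<close>, so
        every remaining point carries the tail weight and the crude lower bound by
        \<open>- d\<close> suffices.\<close>
      have "(\<Sum>i<K. c - ?t K w i) \<le> (\<Sum>i<K. - d ((T ^^ i) w))"
      proof (rule sum_mono)
        fix i assume i: "i \<in> {..<K}"
        then have "K \<le> i + N" using False 3 by simp
        then have "\<bar>c\<bar> + d ((T ^^ i) w) \<le> ?t K w i"
          using dpos[of i] mult_right_mono[of 1 "indicator B ((T ^^ i) w) + of_bool (K \<le> i + N)" "\<bar>c\<bar> + d ((T ^^ i) w)"]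
          by simp
        then show "c - ?t K w i \<le> - d ((T ^^ i) w)" by simp
      qed
      also have "\<dots> \<le> u K w" using lower[OF less.prems, of K] by (simp add: sum_negf)
      finally show ?thesis by (simp add: sum_subtractf mult.commute)
    qed
  qed
qed

end

locale mixing_map = measure_preserving +
  assumes mixing: "A \<in> sets M \<Longrightarrow> B \<in> sets M \<Longrightarrow>
    (\<lambda>n. measure M (A \<inter> (T ^^ n) -` B)) \<longlonglongrightarrow> measure M A * measure M B"

text \<open>Dynkin induction twice: the second set is freed while the first stays in
  \<open>G\<close>, then the first is freed too. Only countable disjoint unions need an exchange of
  limit and sum.\<close>

lemma (in measure_preserving) mixing_mapI:
  assumes G: "sets M = sigma_sets (space M) G" "Int_stable G" "G \<subseteq> Pow (space M)"
    and mix: "\<And>A B. A \<in> G \<Longrightarrow> B \<in> G \<Longrightarrow> (\<lambda>n. prob (A \<inter> (T ^^ n) -` B)) \<longlonglongrightarrow> prob A * prob B"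
  shows "mixing_map M T"
proof
  have vim: "A \<inter> (T ^^ n) -` B = A \<inter> ((T ^^ n) -` B \<inter> space M)" if "A \<in> sets M" for A B n
    using sets.sets_into_space[OF that] by blast
  have Gs: "A \<in> G \<Longrightarrow> A \<in> sets M" for A using G by (auto intro: sigma_sets.Basic)
  have vs: "A \<inter> (T ^^ n) -` B \<in> sets M" if "A \<in> sets M" "B \<in> sets M" for A B n
    unfolding vim[OF that(1)] using that measurable_sets[OF iter_meas] by blast
  have 1: "(\<lambda>n. prob (A \<inter> (T ^^ n) -` B)) \<longlonglongrightarrow> prob A * prob B"
    if A: "A \<in> G" and B: "B \<in> sigma_sets (space M) G" for A B
    using G(2,3) B
  proof (induction B rule: sigma_sets_induct_disjoint)
    case (basic B) with mix A show ?case by blast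
  next
    case empty show ?case by simp
  next
    case (compl B)
    then have B: "B \<in> sets M" using G by simp
    have "prob (A \<inter> (T ^^ n) -` (space M - B)) = prob A - prob (A \<inter> (T ^^ n) -` B)" for n
    proof -
      have "A \<inter> (T ^^ n) -` (space M - B) = A - A \<inter> (T ^^ n) -` B"
        using iter_space sets.sets_into_space[OF Gs[OF A]] by blast
      then show ?thesis using finite_measure_Diff[OF Gs[OF A] vs[OF Gs[OF A] B]] by simp
    qed
    then have eq: "(\<lambda>n. prob (A \<inter> (T ^^ n) -` (space M - B))) = (\<lambda>n. prob A - prob (A \<inter> (T ^^ n) -` B))"
      by (rule ext)
    show ?case
      unfolding eq prob_compl[OF B] right_diff_distrib mult_1_right
      by (intro tendsto_diff tendsto_const compl.IH)
  next
    case (union B)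
    then have B: "B i \<in> sets M" for i using G by auto
    have "prob (A \<inter> (T ^^ n) -` (\<Union>i. B i)) = (\<Sum>i. prob (A \<inter> (T ^^ n) -` B i))" for n
    proof -
      have "(\<lambda>i. prob (A \<inter> (T ^^ n) -` B i)) sums prob (\<Union>i. A \<inter> (T ^^ n) -` B i)"
        using vs[OF Gs[OF A] B] union(1) by (intro finite_measure_UNION) (auto simp: disjoint_family_on_def, blast)
      then show ?thesis by (simp add: vimage_Union sums_iff vimage_UN)
    qed
    moreover have sums: "(\<lambda>i. prob (B i)) sums prob (\<Union>i. B i)"
      using B union(1) by (intro finite_measure_UNION) auto
    then have summ: "summable (\<lambda>i. prob (B i))" by (simp add: sums_iff)
    moreover have "prob A * prob (\<Union>i. B i) = (\<Sum>i. prob A * prob (B i))"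
      using sums_unique[OF sums_mult[OF sums]] by simp
    \<comment> \<open>Tannery's theorem is dominated convergence for series; invariance of the
      measure supplies the summable bound \<open>prob (B i)\<close>.\<close>
    moreover have "(\<lambda>n. \<Sum>i. prob (A \<inter> (T ^^ n) -` B i)) \<longlonglongrightarrow> (\<Sum>i. prob A * prob (B i))"
    proof (rule tannerys_theorem[THEN conjunct2, THEN conjunct2])
      show "\<forall>\<^sub>F (i, n) in at_top \<times>\<^sub>F sequentially. norm (prob (A \<inter> (T ^^ n) -` B i)) \<le> prob (B i)"
      proof (intro always_eventually, clarsimp)
        fix i n
        have "prob (A \<inter> (T ^^ n) -` B i) \<le> prob ((T ^^ n) -` B i \<inter> space M)"
          unfolding vim[OF Gs[OF A]] using measurable_sets[OF iter_meas B] by (intro finite_measure_mono) auto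
        then show "prob (A \<inter> (T ^^ n) -` B i) \<le> prob (B i)" by (simp add: prob_vimage_iter B)
      qed
    qed (use union.IH summ in auto)
    ultimately show ?case by simp
  qed
  show "(\<lambda>n. prob (A \<inter> (T ^^ n) -` B)) \<longlonglongrightarrow> prob A * prob B"
    if A: "A \<in> sets M" and B: "B \<in> sets M" for A B
    using G(2,3) A[unfolded G(1)]
  proof (induction A rule: sigma_sets_induct_disjoint)
    case (basic A) with 1 B show ?case unfolding G by blast
  next
    case empty show ?case by simp
  next
    case (compl A)
    then have A: "A \<in> sets M" using G by simp
    have "prob ((space M - A) \<inter> (T ^^ n) -` B) = prob B - prob (A \<inter> (T ^^ n) -` B)" for n
    proof -
      have "(space M - A) \<inter> (T ^^ n) -` B = ((T ^^ n) -` B \<inter> space M) - A \<inter> (T ^^ n) -` B"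
        by blast
      moreover have "A \<inter> (T ^^ n) -` B \<subseteq> (T ^^ n) -` B \<inter> space M"
        using sets.sets_into_space[OF A] by blast
      ultimately show ?thesis
        using finite_measure_Diff[OF measurable_sets[OF iter_meas B] vs[OF A B]] by (simp add: prob_vimage_iter B)
    qed
    then have eq: "(\<lambda>n. prob ((space M - A) \<inter> (T ^^ n) -` B)) = (\<lambda>n. prob B - prob (A \<inter> (T ^^ n) -` B))"
      by (rule ext)
    show ?case
      unfolding eq prob_compl[OF A] left_diff_distrib mult_1_left
      by (intro tendsto_diff tendsto_const compl.IH)
  next
    case (union A)
    then have A: "A i \<in> sets M" for i using G by auto
    have "prob ((\<Union>i. A i) \<inter> (T ^^ n) -` B) = (\<Sum>i. prob (A i \<inter> (T ^^ n) -` B))" for n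
    proof -
      have "(\<lambda>i. prob (A i \<inter> (T ^^ n) -` B)) sums prob (\<Union>i. A i \<inter> (T ^^ n) -` B)"
        using vs[OF A B] union(1) by (intro finite_measure_UNION) (auto simp: disjoint_family_on_def, blast)
      then show ?thesis by (simp add: sums_iff)
    qed
    moreover have sums: "(\<lambda>i. prob (A i)) sums prob (\<Union>i. A i)"
      using A union(1) by (intro finite_measure_UNION) auto
    then have summ: "summable (\<lambda>i. prob (A i))" by (simp add: sums_iff)
    moreover have "prob (\<Union>i. A i) * prob B = (\<Sum>i. prob (A i) * prob B)"
      using sums_unique[OF sums_mult2[OF sums]] by simp
    moreover have "(\<lambda>n. \<Sum>i. prob (A i \<inter> (T ^^ n) -` B)) \<longlonglongrightarrow> (\<Sum>i. prob (A i) * prob B)"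
    proof (rule tannerys_theorem[THEN conjunct2, THEN conjunct2])
      show "\<forall>\<^sub>F (i, n) in at_top \<times>\<^sub>F sequentially. norm (prob (A i \<inter> (T ^^ n) -` B)) \<le> prob (A i)"
        by (intro always_eventually) (auto intro!: finite_measure_mono A)
    qed (use union.IH summ in auto)
    ultimately show ?case by simp
  qed
qed

context mixing_map
begin

text \<open>One-sided invariance suffices: the preimages of \<open>A\<close> lie in \<open>A\<close>
  and have the same probability p, so mixing of \<open>A\<close> with itself forces p = p *
  p.\<close>

lemma prob_01_of_invariant:
  assumes A: "A \<in> sets M" and inv: "\<And>w. w \<in> space M \<Longrightarrow> T w \<in> A \<Longrightarrow> w \<in> A"
  shows "prob A = 0 \<or> prob A = 1"
proof -
  have "(T ^^ n) w \<in> A \<Longrightarrow> w \<in> space M \<Longrightarrow> w \<in> A" for w n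
  proof (induction n arbitrary: w)
    case (Suc n)
    from Suc.prems have "(T ^^ n) (T w) \<in> A" by (simp add: funpow_swap1)
    with Suc.IH[of "T w"] have "T w \<in> A" using Suc.prems measurable_space[OF T_meas] by blast
    with inv Suc.prems show ?case by blast
  qed simp
  then have "A \<inter> (T ^^ n) -` A = (T ^^ n) -` A \<inter> space M" for n
    using sets.sets_into_space[OF A] by blast
  then have "(\<lambda>n. prob (A \<inter> (T ^^ n) -` A)) = (\<lambda>_. prob A)"
    by (simp add: prob_vimage_iter A)
  with mixing[OF A A] have "prob A = prob A * prob A"
    by (metis LIMSEQ_unique tendsto_const)
  then show ?thesis by auto
qed

lemma mixing_map_iter:
  assumes "k \<ge> 1" shows "mixing_map M (T ^^ k)"
proof
  fix A B assume A: "A \<in> sets M" and B: "B \<in> sets M"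
  have "strict_mono (\<lambda>n. k * n)" using assms by (auto simp: strict_mono_def)
  from LIMSEQ_subseq_LIMSEQ[OF mixing[OF A B] this]
  show "(\<lambda>n. prob (A \<inter> ((T ^^ k) ^^ n) -` B)) \<longlonglongrightarrow> prob A * prob B"
    by (simp add: comp_def funpow_mult)
qed (auto simp: distr_iter)

text \<open>A zero-one law combined with the covering bound. If \<open>u n\<close> exceeded
  \<open>b * n\<close> infinitely often almost surely for some \<open>b > G\<close>, almost every
  point would start a good block, and covering long segments by such blocks would push the mean
  growth above \<open>G\<close>.\<close>

lemma superadditive_eventually_le:
  assumes u0: "\<And>w. w \<in> space M \<Longrightarrow> u 0 w = 0"
    and super: "\<And>m n w. w \<in> space M \<Longrightarrow> u m w + u n ((T ^^ m) w) \<le> u (m + n) w"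
    and u1: "\<And>w. w \<in> space M \<Longrightarrow> - d w \<le> u 1 w" and d: "\<And>w. w \<in> space M \<Longrightarrow> 0 \<le> d w"
    and int: "\<And>n. integrable M (u n)" and dint: "integrable M d"
    and G: "\<And>n. expectation (u n) \<le> G * real n" and c: "G < c"
  shows "AE w in M. \<forall>\<^sub>F n in sequentially. (u n w :: real) \<le> c * real n"
proof -
  note [measurable] = borel_measurable_integrable[OF int] borel_measurable_integrable[OF dint]
  define b where "b = (G + c) / 2"
  have b: "G < b" "b < c" using c by (auto simp: b_def)
  \<comment> \<open>The event that the upper limit of \<open>u n / n\<close> exceeds the midpoint
    \<open>b\<close>. The margin \<open>1 / Suc m\<close> gives room for invariance: passing to
    \<open>Suc m\<close> frees a multiple of \<open>n\<close>, which outweighs the loss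
    \<open>d w\<close> of one step.\<close>
  define A where "A = {w \<in> space M. \<exists>m::nat. \<forall>N. \<exists>n\<ge>N. (b + 1 / Suc m) * real n < u n w}"
  have A [measurable]: "A \<in> sets M" unfolding A_def by measurable
  have "prob A = 0 \<or> prob A = 1"
  proof (rule prob_01_of_invariant[OF A])
    fix w assume w: "w \<in> space M" and "T w \<in> A"
    then obtain m :: nat where m: "\<And>N. \<exists>n\<ge>N. (b + 1 / Suc m) * real n < u n (T w)"
      by (auto simp: A_def)
    have "\<exists>n\<ge>N. (b + 1 / Suc (Suc m)) * real n < u n w" for N
    proof -
      define e where "e = 1 / Suc m - 1 / Suc (Suc m)"
      have e: "e > 0" by (simp add: e_def frac_less2)
      obtain N0 :: nat where N0: "(d w + b + 1 / Suc (Suc m)) / e < N0" using reals_Archimedean2 by blast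
      obtain n where n: "n \<ge> max N N0" "(b + 1 / Suc m) * real n < u n (T w)" using m by blast
      have "d w + b + 1 / Suc (Suc m) < e * N0"
        using N0[unfolded pos_divide_less_eq[OF e]] by (simp only: mult.commute)
      also have "\<dots> \<le> e * n" using n e by (intro mult_left_mono) auto
      finally have "d w + b + 1 / Suc (Suc m) < (1 / Suc m - 1 / Suc (Suc m)) * n" by (simp add: e_def)
      moreover have arith: "d w + b + q < (p - q) * n \<Longrightarrow> (b + q) * real (Suc n) < (b + p) * n - d w" for p q :: real
        by (simp add: algebra_simps)
      ultimately have "(b + 1 / Suc (Suc m)) * real (Suc n) < (b + 1 / Suc m) * real n - d w"
        by blast
      also have "\<dots> < u n (T w) + u 1 w" using n(2) u1[OF w] by simp
      also have "\<dots> \<le> u (Suc n) w" using super[OF w, of 1 n] by simp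
      finally show ?thesis
        using n by (intro exI[of _ "Suc n"]) auto
    qed
    then show "w \<in> A" unfolding A_def using w by blast
  qed
  moreover have "prob A \<noteq> 1"
  proof
    assume "prob A = 1"
    then have AA: "AE w in M. w \<in> A" using prob_eq_1[OF A] by simp
    \<comment> \<open>Points that start no good block of length at most \<open>N\<close>. They
      decrease to a null set as \<open>N\<close> grows.\<close>
    define B where "B N = {w \<in> space M. \<forall>n\<in>{1..N}. u n w < b * real n}" for N
    have B [measurable]: "B N \<in> sets M" for N unfolding B_def by measurable
    let ?D = "\<lambda>w. \<bar>b\<bar> + d w"
    define \<delta> where "\<delta> = expectation ?D"
    define \<beta> where "\<beta> N = (\<integral>w. indicator (B N) w * ?D w \<partial>M)" for N
    have Dint: "integrable M ?D" using dint by simp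
    have BDint: "integrable M (\<lambda>w. indicator (B N) w * ?D w)" for N
      by (rule Bochner_Integration.integrable_bound[OF Dint])
        (auto simp: indicator_def d intro!: AE_I2)
    \<comment> \<open>The covering bound in expectation: bad points cost \<open>\<beta> N\<close>
      per unit length, while the final stretch costs at most \<open>N * \<delta>\<close> in total
      and vanishes after division by a large \<open>K\<close>.\<close>
    have main: "b - \<beta> N \<le> G" for N
    proof (rule field_le_epsilon)
      fix e :: real assume e: "0 < e"
      obtain K :: nat where K: "K > N * \<delta> / e" "K \<ge> 1"
        using reals_Archimedean2[of "max 1 (N * \<delta> / e)"]
        by (metis max_less_iff_conj of_nat_1 of_nat_less_iff less_imp_le)
      let ?t = "\<lambda>w i. (indicator (B N) ((T ^^ i) w) + of_bool (K \<le> i + N)) * ?D ((T ^^ i) w) :: real"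
      have t_eq: "?t w i = indicator (B N) ((T ^^ i) w) * ?D ((T ^^ i) w) + of_bool (K \<le> i + N) * ?D ((T ^^ i) w)" for w i
        by (simp add: distrib_right)
      have i1: "integrable M (\<lambda>w. indicator (B N) ((T ^^ i) w) * ?D ((T ^^ i) w))"
        and i2: "integrable M (\<lambda>w. ?D ((T ^^ i) w))" for i
        using integrable_iter[OF BDint] integrable_iter[OF Dint] by auto
      have tint: "integrable M (\<lambda>w. ?t w i)" for i
        unfolding t_eq by (rule Bochner_Integration.integrable_add[OF i1 integrable_mult_right[OF i2]])
      have tE: "(\<integral>w. ?t w i \<partial>M) = \<beta> N + of_bool (K \<le> i + N) * \<delta>" for i
      proof -
        have "(\<integral>w. ?t w i \<partial>M) = (\<integral>w. indicator (B N) ((T ^^ i) w) * ?D ((T ^^ i) w) \<partial>M)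
           + (\<integral>w. of_bool (K \<le> i + N) * ?D ((T ^^ i) w) \<partial>M)"
          unfolding t_eq by (rule Bochner_Integration.integral_add[OF i1 integrable_mult_right[OF i2]])
        moreover have "(\<integral>w. indicator (B N) ((T ^^ i) w) * ?D ((T ^^ i) w) \<partial>M) = \<beta> N"
          unfolding \<beta>_def by (rule integral_iter) measurable
        moreover have "(\<integral>w. ?D ((T ^^ i) w) \<partial>M) = \<delta>"
          unfolding \<delta>_def by (rule integral_iter) measurable
        ultimately show ?thesis by simp
      qed
      have "b * K - (\<Sum>i<K. \<beta> N + of_bool (K \<le> i + N) * \<delta>) = (\<integral>w. b * K - (\<Sum>i<K. ?t w i) \<partial>M)"
        using tint by (simp add: Bochner_Integration.integral_diff Bochner_Integration.integral_sum tE prob_space)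
      also have "\<dots> \<le> expectation (u K)"
      proof (rule integral_mono)
        fix w assume w: "w \<in> space M"
        show "b * K - (\<Sum>i<K. ?t w i) \<le> u K w"
        proof (rule superadditive_covering[OF u0 super u1 d _ w])
          fix w assume "w \<in> space M" "w \<notin> B N"
          then show "\<exists>n\<in>{1..N}. b * real n \<le> u n w" by (auto simp: B_def not_less)
        qed
      qed (use tint int in auto)
      finally have "b * K - (K * \<beta> N + (\<Sum>i<K. of_bool (K \<le> i + N) * \<delta>)) \<le> G * K"
        using G[of K] by (simp add: sum.distrib)
      moreover have "(\<Sum>i<K. of_bool (K \<le> i + N) * \<delta>) \<le> N * \<delta>"
      proof -
        have "(\<Sum>i<K. of_bool (K \<le> i + N)) = real (card {i\<in>{..<K}. K \<le> i + N})"
          by (simp add: of_bool_def sum.If_cases Int_def)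
        also have "card {i\<in>{..<K}. K \<le> i + N} \<le> card {K - N..<K}"
          by (rule card_mono) auto
        also have "\<dots> \<le> N" by simp
        finally have "(\<Sum>i<K. of_bool (K \<le> i + N)) \<le> real N" by simp
        moreover have "\<delta> \<ge> 0" unfolding \<delta>_def using d by (intro integral_nonneg_AE AE_I2) auto
        ultimately show ?thesis unfolding sum_distrib_right[symmetric] by (rule mult_right_mono)
      qed
      moreover have "N * \<delta> \<le> e * K" using K e by (simp add: field_simps)
      ultimately have "(b - \<beta> N) * K \<le> (G + e) * K" by (simp add: algebra_simps)
      then show "b - \<beta> N \<le> G + e" using K by simp
    qed
    have "\<beta> \<longlonglongrightarrow> (\<integral>w. 0 \<partial>M)" unfolding \<beta>_def
    proof (rule integral_dominated_convergence[where w = ?D])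
      show "AE w in M. (\<lambda>N. indicator (B N) w * ?D w) \<longlonglongrightarrow> 0" using AA
      proof eventually_elim
        case (elim w)
        then obtain m :: nat where "\<forall>N. \<exists>n\<ge>N. (b + 1 / Suc m) * real n < u n w" by (auto simp: A_def)
        then obtain n where n: "n \<ge> 1" "(b + 1 / Suc m) * real n < u n w" by blast
        then have "b * real n < u n w" by (simp add: algebra_simps) (smt (verit) divide_nonneg_nonneg of_nat_0_le_iff)
        then have "w \<notin> B N" if "N \<ge> n" for N using n that by (force simp: B_def)
        then have "\<forall>\<^sub>F N in sequentially. indicator (B N) w * ?D w = 0"
          unfolding eventually_sequentially by (intro exI[of _ n]) auto
        then show ?case by (rule tendsto_eventually)
      qed
      show "AE w in M. norm (indicator (B N) w * ?D w) \<le> ?D w" for N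
        by (auto simp: indicator_def d intro!: AE_I2)
    qed (use Dint in auto)
    then have "(\<lambda>N. b - \<beta> N) \<longlonglongrightarrow> b - 0" by (intro tendsto_diff tendsto_const) simp
    then have "b - 0 \<le> G" by (rule LIMSEQ_le_const2) (use main in blast)
    with b show False by simp
  qed
  ultimately have "AE w in M. w \<notin> A" using prob_eq_0[OF A] by blast
  then show ?thesis using AE_space
  proof eventually_elim
    case (elim w)
    obtain m :: nat where "1 / Suc m < c - b" using b reals_Archimedean[of "c - b"]
      by (auto simp: inverse_eq_divide)
    then have m: "b + 1 / Suc m \<le> c" by simp
    from elim obtain N where "\<forall>n\<ge>N. u n w \<le> (b + 1 / Suc m) * real n"
      by (auto simp: A_def not_less)
    then show ?case unfolding eventually_sequentially
      using m by (meson mult_right_mono of_nat_0_le_iff order_trans)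
  qed
qed

text \<open>Both halves come from \<open>superadditive_eventually_le\<close>: the lower one applied
  to \<open>- g\<close>, the upper one to the Birkhoff sums of \<open>g k\<close> along
  \<open>T ^^ k\<close>, which dominate \<open>g (j * k)\<close> and are additive, hence
  superadditive.\<close>

theorem subadditive_ergodic:
  fixes g :: "nat \<Rightarrow> 'a \<Rightarrow> real"
  assumes g0: "\<And>w. w \<in> space M \<Longrightarrow> g 0 w = 0"
    and nonneg: "\<And>n w. w \<in> space M \<Longrightarrow> 0 \<le> g n w"
    and sub: "\<And>m n w. w \<in> space M \<Longrightarrow> g (m + n) w \<le> g m w + g n ((T ^^ m) w)"
    and int: "\<And>n. integrable M (g n)"
  defines "L \<equiv> INF n\<in>{1..}. expectation (g n) / real n"
  shows "AE w in M. (\<lambda>n. g n w / n) \<longlonglongrightarrow> L"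
    and "(\<lambda>n. expectation (g n) / n) \<longlonglongrightarrow> L"
    and "(\<lambda>n. \<integral>w. \<bar>g n w / n - L\<bar> \<partial>M) \<longlonglongrightarrow> 0"
    and "0 \<le> L"
proof -
  note [measurable] = borel_measurable_integrable[OF int]
  have Eg: "0 \<le> expectation (g n)" for n using nonneg by (intro integral_nonneg_AE AE_I2)
  have bdd: "bdd_below ((\<lambda>n. expectation (g n) / real n) ` {1..})"
    by (rule bdd_belowI2[of _ 0]) (simp add: Eg)
  show L0: "0 \<le> L" unfolding L_def by (rule cINF_greatest) (auto simp: Eg)
  have L_le: "L \<le> expectation (g n) / n" if "n \<ge> 1" for n
    unfolding L_def by (rule cINF_lower[OF bdd]) (use that in auto)
  have Esub: "expectation (g (m + n)) \<le> expectation (g m) + expectation (g n)" for m n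
  proof -
    have "expectation (g (m + n)) \<le> expectation (\<lambda>w. g m w + g n ((T ^^ m) w))"
      by (rule integral_mono) (use sub int integrable_iter in auto)
    also have "\<dots> = expectation (g m) + expectation (g n)"
      using int integrable_iter integral_iter[of "g n" m] by (subst Bochner_Integration.integral_add) auto
    finally show ?thesis .
  qed
  show EL: "(\<lambda>n. expectation (g n) / n) \<longlonglongrightarrow> L"
    using almost_subadditive_tendsto[of "\<lambda>n. expectation (g n)" 0] Esub Eg by (simp add: L_def)

  have lower: "AE w in M. \<forall>\<^sub>F n in sequentially. c * n \<le> g n w" if "c < L" for c :: real
  proof -
    have "AE w in M. \<forall>\<^sub>F n in sequentially. - g n w \<le> (- c) * real n"
    proof (rule superadditive_eventually_le[of "\<lambda>n w. - g n w" "g 1" "- L"])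
      show "expectation (\<lambda>w. - g n w) \<le> - L * real n" for n
      proof (cases "n = 0")
        case True
        have "expectation (g 0) = expectation (\<lambda>_. 0)" by (rule Bochner_Integration.integral_cong) (auto simp: g0)
        with True show ?thesis by simp
      next
        case False then show ?thesis using L_le[of n] by (simp add: field_simps)
      qed
      show "- g m w + - g n ((T ^^ m) w) \<le> - g (m + n) w" if "w \<in> space M" for m n w
        using sub[OF that, of m n] by simp
    qed (use g0 nonneg int that in auto)
    then show ?thesis by simp
  qed

  have upper: "AE w in M. \<forall>\<^sub>F n in sequentially. g n w \<le> c * n" if "L < c" for c :: real
  proof -
    have "\<exists>k\<in>{1..}. expectation (g k) / real k < c"
      using that cINF_less_iff[OF _ bdd] unfolding L_def by auto
    then obtain k :: nat where k: "k \<ge> 1" "expectation (g k) / k < c" by auto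
    obtain b where b: "expectation (g k) / k < b" "b < c" using k(2) dense by blast
    interpret k: mixing_map M "T ^^ k" by (rule mixing_map_iter[OF k(1)])
    define u where "u j w = (\<Sum>i<j. g k (((T ^^ k) ^^ i) w))" for j w
    have "AE w in M. \<forall>\<^sub>F j in sequentially. u j w \<le> (k * b) * real j"
    proof (rule k.superadditive_eventually_le[of u "\<lambda>_. 0" "expectation (g k)"])
      show "u m w + u n (((T ^^ k) ^^ m) w) \<le> u (m + n) w" for m n w
        unfolding u_def by (subst sum_shift_block[of m "m + n"]) (auto simp: funpow_add)
      show "- 0 \<le> u 1 w" if "w \<in> space M" for w using nonneg that by (simp add: u_def)
      show "integrable M (u n)" for n unfolding u_def by (intro Bochner_Integration.integrable_sum k.integrable_iter int)
      show "expectation (u n) \<le> expectation (g k) * real n" for n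
        unfolding u_def by (simp add: Bochner_Integration.integral_sum k.integrable_iter int k.integral_iter)
      show "expectation (g k) < k * b" using b k by (simp add: field_simps)
    qed (auto simp: u_def)
    then have "AE w in M. \<forall>r\<in>{..<k}. \<forall>\<^sub>F j in sequentially. u j ((T ^^ r) w) \<le> (k * b) * real j"
      by (intro AE_finite_allI AE_iter) auto
    then show ?thesis using AE_space
    proof eventually_elim
      case (elim w)
      have gu: "g (j * k) w \<le> u j w" if "w \<in> space M" for j w
        using that
      proof (induction j arbitrary: w)
        case 0 then show ?case using g0 by (simp add: u_def)
      next
        case (Suc j)
        have "g (Suc j * k) w \<le> g k w + g (j * k) ((T ^^ k) w)" using sub[OF Suc.prems, of k "j * k"] by simp
        also have "g (j * k) ((T ^^ k) w) \<le> u j ((T ^^ k) w)" by (rule Suc.IH[OF iter_space[OF Suc.prems]])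
        also have "g k w + u j ((T ^^ k) w) = u (Suc j) w"
          unfolding u_def sum.lessThan_Suc_shift by (simp add: funpow_swap1)
        finally show ?case by simp
      qed
      from elim(1) have "\<forall>\<^sub>F j in sequentially. \<forall>r\<in>{..<k}. u j ((T ^^ r) w) \<le> (k * b) * real j"
        by (intro eventually_ball_finite) auto
      then obtain J where J: "\<And>j r. j \<ge> J \<Longrightarrow> r < k \<Longrightarrow> u j ((T ^^ r) w) \<le> (k * b) * real j"
        unfolding eventually_sequentially by auto
      \<comment> \<open>The remainder \<open>n mod k\<close> is split off at the front of the orbit.
        There \<open>g r w\<close> has a bound independent of \<open>n\<close>; at the far end it
        would be evaluated at a moving point.\<close>
      define C where "C = (\<Sum>r<k. g r w)"
      obtain N :: nat where N: "C / (c - b) < N" using reals_Archimedean2 by blast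
      show ?case unfolding eventually_sequentially
      proof (intro exI allI impI)
        fix n assume n: "n \<ge> max (J * k) N"
        define j where "j = n div k"
        define r where "r = n mod k"
        have njr: "n = r + j * k" by (simp add: j_def r_def)
        have r: "r < k" using k by (simp add: r_def)
        have jJ: "j \<ge> J" using n k unfolding j_def by (simp add: less_eq_div_iff_mult_less_eq)
        have "g n w \<le> g r w + g (j * k) ((T ^^ r) w)" unfolding njr by (rule sub[OF elim(2)])
        also have "g r w \<le> C" unfolding C_def using r nonneg[OF elim(2)] by (intro member_le_sum) auto
        also have "g (j * k) ((T ^^ r) w) \<le> u j ((T ^^ r) w)" by (rule gu[OF iter_space[OF elim(2)]])
        also have "\<dots> \<le> (k * b) * real j" by (rule J[OF jJ r])
        also have "\<dots> \<le> b * n"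
        proof -
          have "0 < b" using b Eg[of k] by (smt (verit) divide_nonneg_nonneg of_nat_0_le_iff)
          then show ?thesis using njr by (simp add: algebra_simps)
        qed
        also have "C \<le> (c - b) * n"
        proof -
          have "C < (c - b) * N" using N b by (simp add: field_simps)
          also have "\<dots> \<le> (c - b) * n" using n b by (intro mult_left_mono) auto
          finally show ?thesis by simp
        qed
        finally show "g n w \<le> c * n" by (simp add: algebra_simps)
      qed
    qed
  qed

  have "AE w in M. \<forall>m::nat. (\<forall>\<^sub>F n in sequentially. (L - 1 / Suc m) * n \<le> g n w) \<and>
      (\<forall>\<^sub>F n in sequentially. g n w \<le> (L + 1 / Suc m) * n)"
    by (subst AE_all_countable) (auto intro!: AE_conjI lower upper)
  then show conv: "AE w in M. (\<lambda>n. g n w / n) \<longlonglongrightarrow> L"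
  proof eventually_elim
    case (elim w)
    show ?case
    proof (rule tendstoI)
      fix e :: real assume "0 < e"
      then obtain m :: nat where m: "1 / Suc m < e" using reals_Archimedean by (auto simp: inverse_eq_divide)
      show "\<forall>\<^sub>F n in sequentially. dist (g n w / n) L < e"
        using elim[rule_format, of m, THEN conjunct1] elim[rule_format, of m, THEN conjunct2] eventually_gt_at_top[of 0]
      proof eventually_elim
        case (elim n)
        then have "L - 1 / Suc m \<le> g n w / n" "g n w / n \<le> L + 1 / Suc m"
          by (simp_all add: pos_le_divide_eq pos_divide_le_eq)
        with m show ?case by (auto simp: dist_real_def abs_le_iff)
      qed
    qed
  qed

  \<comment> \<open>Since |y - L| = (y - L) + 2 max 0 (L - y), convergence of the means handles the
    first term. The second lies between 0 and \<open>L\<close> by nonnegativity of \<open>g\<close>,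
    so dominated convergence applies.\<close>
  let ?p = "\<lambda>n w. max 0 (L - g n w / n)"
  have pint: "integrable M (?p n)" for n using int by (intro integrable_max) auto
  have "(\<lambda>n. expectation (?p n)) \<longlonglongrightarrow> expectation (\<lambda>_. 0)"
  proof (rule integral_dominated_convergence[where w = "\<lambda>_. L"])
    show "AE w in M. (\<lambda>n. ?p n w) \<longlonglongrightarrow> 0" using conv
    proof eventually_elim
      case (elim w)
      have "(\<lambda>n. max 0 (L - g n w / n)) \<longlonglongrightarrow> max 0 (L - L)" by (intro tendsto_intros elim)
      then show ?case by simp
    qed
    show "AE w in M. norm (?p n w) \<le> L" for n using nonneg L0 by (auto intro!: AE_I2)
  qed auto
  then have "(\<lambda>n. expectation (g n) / n - L + 2 * expectation (?p n)) \<longlonglongrightarrow> L - L + 2 * 0"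
    using EL by (intro tendsto_intros) auto
  moreover have "(\<integral>w. \<bar>g n w / n - L\<bar> \<partial>M) = expectation (g n) / n - L + 2 * expectation (?p n)" for n
  proof -
    have "(\<integral>w. \<bar>g n w / n - L\<bar> \<partial>M) = (\<integral>w. (g n w / n - L) + 2 * ?p n w \<partial>M)"
      by (rule Bochner_Integration.integral_cong) (auto simp: max_def abs_if)
    also have "\<dots> = expectation (g n) / n - L + 2 * expectation (?p n)"
      using int[of n] pint[of n] by (simp add: prob_space)
    finally show ?thesis .
  qed
  ultimately show "(\<lambda>n. \<integral>w. \<bar>g n w / n - L\<bar> \<partial>M) \<longlonglongrightarrow> 0" by simp
qed

end

section \<open>Mixing of product maps and of lattice shifts\<close>

lemma mixing_map_pair:
  assumes "mixing_map M S" and "mixing_map N T"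
  shows "mixing_map (M \<Otimes>\<^sub>M N) (\<lambda>(x, y). (S x, T y))"
proof -
  interpret M: mixing_map M S by fact
  interpret N: mixing_map N T by fact
  interpret P: pair_prob_space M N ..
  let ?U = "\<lambda>(x, y). (S x, T y)"
  interpret U: measure_preserving "M \<Otimes>\<^sub>M N" ?U
  proof
    show "distr (M \<Otimes>\<^sub>M N) (M \<Otimes>\<^sub>M N) ?U = M \<Otimes>\<^sub>M N"
      using pair_measure_distr[OF M.T_meas N.T_meas] by (simp add: M.distr_T N.distr_T N.sigma_finite_measure_axioms)
  qed simp
  have times: "measure (M \<Otimes>\<^sub>M N) (A \<times> B) = measure M A * measure N B" if "A \<in> sets M" "B \<in> sets N" for A B
    using N.emeasure_pair_measure_Times[OF that] by (simp add: measure_def enn2real_mult)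
  have iter: "(?U ^^ n) (x, y) = ((S ^^ n) x, (T ^^ n) y)" for n x y
    by (induction n) auto
  \<comment> \<open>Measurable rectangles form a generating pi-system on which iterates act
    coordinatewise, so the two mixing limits multiply.\<close>
  show ?thesis
  proof (rule U.mixing_mapI)
    let ?G = "{a \<times> b | a b. a \<in> sets M \<and> b \<in> sets N}"
    show "sets (M \<Otimes>\<^sub>M N) = sigma_sets (space (M \<Otimes>\<^sub>M N)) ?G"
      by (simp add: sets_pair_measure space_pair_measure)
    show "Int_stable ?G" by (rule Int_stable_pair_measure_generator)
    show "?G \<subseteq> Pow (space (M \<Otimes>\<^sub>M N))" using pair_measure_closed[of M N] unfolding space_pair_measure .
    fix X Y assume "X \<in> ?G" "Y \<in> ?G"
    then obtain A B A' B' where XY: "X = A \<times> B" "Y = A' \<times> B'"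
      and [simp]: "A \<in> sets M" "B \<in> sets N" "A' \<in> sets M" "B' \<in> sets N" by auto
    have "X \<inter> (?U ^^ n) -` Y = (A \<inter> (S ^^ n) -` A') \<times> (B \<inter> (T ^^ n) -` B')" for n
      unfolding XY by (auto simp: iter)
    moreover have "A \<inter> (S ^^ n) -` A' \<in> sets M" for n
    proof -
      have "A \<inter> (S ^^ n) -` A' = A \<inter> ((S ^^ n) -` A' \<inter> space M)" using sets.sets_into_space[of A M] by auto
      then show ?thesis using measurable_sets[OF M.iter_meas, of A' n] by (simp only: sets.Int[OF \<open>A \<in> sets M\<close>] \<open>A' \<in> sets M\<close>)
    qed
    moreover have "B \<inter> (T ^^ n) -` B' \<in> sets N" for n
    proof -
      have "B \<inter> (T ^^ n) -` B' = B \<inter> ((T ^^ n) -` B' \<inter> space N)" using sets.sets_into_space[of B N] by auto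
      then show ?thesis using measurable_sets[OF N.iter_meas, of B' n] by (simp only: sets.Int[OF \<open>B \<in> sets N\<close>] \<open>B' \<in> sets N\<close>)
    qed
    ultimately have "measure (M \<Otimes>\<^sub>M N) (X \<inter> (?U ^^ n) -` Y) =
        measure M (A \<inter> (S ^^ n) -` A') * measure N (B \<inter> (T ^^ n) -` B')" for n
      by (simp add: times)
    moreover have "(\<lambda>n. measure M (A \<inter> (S ^^ n) -` A') * measure N (B \<inter> (T ^^ n) -` B'))
        \<longlonglongrightarrow> (measure M A * measure M A') * (measure N B * measure N B')"
      by (intro tendsto_mult M.mixing N.mixing) auto
    ultimately show "(\<lambda>n. measure (M \<Otimes>\<^sub>M N) (X \<inter> (?U ^^ n) -` Y)) \<longlonglongrightarrow> measure (M \<Otimes>\<^sub>M N) X * measure (M \<Otimes>\<^sub>M N) Y"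
      unfolding XY by (simp add: times mult_ac)
  qed
qed

definition shift :: "'d::finite site \<Rightarrow> ('d site \<Rightarrow> 'a) \<Rightarrow> 'd site \<Rightarrow> 'a" where
  "shift z w = (\<lambda>x. w (x + z))"

lemma shift_iter: "(shift z ^^ n) w = shift (int n *s z) w"
proof (induction n)
  case (Suc n)
  have "int (Suc n) *s z = int n *s z + z" by (simp add: vec_eq_iff algebra_simps)
  then show ?case using Suc by (simp add: shift_def add_ac)
qed (simp add: shift_def)

lemma measure_preserving_shift:
  assumes "prob_space N"
  shows "measure_preserving (PiM UNIV (\<lambda>_ :: 'd::finite site. N)) (shift z)"
proof -
  interpret prob_space "PiM UNIV (\<lambda>_ :: 'd site. N)" by (intro prob_space_PiM assms)
  show ?thesis
  proof
    show "shift z \<in> PiM UNIV (\<lambda>_ :: 'd site. N) \<rightarrow>\<^sub>M PiM UNIV (\<lambda>_ :: 'd site. N)"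
      unfolding shift_def by (rule measurable_PiM_single') (auto simp: space_PiM measurable_component_singleton)
    show "distr (PiM UNIV (\<lambda>_ :: 'd site. N)) (PiM UNIV (\<lambda>_ :: 'd site. N)) (shift z) = PiM UNIV (\<lambda>_. N)"
      using distr_PiM_reindex[of UNIV "\<lambda>_. N" "\<lambda>x. x + z" UNIV] assms
      by (simp add: shift_def[abs_def] restrict_def)
  qed
qed

text \<open>Cylinders look at finitely many sites, and translation by a large multiple of
  \<open>z\<close> makes two such site sets disjoint. Independence then gives the product exactly
  for all large \<open>n\<close>.\<close>

lemma mixing_map_shift:
  fixes z :: "'d::finite site"
  assumes N: "prob_space N" and z: "z \<noteq> 0"
  shows "mixing_map (PiM UNIV (\<lambda>_ :: 'd site. N)) (shift z)"
proof -
  let ?M = "PiM UNIV (\<lambda>_ :: 'd site. N)"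
  interpret measure_preserving ?M "shift z" by (rule measure_preserving_shift[OF N])
  interpret N: prob_space N by fact
  interpret PP: product_prob_space "\<lambda>_ :: 'd site. N" UNIV ..
  show ?thesis
  proof (rule mixing_mapI)
    let ?G = "prod_algebra UNIV (\<lambda>_ :: 'd site. N)"
    show "sets ?M = sigma_sets (space ?M) ?G" by (simp add: sets_PiM space_PiM)
    show "Int_stable ?G" by (rule Int_stable_prod_algebra)
    show "?G \<subseteq> Pow (space ?M)" using prod_algebra_sets_into_space by (simp add: space_PiM)
    fix A B assume "A \<in> ?G" "B \<in> ?G"
    then obtain J E K F where A: "A = prod_emb UNIV (\<lambda>_. N) J (Pi\<^sub>E J E)" "finite J" "\<And>i. i \<in> J \<Longrightarrow> E i \<in> sets N"
      and B: "B = prod_emb UNIV (\<lambda>_. N) K (Pi\<^sub>E K F)" "finite K" "\<And>i. i \<in> K \<Longrightarrow> F i \<in> sets N"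
      by (elim prod_algebraE) metis
    have pA: "measure ?M A = (\<Prod>i\<in>J. measure N (E i))"
      using A by (simp add: PP.measure_PiM_emb)
    have pB: "measure ?M B = (\<Prod>i\<in>K. measure N (F i))"
      using B by (simp add: PP.measure_PiM_emb)
    \<comment> \<open>The site sets overlap only if \<open>int n *s z\<close> is one of finitely
      many differences, and distinct \<open>n\<close> give distinct multiples because
      \<open>z\<close> is nonzero.\<close>
    have "finite ((\<lambda>n. int n *s z) -` ((\<lambda>(j, k). j - k) ` (J \<times> K)))"
    proof (rule finite_vimageI)
      obtain i where "z $ i \<noteq> 0" using z by (metis vec_eq_iff zero_index)
      then show "inj (\<lambda>n. int n *s z)"
        by (intro injI) (metis mult_cancel_right of_nat_eq_iff vector_smult_component)
    qed (use A B in auto)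
    then have "\<forall>\<^sub>F n in sequentially. n \<notin> (\<lambda>n. int n *s z) -` ((\<lambda>(j, k). j - k) ` (J \<times> K))"
      unfolding cofinite_eq_sequentially[symmetric] eventually_cofinite not_not Collect_mem_eq .
    then have "\<forall>\<^sub>F n in sequentially. prob A * prob B = prob (A \<inter> (shift z ^^ n) -` B)"
    proof eventually_elim
      case (elim n)
      let ?s = "\<lambda>k. k + int n *s z"
      define K' where "K' = ?s ` K"
      \<comment> \<open>The sides of the merged cylinder over \<open>J\<close> and
        \<open>K'\<close>.\<close>
      define H where "H x = (if x \<in> J then E x else F (x - int n *s z))" for x
      have disj: "x \<notin> K'" if "x \<in> J" for x
        using elim that by (force simp: K'_def image_iff)
      have "finite K'" using B by (simp add: K'_def)
      have sp: "E i \<subseteq> space N" if "i \<in> J" for i using A that sets.sets_into_space by blast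
      have sp': "F i \<subseteq> space N" if "i \<in> K" for i using B that sets.sets_into_space by blast
      have "A \<inter> (shift z ^^ n) -` B = prod_emb UNIV (\<lambda>_. N) (J \<union> K') (Pi\<^sub>E (J \<union> K') H)"
        (is "?L = ?R")
      proof (rule set_eqI)
        fix w
        have "w \<in> ?L \<longleftrightarrow> (\<forall>x. w x \<in> space N) \<and> (\<forall>j\<in>J. w j \<in> E j) \<and> (\<forall>k\<in>K. w (?s k) \<in> F k)"
          unfolding A B by (auto simp: prod_emb_def shift_iter shift_def PiE_iff)
        also have "\<dots> \<longleftrightarrow> w \<in> ?R"
        proof -
          have "(\<forall>x\<in>J \<union> K'. w x \<in> H x) \<longleftrightarrow> (\<forall>j\<in>J. w j \<in> E j) \<and> (\<forall>k\<in>K'. w k \<in> H k)"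
            by (auto simp: H_def)
          moreover have "(\<forall>k\<in>K'. w k \<in> H k) \<longleftrightarrow> (\<forall>k\<in>K. w (?s k) \<in> F k)"
            using disj by (auto simp: H_def K'_def)
          moreover have "w \<in> ?R \<longleftrightarrow> (\<forall>x. w x \<in> space N) \<and> (\<forall>x\<in>J \<union> K'. w x \<in> H x)"
            by (auto simp: prod_emb_def PiE_iff)
          ultimately show ?thesis by simp
        qed
        finally show "w \<in> ?L \<longleftrightarrow> w \<in> ?R" .
      qed
      moreover have Hs: "H x \<in> sets N" if "x \<in> J \<union> K'" for x
        using that A B by (auto simp: H_def K'_def)
      ultimately have "prob (A \<inter> (shift z ^^ n) -` B) = (\<Prod>i\<in>J \<union> K'. measure N (H i))"
        using A(2) \<open>finite K'\<close> by (simp only: PP.measure_PiM_emb subset_UNIV finite_Un)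
      also have "\<dots> = (\<Prod>i\<in>J. measure N (H i)) * (\<Prod>i\<in>K'. measure N (H i))"
        using A \<open>finite K'\<close> disj by (intro prod.union_disjoint) auto
      also have "(\<Prod>i\<in>J. measure N (H i)) = prob A" unfolding pA by (simp add: H_def)
      also have "(\<Prod>i\<in>K'. measure N (H i)) = prob B"
      proof -
        have "H (?s k) = F k" if "k \<in> K" for k using disj that by (auto simp: H_def K'_def)
        then show ?thesis unfolding pB K'_def by (subst prod.reindex) (auto simp: inj_on_def)
      qed
      finally show ?case by simp
    qed
    then show "(\<lambda>n. prob (A \<inter> (shift z ^^ n) -` B)) \<longlonglongrightarrow> prob A * prob B"
      by (rule Lim_transform_eventually[OF tendsto_const])
  qed
qed

text \<open>The integrand sees only the coordinates in \<open>J\<close>, so restriction carries the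
  integral to a finite product, where it factorises.\<close>

lemma nn_integral_PiM_prod:
  assumes M: "\<And>i. prob_space (M i)" and J: "finite J"
    and f: "\<And>i. i \<in> J \<Longrightarrow> f i \<in> borel_measurable (M i)"
  shows "(\<integral>\<^sup>+x. (\<Prod>i\<in>J. f i (x i)) \<partial>PiM UNIV M) = (\<Prod>i\<in>J. \<integral>\<^sup>+x. f i x \<partial>M i)"
proof -
  interpret product_prob_space M UNIV
    by (simp add: product_prob_space_def product_prob_space_axioms_def product_sigma_finite_def
        M prob_space_imp_sigma_finite)
  have meas: "(\<lambda>x. \<Prod>i\<in>J. f i (x i)) \<in> borel_measurable (Pi\<^sub>M J M)"
  proof (rule borel_measurable_prod_ennreal)
    fix i assume "i \<in> J"
    then show "(\<lambda>x. f i (x i)) \<in> borel_measurable (Pi\<^sub>M J M)"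
      by (rule measurable_compose[OF measurable_component_singleton]) (rule f[OF \<open>i \<in> J\<close>])
  qed
  have "(\<lambda>x. restrict x J) \<in> PiM UNIV M \<rightarrow>\<^sub>M PiM J M" by (rule measurable_restrict_subset) simp
  from nn_integral_distr[OF this, of "\<lambda>x. \<Prod>i\<in>J. f i (x i)"] meas
  have "(\<integral>\<^sup>+x. (\<Prod>i\<in>J. f i (x i)) \<partial>PiM UNIV M) = (\<integral>\<^sup>+x. (\<Prod>i\<in>J. f i (x i)) \<partial>PiM J M)"
    by (simp add: distr_PiM_restrict_finite J cong: prod.cong)
  then show ?thesis
    using product_nn_integral_prod[OF J f] by simp
qed

section \<open>Hitting probabilities of the walk\<close>

lemma finite_unit_steps: "finite (unit_steps :: 'd::finite site set)"
proof (rule finite_subset)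
  have "\<bar>e $ i\<bar> \<le> 1" if "e \<in> unit_steps" for e :: "'d site" and i
  proof -
    have "\<bar>real_of_int (e $ i)\<bar> \<le> (\<Sum>j\<in>UNIV. \<bar>real_of_int (e $ j)\<bar>)"
      by (rule member_le_sum) auto
    then show ?thesis using that by (simp add: unit_steps_def l1norm_def embed_def)
  qed
  then show "(unit_steps :: 'd site set) \<subseteq> vec_lambda ` (UNIV \<rightarrow>\<^sub>E {-1..1})"
    by (auto simp: image_iff PiE_def abs_le_iff intro!: bexI[of _ "vec_nth _"])
  show "finite (vec_lambda ` ((UNIV :: 'd set) \<rightarrow>\<^sub>E {-1..1::int}))"
    by (intro finite_imageI finite_PiE) auto
qed

text \<open>Serves to compute path integrals from cylinder probabilities: the law of a
  countable-valued map has a density with respect to counting measure.\<close>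

lemma nn_integral_countable_image:
  fixes K :: "'a \<Rightarrow> 'b::countable"
  assumes K: "K \<in> M \<rightarrow>\<^sub>M count_space UNIV"
  shows "(\<integral>\<^sup>+w. h (K w) \<partial>M) = (\<integral>\<^sup>+k. h k * emeasure M {w \<in> space M. K w = k} \<partial>count_space UNIV)"
proof -
  let ?D = "distr M (count_space UNIV) K"
  have e: "emeasure ?D {k} = emeasure M {w \<in> space M. K w = k}" for k
    using K by (subst emeasure_distr) (auto intro!: arg_cong[where f = "emeasure M"])
  have "?D = density (count_space UNIV) (\<lambda>k. emeasure ?D {k})"
    by (rule measure_eqI_countable[where A = UNIV]) (auto simp: emeasure_density)
  then have "(\<integral>\<^sup>+k. h k \<partial>?D) = (\<integral>\<^sup>+k. h k \<partial>density (count_space UNIV) (\<lambda>k. emeasure ?D {k}))"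
    by (rule arg_cong)
  also have "\<dots> = (\<integral>\<^sup>+k. h k * emeasure M {w \<in> space M. K w = k} \<partial>count_space UNIV)"
    by (subst nn_integral_density) (auto simp: e mult.commute)
  finally show ?thesis using K by (subst (asm) nn_integral_distr) auto
qed

definition laplace :: "real \<Rightarrow> ('d::finite site \<Rightarrow> real measure) \<Rightarrow> 'd site \<Rightarrow> real" where
  "laplace lam \<sigma> x = (\<integral>s. exp (- lam * s) \<partial>\<sigma> x)"

text \<open>The expected discount on the event that \<open>y\<close> is reached from
  \<open>x\<close> within \<open>N\<close> jumps, unfolded at the first jump.\<close>

primrec hit_upto ::
  "real \<Rightarrow> ('d::finite site \<Rightarrow> 'd site measure) \<Rightarrow> ('d site \<Rightarrow> real measure) \<Rightarrow> 'd site \<Rightarrow> nat \<Rightarrow> 'd site \<Rightarrow> real" where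
  "hit_upto lam \<omega> \<sigma> y 0 x = of_bool (x = y)"
| "hit_upto lam \<omega> \<sigma> y (Suc N) x = (if x = y then 1 else
     laplace lam \<sigma> x * (\<Sum>e\<in>unit_steps. measure (\<omega> x) {e} * hit_upto lam \<omega> \<sigma> y N (x + e)))"

locale environment =
  fixes \<omega> :: "'d::finite site \<Rightarrow> 'd site measure" and \<sigma> :: "'d site \<Rightarrow> real measure" and lam :: real
  assumes omega: "\<And>y. \<omega> y \<in> space P1" and sigma: "\<And>y. \<sigma> y \<in> space P2" and lam: "0 \<le> lam"
begin

lemma sets_omega: "sets (\<omega> y) = Pow unit_steps" and prob_space_omega: "prob_space (\<omega> y)"
  using omega[of y] by (auto simp: P1_def space_prob_algebra)

lemma sum_omega: "(\<Sum>e\<in>unit_steps. measure (\<omega> y) {e}) = 1"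
proof -
  interpret prob_space "\<omega> y" by (rule prob_space_omega)
  have "sets (\<omega> y) = sets (count_space unit_steps)" by (simp add: sets_omega)
  from sets_eq_imp_space_eq[OF this] have "space (\<omega> y) = unit_steps" by simp
  then show ?thesis
    using finite_measure_eq_sum_singleton[of unit_steps]
      prob_space sets_omega finite_unit_steps by simp
qed

lemma sets_sigma: "sets (\<sigma> y) = sets (restrict_space borel {0<..})" and prob_space_sigma: "prob_space (\<sigma> y)"
  using sigma[of y] by (auto simp: P2_def space_prob_algebra)

lemma space_sigma: "space (\<sigma> y) = {0<..}"
  using sets_eq_imp_space_eq[OF sets_sigma] by (simp add: space_restrict_space)

lemma borel_sigma: "f \<in> borel_measurable borel \<Longrightarrow> f \<in> borel_measurable (\<sigma> y)"
  by (simp add: measurable_cong_sets[OF sets_sigma refl] measurable_restrict_space1)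

lemma exp_integrable: "integrable (\<sigma> y) (\<lambda>s. exp (- lam * s))"
proof -
  interpret prob_space "\<sigma> y" by (rule prob_space_sigma)
  show ?thesis
    by (rule integrable_const_bound[of _ 1]) (auto intro!: AE_I2 borel_sigma simp: space_sigma lam)
qed

lemma laplace_le_1: "laplace lam \<sigma> x \<le> 1"
proof -
  interpret prob_space "\<sigma> x" by (rule prob_space_sigma)
  have "laplace lam \<sigma> x \<le> (\<integral>s. 1 \<partial>\<sigma> x)" unfolding laplace_def
    by (rule integral_mono[OF exp_integrable]) (auto simp: space_sigma lam)
  then show ?thesis by (simp add: prob_space)
qed

lemma laplace_pos: "0 < laplace lam \<sigma> x"
proof -
  interpret prob_space "\<sigma> x" by (rule prob_space_sigma)
  show ?thesis unfolding laplace_def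
    using integral_less_AE_space[of "\<lambda>_. 0" "\<lambda>s. exp (- lam * s)"] exp_integrable emeasure_space_1 by simp
qed

lemma nn_integral_laplace: "(\<integral>\<^sup>+s. ennreal (exp (- lam * s)) \<partial>\<sigma> x) = ennreal (laplace lam \<sigma> x)"
  unfolding laplace_def by (rule nn_integral_eq_integral[OF exp_integrable]) auto

lemma hit_upto_nonneg: "0 \<le> hit_upto lam \<omega> \<sigma> y N x"
  by (induction N arbitrary: x) (auto intro!: mult_nonneg_nonneg sum_nonneg less_imp_le[OF laplace_pos])

lemma hit_upto_le_1: "hit_upto lam \<omega> \<sigma> y N x \<le> 1"
proof (induction N arbitrary: x)
  case (Suc N)
  have "(\<Sum>e\<in>unit_steps. measure (\<omega> x) {e} * hit_upto lam \<omega> \<sigma> y N (x + e)) \<le> (\<Sum>e\<in>unit_steps. measure (\<omega> x) {e} * 1)"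
    by (intro sum_mono mult_left_mono Suc) auto
  then have "laplace lam \<sigma> x * (\<Sum>e\<in>unit_steps. measure (\<omega> x) {e} * hit_upto lam \<omega> \<sigma> y N (x + e)) \<le> 1 * 1"
    using laplace_le_1 laplace_pos[of x]
    by (intro mult_mono) (auto simp: sum_omega hit_upto_nonneg intro!: sum_nonneg mult_nonneg_nonneg)
  then show ?case by simp
qed simp

abbreviation walk :: "'d site \<Rightarrow> (nat \<Rightarrow> 'd site) measure" where "walk \<equiv> walk_law \<omega>"

lemmas sets_walk [measurable_cong] = sets_walk_law[of \<omega>, OF omega]

lemma space_walk: "space (walk x) = UNIV"
  using sets_eq_imp_space_eq[OF sets_walk] by (simp add: space_PiM)

lemma walk_component [measurable]: "(\<lambda>X. X n) \<in> walk x \<rightarrow>\<^sub>M count_space UNIV"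
  by (simp add: measurable_cong_sets[OF sets_walk refl] measurable_component_singleton)

lemma walk_0: "AE X in walk x. X 0 = x" and prob_space_walk: "prob_space (walk x)"
proof -
  have 1: "emeasure (walk x) {X. X 0 = x} = 1"
    using emeasure_walk_law_cylinder[of \<omega> x 0 "\<lambda>_. x", OF omega] by simp
  have "{X \<in> space (walk x). X 0 = z} = {X. \<forall>i\<le>0. X i = z}" for z by (auto simp: space_walk)
  then have z: "emeasure (walk x) {X \<in> space (walk x). X 0 = z} = of_bool (z = x)" for z
    using emeasure_walk_law_cylinder[of \<omega> x 0 "\<lambda>_. z", OF omega] by simp
  \<comment> \<open>The total mass is read off the one-point cylinders at time 0, among which only
    the one at \<open>x\<close> has mass.\<close>
  have "emeasure (walk x) (space (walk x)) = (\<integral>\<^sup>+X. 1 \<partial>walk x)" by simp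
  also have "\<dots> = (\<integral>\<^sup>+z. 1 * of_bool (z = x) \<partial>count_space UNIV)"
    using nn_integral_countable_image[OF walk_component[of 0 x], of "\<lambda>_. 1"] unfolding z .
  also have "\<dots> = (\<Sum>z\<in>{x}. 1 * of_bool (z = x))"
    by (rule nn_integral_count_space') auto
  finally show P: "prob_space (walk x)" by (intro prob_spaceI) simp
  interpret prob_space "walk x" by (rule P)
  have "{X \<in> space (walk x). X 0 = x} \<in> sets (walk x)" by measurable
  then show "AE X in walk x. X 0 = x" using 1
    by (subst prob_Collect_eq_1[symmetric]) (auto simp: space_walk emeasure_eq_measure)
qed

lemma walk_map [measurable]: "(\<lambda>X. map X [0..<n]) \<in> walk x \<rightarrow>\<^sub>M count_space UNIV"
proof -
  have eq: "map X [0..<n] = l \<longleftrightarrow> length l = n \<and> (\<forall>i\<in>{..<n}. X i = l ! i)" for X and l :: "'d site list"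
    by (subst list_eq_iff_nth_eq) auto
  have "{X \<in> space (walk x). length l = n \<and> (\<forall>i\<in>{..<n}. X i = l ! i)} \<in> sets (walk x)" for l :: "'d site list"
    by measurable
  then have "(\<lambda>X. map X [0..<n]) -` {l} \<inter> space (walk x) \<in> sets (walk x)" for l :: "'d site list"
    unfolding vimage_def Int_def eq[symmetric] by (simp add: conj_commute)
  then show ?thesis by (subst measurable_count_space_eq2_countable) auto
qed

text \<open>The Markov property in integrated form. The past is handed to \<open>f\<close> as a list
  because lists of sites form a countable type, so its joint law with the next site is given by
  cylinder masses.\<close>

lemma walk_Markov:
  "(\<integral>\<^sup>+X. f (map X [0..<Suc n]) * g (X (Suc n)) \<partial>walk x) =
   (\<integral>\<^sup>+X. f (map X [0..<Suc n]) * (\<Sum>e\<in>unit_steps. emeasure (\<omega> (X n)) {e} * g (X n + e)) \<partial>walk x)"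
proof -
  let ?p = "\<lambda>l. emeasure (walk x) {X \<in> space (walk x). map X [0..<Suc n] = l}"
  have joint: "emeasure (walk x) {X \<in> space (walk x). (map X [0..<Suc n], X (Suc n)) = (l, z)}
      = ?p l * emeasure (\<omega> (last l)) {z - last l}" for l z
  proof (cases "length l = Suc n")
    case True
    let ?q = "\<lambda>i. (l @ [z]) ! i"
    have 1: "{X \<in> space (walk x). map X [0..<Suc n] = l} = {X. \<forall>i\<le>n. X i = ?q i}"
      using True by (auto simp: space_walk list_eq_iff_nth_eq less_Suc_eq_le nth_append simp del: upt_Suc)
    have "{X \<in> space (walk x). (map X [0..<Suc n], X (Suc n)) = (l, z)} = {X. \<forall>i\<le>n. X i = ?q i} \<inter> {X. X (Suc n) = z}"
      unfolding 1[symmetric] by auto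
    also have "\<dots> = {X. \<forall>i\<le>Suc n. X i = ?q i}"
      using True by (auto simp: le_Suc_eq nth_append)
    finally have 2: "{X \<in> space (walk x). (map X [0..<Suc n], X (Suc n)) = (l, z)} = {X. \<forall>i\<le>Suc n. X i = ?q i}" .
    have "l \<noteq> []" using True by auto
    then have "last l = ?q n" using True by (simp add: last_conv_nth nth_append)
    moreover have "z = ?q (Suc n)" using nth_append_length[of l z "[]"] unfolding True by simp
    ultimately show ?thesis unfolding 1 2 emeasure_walk_law_cylinder[OF omega] by simp
  next
    case False
    then have *: "{X \<in> space (walk x). (map X [0..<Suc n], X (Suc n)) = (l, z)} = {}"
      "{X \<in> space (walk x). map X [0..<Suc n] = l} = {}" by (auto simp del: upt_Suc)
    show ?thesis unfolding * by simp
  qed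
  have inner: "(\<integral>\<^sup>+z. g z * emeasure (\<omega> v) {z - v} \<partial>count_space UNIV) = (\<Sum>e\<in>unit_steps. emeasure (\<omega> v) {e} * g (v + e))" for v
  proof -
    have "(\<integral>\<^sup>+z. g z * emeasure (\<omega> v) {z - v} \<partial>count_space UNIV) = (\<Sum>z\<in>(\<lambda>e. v + e) ` unit_steps. g z * emeasure (\<omega> v) {z - v})"
    proof (rule nn_integral_count_space')
      fix z assume "z \<notin> (\<lambda>e. v + e) ` unit_steps"
      then have "z - v \<notin> unit_steps" by (metis add.commute diff_add_cancel image_eqI)
      then have "{z - v} \<notin> sets (\<omega> v)" by (simp add: sets_omega)
      then show "g z * emeasure (\<omega> v) {z - v} = 0" by (simp add: emeasure_notin_sets)
    qed (auto intro: finite_imageI finite_unit_steps)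
    also have "\<dots> = (\<Sum>e\<in>unit_steps. emeasure (\<omega> v) {e} * g (v + e))"
      by (subst sum.reindex) (auto simp: inj_on_def mult.commute)
    finally show ?thesis .
  qed
  have "(\<integral>\<^sup>+X. f (map X [0..<Suc n]) * g (X (Suc n)) \<partial>walk x) =
      (\<integral>\<^sup>+X. (\<lambda>(l, z). f l * g z) (map X [0..<Suc n], X (Suc n)) \<partial>walk x)" by (simp del: upt_Suc)
  also have "\<dots> = (\<integral>\<^sup>+p. (\<lambda>(l, z). f l * g z) p *
      emeasure (walk x) {X \<in> space (walk x). (map X [0..<Suc n], X (Suc n)) = p} \<partial>count_space UNIV)"
    by (rule nn_integral_countable_image) (simp del: upt_Suc, measurable)
  also have "\<dots> = (\<integral>\<^sup>+l. \<integral>\<^sup>+z. f l * g z * (?p l * emeasure (\<omega> (last l)) {z - last l}) \<partial>count_space UNIV \<partial>count_space UNIV)"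
    unfolding nn_integral_fst_count_space[symmetric] joint by simp
  also have "\<dots> = (\<integral>\<^sup>+l. (f l * ?p l) * (\<integral>\<^sup>+z. g z * emeasure (\<omega> (last l)) {z - last l} \<partial>count_space UNIV) \<partial>count_space UNIV)"
    by (subst nn_integral_cmult[symmetric]) (auto simp: mult_ac simp del: upt_Suc)
  also have "\<dots> = (\<integral>\<^sup>+l. (f l * (\<Sum>e\<in>unit_steps. emeasure (\<omega> (last l)) {e} * g (last l + e))) * ?p l \<partial>count_space UNIV)"
    unfolding inner by (simp add: mult_ac del: upt_Suc)
  also have "\<dots> = (\<integral>\<^sup>+X. f (map X [0..<Suc n]) * (\<Sum>e\<in>unit_steps. emeasure (\<omega> (last (map X [0..<Suc n]))) {e}
      * g (last (map X [0..<Suc n]) + e)) \<partial>walk x)"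
    by (rule nn_integral_countable_image[symmetric]) (rule walk_map)
  finally show ?thesis by (simp add: last_map del: map_append)
qed

definition first_hit :: "'d site \<Rightarrow> nat \<Rightarrow> (nat \<Rightarrow> 'd site) \<Rightarrow> real" where
  "first_hit y n X = of_bool (X n = y \<and> (\<forall>m<n. X m \<noteq> y))"

text \<open>Jumps are peeled off one at a time. \<open>J n k\<close> lets the walk make
  \<open>n\<close> jumps, the first \<open>n\<close> sites avoiding \<open>y\<close>, and then
  continues with the recursion for \<open>k\<close> jumps. By the Markov property
  \<open>J n (Suc k) = I n + J (Suc n) k\<close>, and this is iterated starting from
  \<open>J 0 N\<close>.\<close>

lemma sum_first_hit_integrals:
  "hit_upto lam \<omega> \<sigma> y N x =
    (\<Sum>n\<le>N. \<integral>\<^sup>+X. ennreal (first_hit y n X * (\<Prod>m<n. laplace lam \<sigma> (X m))) \<partial>walk x)"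
proof -
  define I where "I n = (\<integral>\<^sup>+X. ennreal (first_hit y n X * (\<Prod>m<n. laplace lam \<sigma> (X m))) \<partial>walk x)" for n
  define f where "f l = ennreal (\<Prod>v\<leftarrow>l. of_bool (v \<noteq> y) * laplace lam \<sigma> v)" for l
  define H where "H k v = ennreal (hit_upto lam \<omega> \<sigma> y k v)" for k v
  define J where "J n k = (\<integral>\<^sup>+X. f (map X [0..<n]) * H k (X n) \<partial>walk x)" for n k
  have F_meas: "(\<lambda>X. F (X n)) \<in> borel_measurable (walk x)" for F :: "'d site \<Rightarrow> ennreal" and n
    by (rule measurable_compose[OF walk_component]) simp
  have f_meas: "(\<lambda>X. f (map X [0..<n])) \<in> borel_measurable (walk x)" for n
    by (rule measurable_compose[OF walk_map]) simp
  have f_eq: "f (map X [0..<n]) = ennreal (of_bool (\<forall>m<n. X m \<noteq> y) * (\<Prod>m<n. laplace lam \<sigma> (X m)))" for X n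
  proof -
    have "(\<Prod>v\<leftarrow>map X [0..<n]. of_bool (v \<noteq> y) * laplace lam \<sigma> v) = of_bool (\<forall>m<n. X m \<noteq> y) * (\<Prod>m<n. laplace lam \<sigma> (X m))"
      by (induction n) (auto simp: less_Suc_eq)
    then show ?thesis by (simp add: f_def)
  qed
  have fh: "f (map X [0..<n]) * of_bool (X n = y) = ennreal (first_hit y n X * (\<Prod>m<n. laplace lam \<sigma> (X m)))" for X n
    unfolding f_eq first_hit_def by auto
  have J0: "J n 0 = I n" for n
    unfolding J_def I_def by (intro nn_integral_cong) (auto simp: H_def fh[symmetric])
  have JS: "J n (Suc k) = I n + J (Suc n) k" for n k
  proof -
    have H: "H (Suc k) v = of_bool (v = y) +
        ennreal (of_bool (v \<noteq> y) * laplace lam \<sigma> v) * (\<Sum>e\<in>unit_steps. emeasure (\<omega> v) {e} * H k (v + e))" for v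
    proof -
      have "(\<Sum>e\<in>unit_steps. emeasure (\<omega> v) {e} * H k (v + e)) = ennreal (\<Sum>e\<in>unit_steps. measure (\<omega> v) {e} * hit_upto lam \<omega> \<sigma> y k (v + e))"
        using finite_measure.emeasure_eq_measure[OF prob_space.finite_measure, OF prob_space_omega]
        by (subst sum_ennreal[symmetric]) (auto simp: H_def ennreal_mult hit_upto_nonneg)
      moreover have "H (Suc k) v = ennreal (laplace lam \<sigma> v) *
          ennreal (\<Sum>e\<in>unit_steps. measure (\<omega> v) {e} * hit_upto lam \<omega> \<sigma> y k (v + e))" if "v \<noteq> y"
        unfolding H_def using that
        by (subst ennreal_mult[symmetric]) (auto simp: less_imp_le[OF laplace_pos] intro!: sum_nonneg mult_nonneg_nonneg hit_upto_nonneg)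
      ultimately show ?thesis by (cases "v = y") (simp_all add: H_def)
    qed
    have fS: "f (map X [0..<Suc n]) = f (map X [0..<n]) * ennreal (of_bool (X n \<noteq> y) * laplace lam \<sigma> (X n))" for X
      unfolding f_eq by (auto simp: ennreal_mult[symmetric] less_Suc_eq prod_nonneg less_imp_le[OF laplace_pos])
    have "J n (Suc k) = (\<integral>\<^sup>+X. f (map X [0..<n]) * of_bool (X n = y) + f (map X [0..<Suc n]) *
        (\<Sum>e\<in>unit_steps. emeasure (\<omega> (X n)) {e} * H k (X n + e)) \<partial>walk x)"
      unfolding J_def H fS by (simp add: distrib_left mult_ac)
    also have "\<dots> = (\<integral>\<^sup>+X. f (map X [0..<n]) * of_bool (X n = y) \<partial>walk x) + (\<integral>\<^sup>+X. f (map X [0..<Suc n]) *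
        (\<Sum>e\<in>unit_steps. emeasure (\<omega> (X n)) {e} * H k (X n + e)) \<partial>walk x)"
      by (intro nn_integral_add borel_measurable_times_ennreal f_meas
          F_meas[of "\<lambda>v. of_bool (v = y)"] F_meas[of "\<lambda>v. \<Sum>e\<in>unit_steps. emeasure (\<omega> v) {e} * H k (v + e)"])
    also have "(\<integral>\<^sup>+X. f (map X [0..<n]) * of_bool (X n = y) \<partial>walk x) = I n"
      unfolding I_def fh ..
    finally show ?thesis unfolding J_def[of "Suc n"] walk_Markov .
  qed
  have "J n k = (\<Sum>j\<le>k. I (n + j))" for n k
  proof (induction k arbitrary: n)
    case (Suc k)
    then show ?case unfolding JS sum.atMost_Suc_shift by simp
  qed (simp add: J0)
  from this[of 0 N] have "J 0 N = (\<Sum>n\<le>N. I n)" by simp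
  moreover have "J 0 N = (\<integral>\<^sup>+X. H N x \<partial>walk x)"
    unfolding J_def by (intro nn_integral_cong_AE AE_mp[OF walk_0 AE_I2]) (auto simp: f_def)
  ultimately show ?thesis using prob_space.emeasure_space_1[OF prob_space_walk]
    by (simp add: I_def H_def)
qed

end

section \<open>Jump times and hitting times of the continuous-time process\<close>

lemma jump_time_strict_mono:
  assumes "\<And>p. 0 < \<tau> p" shows "strict_mono (jump_time X \<tau>)"
  by (rule strict_mono_Suc_iff[THEN iffD2]) (simp add: jump_time_def assms)

lemma Z_process_eq:
  assumes pos: "\<And>p. 0 < \<tau> p" and n: "jump_time X \<tau> n \<le> t" "t < jump_time X \<tau> (Suc n)"
  shows "Z_process X \<tau> t = Some (X n)"
proof -
  have uniq: "m = n" if m: "jump_time X \<tau> m \<le> t" "t < jump_time X \<tau> (Suc m)" for m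
  proof -
    have "jump_time X \<tau> m < jump_time X \<tau> (Suc n)" "jump_time X \<tau> n < jump_time X \<tau> (Suc m)"
      using m n by linarith+
    then have "m < Suc n" "n < Suc m" by (simp_all only: strict_mono_less[OF jump_time_strict_mono[where \<tau> = \<tau>, OF pos]])
    then show ?thesis by simp
  qed
  have "(THE n. jump_time X \<tau> n \<le> t \<and> t < jump_time X \<tau> (Suc n)) = n"
    by (rule the_equality) (use n uniq in blast)+
  moreover have "\<exists>n. jump_time X \<tau> n \<le> t \<and> t < jump_time X \<tau> (Suc n)" using n by blast
  ultimately show ?thesis by (simp only: Z_process_def if_True)
qed

lemma Z_process_eq_SomeD:
  assumes pos: "\<And>p. 0 < \<tau> p" and Z: "Z_process X \<tau> t = Some y"
  obtains n where "X n = y" "jump_time X \<tau> n \<le> t"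
proof -
  from Z obtain n where n: "jump_time X \<tau> n \<le> t" "t < jump_time X \<tau> (Suc n)"
    by (auto simp: Z_process_def split: if_splits)
  with Z Z_process_eq[where \<tau> = \<tau>, OF pos n] show thesis by (auto intro: that)
qed

text \<open>Holding intervals contain their left endpoints, so the infimum is attained at the first
  arrival of the embedded walk; every other visit lies in an interval of index at least
  \<open>n\<close>.\<close>

lemma hitting_time_eq_jump_time:
  assumes pos: "\<And>p. 0 < \<tau> p" and n: "X n = y" "\<And>m. m < n \<Longrightarrow> X m \<noteq> y"
  shows "hitting_time X \<tau> y = ereal (jump_time X \<tau> n)"
  unfolding hitting_time_def
proof (rule antisym)
  have mono: "strict_mono (jump_time X \<tau>)" by (rule jump_time_strict_mono[where \<tau> = \<tau>, OF pos])
  have "Z_process X \<tau> (jump_time X \<tau> n) = Some y"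
    using Z_process_eq[where \<tau> = \<tau> and X = X and n = n and t = "jump_time X \<tau> n", OF pos] strict_mono_less[OF mono, of n "Suc n"] n by simp
  moreover have "0 \<le> jump_time X \<tau> n" using strict_mono_less_eq[OF mono, of 0 n] by (simp add: jump_time_def)
  ultimately show "Inf {ereal t |t. 0 \<le> t \<and> Z_process X \<tau> t = Some y} \<le> ereal (jump_time X \<tau> n)"
    by (intro Inf_lower) auto
  show "ereal (jump_time X \<tau> n) \<le> Inf {ereal t |t. 0 \<le> t \<and> Z_process X \<tau> t = Some y}"
  proof (rule Inf_greatest, clarify)
    fix t assume "Z_process X \<tau> t = Some y"
    then obtain k where k: "X k = y" "jump_time X \<tau> k \<le> t" using Z_process_eq_SomeD[where \<tau> = \<tau>, OF pos] by blast
    then have "n \<le> k" using n(2) not_less by blast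
    then have "jump_time X \<tau> n \<le> jump_time X \<tau> k" using strict_mono_less_eq[OF mono] by blast
    with k show "ereal (jump_time X \<tau> n) \<le> ereal t" by simp
  qed
qed

lemma hitting_time_eq_infinity:
  assumes pos: "\<And>p. 0 < \<tau> p" and never: "\<And>n. X n \<noteq> y"
  shows "hitting_time X \<tau> y = \<infinity>"
proof -
  have none: "Z_process X \<tau> t \<noteq> Some y" for t
    using Z_process_eq_SomeD[where \<tau> = \<tau> and X = X and y = y, OF pos] never by metis
  show ?thesis unfolding hitting_time_def by (simp add: none top_ereal_def)
qed

definition discount :: "real \<Rightarrow> 'd::finite site \<Rightarrow> (nat \<Rightarrow> 'd site) \<times> (nat \<times> 'd site \<Rightarrow> real) \<Rightarrow> real" where
  "discount lam y = (\<lambda>(X, \<tau>). if hitting_time X \<tau> y < \<infinity> then exp (- lam * real_of_ereal (hitting_time X \<tau> y)) else 0)"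

context environment
begin

lemma HT_component [measurable]: "(\<lambda>\<tau>. \<tau> (n, x)) \<in> borel_measurable (HT_law \<sigma>)"
proof -
  have "(\<lambda>\<tau>. \<tau> (n, x)) \<in> HT_law \<sigma> \<rightarrow>\<^sub>M (case (n, x) of (n, x) \<Rightarrow> \<sigma> x)"
    unfolding HT_law_def by (rule measurable_component_singleton) simp
  then have "(\<lambda>\<tau>. \<tau> (n, x)) \<in> HT_law \<sigma> \<rightarrow>\<^sub>M restrict_space borel {0<..}"
    by (simp add: measurable_cong_sets[OF refl sets_sigma])
  then show ?thesis by (simp add: measurable_restrict_space2_iff)
qed

lemma HT_pos: "\<tau> \<in> space (HT_law \<sigma>) \<Longrightarrow> 0 < \<tau> p"
  by (cases p) (auto simp: HT_law_def space_PiM space_sigma PiE_iff split: prod.splits)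

lemma prob_space_HT: "prob_space (HT_law \<sigma>)"
  unfolding HT_law_def by (rule prob_space_PiM) (auto simp: prob_space_sigma split: prod.splits)

text \<open>The indices \<open>(m, X m)\<close> are distinct even if the path revisits a site,
  because \<open>m\<close> differs; the holding times along a fixed path are therefore
  independent.\<close>

lemma nn_integral_HT_jump_time:
  "(\<integral>\<^sup>+\<tau>. ennreal (exp (- lam * jump_time X \<tau> n)) \<partial>HT_law \<sigma>) = ennreal (\<Prod>m<n. laplace lam \<sigma> (X m))"
proof -
  let ?J = "(\<lambda>m. (m, X m)) ` {..<n}"
  have inj: "inj_on (\<lambda>m. (m, X m)) {..<n}" by (rule inj_onI) simp
  have "ennreal (exp (- lam * jump_time X \<tau> n)) = (\<Prod>p\<in>?J. ennreal (exp (- lam * \<tau> p)))" for \<tau>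
    unfolding prod.reindex[OF inj]
    by (simp add: jump_time_def sum_distrib_left exp_sum prod_ennreal flip: sum_negf)
  then have "(\<integral>\<^sup>+\<tau>. ennreal (exp (- lam * jump_time X \<tau> n)) \<partial>HT_law \<sigma>) =
      (\<integral>\<^sup>+\<tau>. (\<Prod>p\<in>?J. ennreal (exp (- lam * \<tau> p))) \<partial>PiM UNIV (\<lambda>(n, x). \<sigma> x))"
    unfolding HT_law_def by simp
  also have "\<dots> = (\<Prod>p\<in>?J. \<integral>\<^sup>+s. ennreal (exp (- lam * s)) \<partial>(case p of (n, x) \<Rightarrow> \<sigma> x))"
    by (rule nn_integral_PiM_prod) (auto simp: prob_space_sigma intro!: borel_sigma)
  also have "\<dots> = (\<Prod>m<n. ennreal (laplace lam \<sigma> (X m)))"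
    unfolding prod.reindex[OF inj] by (simp add: nn_integral_laplace[simplified])
  finally show ?thesis by (simp add: prod_ennreal less_imp_le[OF laplace_pos])
qed

lemma first_hit_meas [measurable]: "first_hit y n \<in> borel_measurable (walk x)"
proof -
  have "{X \<in> space (walk x). X n = y \<and> (\<forall>m\<in>{..<n}. X m \<noteq> y)} \<in> sets (walk x)" by measurable
  then have "indicat_real {X \<in> space (walk x). X n = y \<and> (\<forall>m\<in>{..<n}. X m \<noteq> y)} \<in> borel_measurable (walk x)"
    by simp
  moreover have "indicat_real {X \<in> space (walk x). X n = y \<and> (\<forall>m\<in>{..<n}. X m \<noteq> y)} = first_hit y n"
    by (auto simp: fun_eq_iff first_hit_def indicator_def space_walk)
  ultimately show ?thesis by simp
qed

text \<open>The coordinate that is read, \<open>(m, X m)\<close>, is itself random; measurability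
  rests on the countability of the set of sites.\<close>

lemma jump_time_meas [measurable]: "(\<lambda>(X, \<tau>). jump_time X \<tau> n) \<in> borel_measurable (joint_law \<omega> \<sigma> x)"
proof -
  have "(\<lambda>p. snd p (m, fst p m)) \<in> borel_measurable (walk x \<Otimes>\<^sub>M HT_law \<sigma>)" for m
  proof (rule measurable_compose_countable[of "\<lambda>v p. snd p (m, v)"])
    show "(\<lambda>p. fst p m) \<in> walk x \<Otimes>\<^sub>M HT_law \<sigma> \<rightarrow>\<^sub>M count_space UNIV"
      by (rule measurable_compose[OF measurable_fst walk_component])
    show "(\<lambda>p. snd p (m, v)) \<in> borel_measurable (walk x \<Otimes>\<^sub>M HT_law \<sigma>)" for v
      by (rule measurable_compose[OF measurable_snd HT_component])
  qed
  then show ?thesis unfolding joint_law_def jump_time_def split_beta by (intro borel_measurable_sum) simp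
qed

lemma first_hit_meas_joint [measurable]: "(\<lambda>(X, \<tau>). first_hit y n X) \<in> borel_measurable (joint_law \<omega> \<sigma> x)"
  unfolding joint_law_def split_beta by (rule measurable_compose[OF measurable_fst first_hit_meas])

text \<open>At most one summand is nonzero. The series makes the discount measurable, although the
  hitting time is an infimum over uncountably many times, and it can be integrated term by
  term.\<close>

lemma discount_sums:
  assumes "p \<in> space (joint_law \<omega> \<sigma> x)"
  shows "(\<lambda>n. (\<lambda>(X, \<tau>). first_hit y n X * exp (- lam * jump_time X \<tau> n)) p) sums discount lam y p"
proof -
  obtain X \<tau> where p: "p = (X, \<tau>)" by (cases p)
  have pos: "0 < \<tau> q" for q using assms HT_pos by (simp add: p joint_law_def space_pair_measure)
  show ?thesis
  proof (cases "\<exists>n. X n = y")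
    case True
    define N where "N = (LEAST n. X n = y)"
    have N: "X N = y" "\<And>m. m < N \<Longrightarrow> X m \<noteq> y"
      unfolding N_def using LeastI_ex[OF True] not_less_Least[where P = "\<lambda>n. X n = y"] by blast+
    have fh: "first_hit y n X = of_bool (n = N)" for n
      unfolding first_hit_def using N linorder_neqE_nat[of n N] by auto
    have "(\<lambda>n. first_hit y n X * exp (- lam * jump_time X \<tau> n)) sums (\<Sum>n\<in>{N}. first_hit y n X * exp (- lam * jump_time X \<tau> n))"
      by (rule sums_finite) (auto simp: fh)
    moreover have "discount lam y p = exp (- lam * jump_time X \<tau> N)"
      using hitting_time_eq_jump_time[where \<tau> = \<tau> and X = X and n = N and y = y, OF pos N] by (simp add: discount_def p)
    ultimately show ?thesis by (simp add: p fh)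
  next
    case False
    then have "discount lam y p = 0" using hitting_time_eq_infinity[where \<tau> = \<tau> and X = X and y = y, OF pos] by (simp add: discount_def p)
    with False show ?thesis by (simp add: p first_hit_def)
  qed
qed

lemma discount_nonneg: "0 \<le> discount lam y p"
  by (auto simp: discount_def split: prod.splits)

lemma discount_meas [measurable]: "discount lam y \<in> borel_measurable (joint_law \<omega> \<sigma> x)"
proof -
  let ?f = "\<lambda>n. \<lambda>(X, \<tau>). first_hit y n X * exp (- lam * jump_time X \<tau> n)"
  have "?f n \<in> borel_measurable (joint_law \<omega> \<sigma> x)" for n
    using first_hit_meas_joint[of y n x] jump_time_meas[of n x] unfolding split_beta by measurable
  then have "(\<lambda>p. \<Sum>n. ?f n p) \<in> borel_measurable (joint_law \<omega> \<sigma> x)"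
    by (intro borel_measurable_suminf)
  moreover have "(\<Sum>n. ?f n p) = discount lam y p" if "p \<in> space (joint_law \<omega> \<sigma> x)" for p
    using sums_unique[OF discount_sums[OF that]] by simp
  ultimately show ?thesis by (subst measurable_cong[of _ _ "\<lambda>p. \<Sum>n. ?f n p"]) auto
qed

text \<open>Tonelli: for a fixed path the holding times are integrated first, which replaces the
  exponential of the jump time by a product of Laplace factors.\<close>

lemma nn_integral_discount:
  "(\<integral>\<^sup>+p. ennreal (discount lam y p) \<partial>joint_law \<omega> \<sigma> x) =
    (\<Sum>n. \<integral>\<^sup>+X. ennreal (first_hit y n X * (\<Prod>m<n. laplace lam \<sigma> (X m))) \<partial>walk x)"
proof -
  interpret HT: prob_space "HT_law \<sigma>" by (rule prob_space_HT)
  let ?f = "\<lambda>n. \<lambda>(X, \<tau>). first_hit y n X * exp (- lam * jump_time X \<tau> n)"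
  have fh0: "0 \<le> first_hit y n X" for n X by (simp add: first_hit_def)
  have f0: "0 \<le> ?f n p" for n p by (cases p) (simp add: fh0)
  have fm: "?f n \<in> borel_measurable (joint_law \<omega> \<sigma> x)" for n
    using first_hit_meas_joint[of y n x] jump_time_meas[of n x] unfolding split_beta by measurable
  have "(\<integral>\<^sup>+p. ennreal (discount lam y p) \<partial>joint_law \<omega> \<sigma> x) = (\<integral>\<^sup>+p. (\<Sum>n. ennreal (?f n p)) \<partial>joint_law \<omega> \<sigma> x)"
  proof (rule nn_integral_cong)
    fix p assume "p \<in> space (joint_law \<omega> \<sigma> x)"
    then show "ennreal (discount lam y p) = (\<Sum>n. ennreal (?f n p))"
      by (intro suminf_ennreal_eq[symmetric] f0 discount_sums)
  qed
  also have "\<dots> = (\<Sum>n. \<integral>\<^sup>+p. ennreal (?f n p) \<partial>joint_law \<omega> \<sigma> x)"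
    by (intro nn_integral_suminf measurable_compose[OF fm measurable_ennreal])
  also have "\<dots> = (\<Sum>n. \<integral>\<^sup>+X. ennreal (first_hit y n X * (\<Prod>m<n. laplace lam \<sigma> (X m))) \<partial>walk x)"
  proof (rule arg_cong[where f = suminf], rule ext)
    fix n
    have "(\<integral>\<^sup>+p. ennreal (?f n p) \<partial>joint_law \<omega> \<sigma> x) = (\<integral>\<^sup>+X. \<integral>\<^sup>+\<tau>. ennreal (?f n (X, \<tau>)) \<partial>HT_law \<sigma> \<partial>walk x)"
      unfolding joint_law_def
      by (rule HT.nn_integral_fst[symmetric]) (rule measurable_compose[OF fm[unfolded joint_law_def] measurable_ennreal])
    also have "\<dots> = (\<integral>\<^sup>+X. ennreal (first_hit y n X * (\<Prod>m<n. laplace lam \<sigma> (X m))) \<partial>walk x)"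
    proof (rule nn_integral_cong)
      fix X assume "X \<in> space (walk x)"
      have "(\<lambda>\<tau>. ennreal (exp (- lam * jump_time X \<tau> n))) \<in> borel_measurable (HT_law \<sigma>)"
        unfolding jump_time_def by measurable
      then have "(\<integral>\<^sup>+\<tau>. ennreal (first_hit y n X) * ennreal (exp (- lam * jump_time X \<tau> n)) \<partial>HT_law \<sigma>)
          = ennreal (first_hit y n X) * (\<integral>\<^sup>+\<tau>. ennreal (exp (- lam * jump_time X \<tau> n)) \<partial>HT_law \<sigma>)"
        by (rule nn_integral_cmult)
      also have "\<dots> = ennreal (first_hit y n X * (\<Prod>m<n. laplace lam \<sigma> (X m)))"
        unfolding nn_integral_HT_jump_time
        by (rule ennreal_mult[symmetric]) (auto simp: fh0 intro!: prod_nonneg less_imp_le[OF laplace_pos])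
      finally show "(\<integral>\<^sup>+\<tau>. ennreal (?f n (X, \<tau>)) \<partial>HT_law \<sigma>) = ennreal (first_hit y n X * (\<Prod>m<n. laplace lam \<sigma> (X m)))"
        by (simp add: ennreal_mult fh0)
    qed
    finally show "(\<integral>\<^sup>+p. ennreal (?f n p) \<partial>joint_law \<omega> \<sigma> x) = \<dots>" .
  qed
  finally show ?thesis .
qed

lemma e_fun_eq_integral: "e_fun lam x y \<omega> \<sigma> = (\<integral>p. discount lam y p \<partial>joint_law \<omega> \<sigma> x)"
  by (simp add: e_fun_def discount_def)

theorem hit_upto_tendsto: "(\<lambda>N. hit_upto lam \<omega> \<sigma> y N x) \<longlonglongrightarrow> e_fun lam x y \<omega> \<sigma>"
proof -
  let ?I = "\<lambda>n. \<integral>\<^sup>+X. ennreal (first_hit y n X * (\<Prod>m<n. laplace lam \<sigma> (X m))) \<partial>walk x"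
  have "(\<lambda>N. \<Sum>n\<le>N. ?I n) \<longlonglongrightarrow> (\<Sum>n. ?I n)"
    by (rule summable_LIMSEQ') (rule summableI)
  then have lim: "(\<lambda>N. ennreal (hit_upto lam \<omega> \<sigma> y N x)) \<longlonglongrightarrow> (\<Sum>n. ?I n)"
    unfolding sum_first_hit_integrals .
  have "(\<Sum>n. ?I n) \<le> ennreal 1"
    by (rule LIMSEQ_le_const2[OF lim]) (use hit_upto_le_1 in \<open>auto intro!: ennreal_leI simp flip: ennreal_1\<close>)
  then have fin: "(\<Sum>n. ?I n) \<noteq> \<infinity>" by (auto simp: top_unique)
  have "(\<lambda>N. enn2real (ennreal (hit_upto lam \<omega> \<sigma> y N x))) \<longlonglongrightarrow> enn2real (\<Sum>n. ?I n)"
    by (rule tendsto_enn2real) (use fin lim in \<open>simp_all add: less_top\<close>)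
  moreover have "e_fun lam x y \<omega> \<sigma> = enn2real (\<Sum>n. ?I n)"
    unfolding nn_integral_discount[symmetric] e_fun_eq_integral
    by (simp add: integral_eq_nn_integral[OF discount_meas] discount_nonneg)
  ultimately show ?thesis by (simp add: hit_upto_nonneg)
qed

lemma prob_space_joint: "prob_space (joint_law \<omega> \<sigma> x)"
proof -
  interpret W: prob_space "walk x" by (rule prob_space_walk)
  interpret HT: prob_space "HT_law \<sigma>" by (rule prob_space_HT)
  interpret P: pair_prob_space "walk x" "HT_law \<sigma>" ..
  show ?thesis unfolding joint_law_def by (rule P.prob_space_axioms)
qed

end

section \<open>Quenched estimates\<close>

definition site_norm :: "'d::finite site \<Rightarrow> nat" where
  "site_norm z = (\<Sum>i\<in>UNIV. nat \<bar>z $ i\<bar>)"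

lemma l1norm_embed: "l1norm (embed z) = real (site_norm z)"
  by (simp add: l1norm_def embed_def site_norm_def)

lemma site_norm_add: "site_norm (x + y) \<le> site_norm x + site_norm y"
  unfolding site_norm_def sum.distrib[symmetric] by (rule sum_mono) auto

lemma site_norm_0 [simp]: "site_norm 0 = 0"
  by (simp add: site_norm_def)

lemma unit_steps_iff: "e \<in> unit_steps \<longleftrightarrow> site_norm e = 1"
  by (simp add: unit_steps_def l1norm_embed)

text \<open>One nonzero coordinate is moved a unit towards 0. Inductions using this follow a
  shortest lattice path from the origin.\<close>

lemma site_norm_SucE:
  fixes z :: "'d::finite site"
  assumes "site_norm z = Suc n"
  obtains w e where "z = w + e" "site_norm w = n" "e \<in> unit_steps"
proof -
  from assms have "\<exists>i. z $ i \<noteq> 0" by (rule contrapos_pp) (simp add: site_norm_def)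
  then obtain i where i: "z $ i \<noteq> 0" ..
  define e :: "'d site" where "e = (\<chi> j. if j = i then sgn (z $ i) else 0)"
  have split: "site_norm v = nat \<bar>v $ i\<bar> + (\<Sum>j\<in>UNIV - {i}. nat \<bar>v $ j\<bar>)" for v :: "'d site"
    unfolding site_norm_def by (rule sum.remove) auto
  have "(\<Sum>j\<in>UNIV - {i}. nat \<bar>(z - e) $ j\<bar>) = (\<Sum>j\<in>UNIV - {i}. nat \<bar>z $ j\<bar>)"
    by (rule sum.cong) (auto simp: e_def)
  moreover have "nat \<bar>z $ i\<bar> = Suc (nat \<bar>(z - e) $ i\<bar>)" using i by (auto simp: e_def sgn_if)
  ultimately have "site_norm (z - e) = n" using assms split[of z] split[of "z - e"] by simp
  moreover have "site_norm e = 1" using i unfolding split[of e] by (simp add: e_def sgn_if)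
  ultimately show thesis using that[of "z - e" e] by (simp add: unit_steps_iff)
qed

lemma unit_steps_nonempty: "(unit_steps :: 'd::finite site set) \<noteq> {}"
proof -
  have "site_norm (axis (undefined :: 'd) 1) = 1"
    unfolding site_norm_def by (subst sum.remove[of _ undefined]) (auto simp: axis_def)
  then show ?thesis using unit_steps_iff by blast
qed

lemma zero_notin_unit_steps: "0 \<notin> unit_steps"
  by (simp add: unit_steps_iff)

lemma hit_upto_shift:
  "hit_upto lam \<omega> \<sigma> (y + z) N (x + z) = hit_upto lam (shift z \<omega>) (shift z \<sigma>) y N x"
proof (induction N arbitrary: x)
  case (Suc N)
  have "hit_upto lam \<omega> \<sigma> (y + z) N (x + z + e) = hit_upto lam (shift z \<omega>) (shift z \<sigma>) y N (x + e)" for e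
    using Suc[of "x + e"] by (simp add: add_ac)
  moreover have "shift z \<omega> x = \<omega> (x + z)" "laplace lam (shift z \<sigma>) x = laplace lam \<sigma> (x + z)"
    by (simp_all add: shift_def laplace_def)
  ultimately show ?case by simp
qed simp

context environment
begin

lemma environment_shift: "environment (shift z \<omega>) (shift z \<sigma>) lam"
  by unfold_locales (auto simp: shift_def omega sigma lam)

lemma e_fun_shift: "e_fun lam (x + z) (y + z) \<omega> \<sigma> = e_fun lam x y (shift z \<omega>) (shift z \<sigma>)"
  using hit_upto_tendsto[of "y + z" "x + z"] environment.hit_upto_tendsto[OF environment_shift[of z], of y x]
  unfolding hit_upto_shift by (rule LIMSEQ_unique)

lemma e_fun_nonneg: "0 \<le> e_fun lam x y \<omega> \<sigma>"
  by (rule LIMSEQ_le_const[OF hit_upto_tendsto]) (auto simp: hit_upto_nonneg)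

lemma e_fun_le_1: "e_fun lam x y \<omega> \<sigma> \<le> 1"
  by (rule LIMSEQ_le_const2[OF hit_upto_tendsto]) (auto simp: hit_upto_le_1)

lemma hit_upto_self: "hit_upto lam \<omega> \<sigma> y N y = 1"
  by (cases N) auto

lemma e_fun_self: "e_fun lam y y \<omega> \<sigma> = 1"
  using LIMSEQ_unique[OF hit_upto_tendsto[of y y]] by (simp add: hit_upto_self)

lemma hit_upto_Suc_mono: "hit_upto lam \<omega> \<sigma> y N x \<le> hit_upto lam \<omega> \<sigma> y (Suc N) x"
proof (induction N arbitrary: x)
  case 0 then show ?case using hit_upto_nonneg[of y "Suc 0" x] by (auto simp: of_bool_def)
next
  case (Suc N)
  have "(\<Sum>e\<in>unit_steps. measure (\<omega> x) {e} * hit_upto lam \<omega> \<sigma> y N (x + e)) \<le>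
      (\<Sum>e\<in>unit_steps. measure (\<omega> x) {e} * hit_upto lam \<omega> \<sigma> y (Suc N) (x + e))"
    by (intro sum_mono mult_left_mono Suc) auto
  from mult_left_mono[OF this less_imp_le[OF laplace_pos[of x]]] show ?case by simp
qed

lemma hit_upto_le_e_fun: "hit_upto lam \<omega> \<sigma> y N x \<le> e_fun lam x y \<omega> \<sigma>"
  by (rule incseq_le[OF _ hit_upto_tendsto]) (rule incseq_SucI, rule hit_upto_Suc_mono)

lemma e_fun_first_step:
  assumes "x \<noteq> y"
  shows "e_fun lam x y \<omega> \<sigma> = laplace lam \<sigma> x * (\<Sum>e\<in>unit_steps. measure (\<omega> x) {e} * e_fun lam (x + e) y \<omega> \<sigma>)"
proof -
  have "(\<lambda>N. hit_upto lam \<omega> \<sigma> y (Suc N) x) \<longlonglongrightarrow>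
      laplace lam \<sigma> x * (\<Sum>e\<in>unit_steps. measure (\<omega> x) {e} * e_fun lam (x + e) y \<omega> \<sigma>)"
    using assms by (auto intro!: tendsto_intros hit_upto_tendsto)
  with LIMSEQ_Suc[OF hit_upto_tendsto] show ?thesis by (rule LIMSEQ_unique)
qed

text \<open>Passing through \<open>y\<close> is one way to reach \<open>z\<close>. In place of the
  strong Markov property, induction on \<open>N\<close>: away from \<open>y\<close> and
  \<open>z\<close> both sides obey the same one-step recursion, and at \<open>z\<close> the right
  side is 1.\<close>

lemma e_fun_supermult: "e_fun lam x y \<omega> \<sigma> * e_fun lam y z \<omega> \<sigma> \<le> e_fun lam x z \<omega> \<sigma>"
proof -
  have "hit_upto lam \<omega> \<sigma> y N x * e_fun lam y z \<omega> \<sigma> \<le> e_fun lam x z \<omega> \<sigma>" for N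
  proof (induction N arbitrary: x)
    case 0 then show ?case by (simp add: of_bool_def e_fun_nonneg)
  next
    case (Suc N)
    consider "x = y" | "x = z" | "x \<noteq> y" "x \<noteq> z" by blast
    then show ?case
    proof cases
      case 2
      then show ?thesis
        using mult_mono[OF hit_upto_le_1[of y "Suc N" x] e_fun_le_1[of y z]] e_fun_nonneg hit_upto_nonneg by (simp add: e_fun_self)
    next
      case 3
      have "hit_upto lam \<omega> \<sigma> y (Suc N) x * e_fun lam y z \<omega> \<sigma> =
          laplace lam \<sigma> x * (\<Sum>e\<in>unit_steps. measure (\<omega> x) {e} * (hit_upto lam \<omega> \<sigma> y N (x + e) * e_fun lam y z \<omega> \<sigma>))"
        using 3 by (simp add: sum_distrib_left mult_ac)
      also have "\<dots> \<le> laplace lam \<sigma> x * (\<Sum>e\<in>unit_steps. measure (\<omega> x) {e} * e_fun lam (x + e) z \<omega> \<sigma>)"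
        using laplace_pos[of x] by (intro mult_left_mono sum_mono Suc) auto
      also have "\<dots> = e_fun lam x z \<omega> \<sigma>" by (rule e_fun_first_step[OF 3(2), symmetric])
      finally show ?thesis .
    qed simp
  qed
  then show ?thesis
    by (intro LIMSEQ_le_const2[OF tendsto_mult_right[OF hit_upto_tendsto]]) auto
qed

lemma e_fun_step_ge:
  assumes e: "e \<in> unit_steps"
  shows "laplace lam \<sigma> x * measure (\<omega> x) {e} \<le> e_fun lam x (x + e) \<omega> \<sigma>"
proof -
  have "e \<noteq> 0" using e zero_notin_unit_steps by blast
  have "(\<Sum>e'\<in>unit_steps. measure (\<omega> x) {e'} * of_bool (x + e' = x + e)) = measure (\<omega> x) {e}"
    using e by (simp add: of_bool_def if_distrib sum.delta[OF finite_unit_steps] cong: if_cong)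
  then have "hit_upto lam \<omega> \<sigma> (x + e) (Suc 0) x = laplace lam \<sigma> x * measure (\<omega> x) {e}"
    using \<open>e \<noteq> 0\<close> by simp
  with hit_upto_le_e_fun[of "x + e" "Suc 0" x] show ?thesis by simp
qed

text \<open>Every step of a shortest path has positive discounted probability, and
  \<open>e_fun_supermult\<close> multiplies them.\<close>

lemma e_fun_pos:
  assumes ell: "\<And>x e. e \<in> unit_steps \<Longrightarrow> 0 < measure (\<omega> x) {e}"
  shows "0 < e_fun lam x y \<omega> \<sigma>"
proof -
  have "0 < e_fun lam x (x + z) \<omega> \<sigma>" for z
  proof (induction "site_norm z" arbitrary: z)
    case 0
    then have "z = 0" by (simp add: site_norm_def vec_eq_iff)
    then show ?case by (simp add: e_fun_self)
  next
    case (Suc n)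
    then obtain w e where z: "z = w + e" "site_norm w = n" "e \<in> unit_steps" by (metis site_norm_SucE)
    have "0 < laplace lam \<sigma> (x + w) * measure (\<omega> (x + w)) {e}" using laplace_pos ell[OF z(3)] by simp
    also have "\<dots> \<le> e_fun lam (x + w) (x + w + e) \<omega> \<sigma>" by (rule e_fun_step_ge[OF z(3)])
    finally have "0 < e_fun lam x (x + w) \<omega> \<sigma> * e_fun lam (x + w) (x + w + e) \<omega> \<sigma>"
      using Suc z by simp
    also have "\<dots> \<le> e_fun lam x (x + w + e) \<omega> \<sigma>" by (rule e_fun_supermult)
    finally show ?case by (simp add: z add.assoc)
  qed
  from this[of "y - x"] show ?thesis by simp
qed

end

section \<open>Dependence of the quenched quantities on the parameter\<close>

lemma (in environment) discount_cases:
  assumes p: "p \<in> space (joint_law \<omega> \<sigma> x)"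
  obtains "\<And>l. discount l y p = 0" | h where "0 \<le> h" "\<And>l. discount l y p = exp (- l * h)"
proof -
  \<comment> \<open>The hitting time does not involve \<open>l\<close>, so for a fixed sample the
    discount is either 0 for all \<open>l\<close> or a single exponential in \<open>l\<close>.
    Monotonicity, convexity and continuity in the parameter are then pointwise facts.\<close>
  obtain X \<tau> where X: "p = (X, \<tau>)" by (cases p)
  have "0 \<le> hitting_time X \<tau> y" unfolding hitting_time_def by (rule Inf_greatest) auto
  then show thesis
    using that(1) that(2)[of "real_of_ereal (hitting_time X \<tau> y)"]
    by (cases "hitting_time X \<tau> y < \<infinity>") (auto simp: discount_def X real_of_ereal_pos)
qed

lemma (in environment) discount_integrable: "integrable (joint_law \<omega> \<sigma> x) (discount lam y)"
proof -
  interpret J: prob_space "joint_law \<omega> \<sigma> x" by (rule prob_space_joint)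
  show ?thesis
  proof (rule J.integrable_const_bound[of _ 1], rule AE_I2)
    fix p assume "p \<in> space (joint_law \<omega> \<sigma> x)"
    then show "norm (discount lam y p) \<le> 1"
      by (rule discount_cases[where y = y]) (auto simp: lam)
  qed simp
qed

lemma e_fun_antimono:
  assumes env: "environment \<omega> \<sigma> lam" "environment \<omega> \<sigma> lam'" and le: "lam \<le> lam'"
  shows "e_fun lam' x y \<omega> \<sigma> \<le> e_fun lam x y \<omega> \<sigma>"
  unfolding environment.e_fun_eq_integral[OF env(1)] environment.e_fun_eq_integral[OF env(2)]
proof (rule integral_mono[OF environment.discount_integrable[OF env(2)] environment.discount_integrable[OF env(1)]])
  fix p assume "p \<in> space (joint_law \<omega> \<sigma> x)"
  then show "discount lam' y p \<le> discount lam y p"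
    by (rule environment.discount_cases[OF env(1), where y = y]) (auto simp: mult_right_mono le)
qed

text \<open>Hoelder's inequality, in the guise of log-convexity of a Laplace transform: after
  normalising by the two expectations, the pointwise bound is convexity of exp.\<close>

lemma ln_e_fun_convex:
  assumes env: "environment \<omega> \<sigma> l" "environment \<omega> \<sigma> m" and u: "0 \<le> u" "0 \<le> v" "u + v = 1"
    and pos: "0 < e_fun l x y \<omega> \<sigma>" "0 < e_fun m x y \<omega> \<sigma>" "0 < e_fun (u * l + v * m) x y \<omega> \<sigma>"
  shows "ln (e_fun (u * l + v * m) x y \<omega> \<sigma>) \<le> u * ln (e_fun l x y \<omega> \<sigma>) + v * ln (e_fun m x y \<omega> \<sigma>)"
proof -
  interpret l: environment \<omega> \<sigma> l by fact
  interpret m: environment \<omega> \<sigma> m by fact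
  interpret k: environment \<omega> \<sigma> "u * l + v * m"
    by unfold_locales (use l.omega l.sigma l.lam m.lam u in auto)
  let ?A = "e_fun l x y \<omega> \<sigma>" and ?B = "e_fun m x y \<omega> \<sigma>"
  \<comment> \<open>The weighted geometric mean of \<open>?A\<close> and \<open>?B\<close>. The
    normalised discounts integrate to 1, so integrating the bound leaves exactly
    \<open>?c\<close>.\<close>
  let ?c = "exp (u * ln ?A + v * ln ?B)"
  have "e_fun (u * l + v * m) x y \<omega> \<sigma> \<le>
      (\<integral>p. ?c * (u * (discount l y p / ?A) + v * (discount m y p / ?B)) \<partial>joint_law \<omega> \<sigma> x)"
    unfolding k.e_fun_eq_integral
  proof (rule integral_mono[OF k.discount_integrable])
    show "integrable (joint_law \<omega> \<sigma> x) (\<lambda>p. ?c * (u * (discount l y p / ?A) + v * (discount m y p / ?B)))"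
      using l.discount_integrable m.discount_integrable by (intro integrable_mult_right Bochner_Integration.integrable_add integrable_divide) auto
    fix p assume "p \<in> space (joint_law \<omega> \<sigma> x)"
    then show "discount (u * l + v * m) y p \<le> ?c * (u * (discount l y p / ?A) + v * (discount m y p / ?B))"
    proof (rule l.discount_cases[where y = y])
      fix h assume h: "\<And>l. discount l y p = exp (- l * h)"
      have "exp (u * (- l * h - ln ?A) + v * (- m * h - ln ?B)) \<le> u * exp (- l * h - ln ?A) + v * exp (- m * h - ln ?B)"
        using convex_onD[OF exp_convex, of v "- l * h - ln ?A" "- m * h - ln ?B"] u by (simp add: eq_diff_eq[symmetric])
      moreover have "exp (- (u * l + v * m) * h) = ?c * exp (u * (- l * h - ln ?A) + v * (- m * h - ln ?B))"
        unfolding exp_add[symmetric] by (rule arg_cong[where f = exp]) (simp add: algebra_simps)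
      moreover have "exp (- l * h - ln ?A) = exp (- l * h) / ?A" "exp (- m * h - ln ?B) = exp (- m * h) / ?B"
        using pos by (simp_all add: exp_diff)
      ultimately show ?thesis unfolding h by (simp only: mult_left_mono exp_ge_zero)
    qed simp
  qed
  also have "\<dots> = ?c * (u * (?A / ?A) + v * (?B / ?B))"
    using l.discount_integrable m.discount_integrable
    unfolding l.e_fun_eq_integral m.e_fun_eq_integral
    by (simp add: Bochner_Integration.integral_add)
  also have "\<dots> = ?c" using pos u by simp
  finally show ?thesis using pos by (simp add: ln_le_cancel_iff[symmetric] del: ln_le_cancel_iff)
qed

text \<open>For parameters tending to 0 the discounts tend to the indicator of a finite hitting
  time, which is the discount at 0; samples that never hit contribute 0 throughout. A single
  sequence will be enough later because of monotonicity in the parameter.\<close>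

lemma e_fun_tendsto_0:
  assumes env: "environment \<omega> \<sigma> 0"
  shows "(\<lambda>k. e_fun (1 / real (Suc k)) x y \<omega> \<sigma>) \<longlonglongrightarrow> e_fun 0 x y \<omega> \<sigma>"
proof -
  interpret z: environment \<omega> \<sigma> 0 by fact
  have k: "environment \<omega> \<sigma> (1 / real (Suc k))" for k
    by unfold_locales (use z.omega z.sigma in auto)
  interpret J: prob_space "joint_law \<omega> \<sigma> x" by (rule z.prob_space_joint)
  show ?thesis
    unfolding z.e_fun_eq_integral environment.e_fun_eq_integral[OF k]
  proof (rule integral_dominated_convergence[where w = "\<lambda>_. 1"])
    show "AE p in joint_law \<omega> \<sigma> x. (\<lambda>k. discount (1 / real (Suc k)) y p) \<longlonglongrightarrow> discount 0 y p"
    proof (rule AE_I2)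
      fix p assume "p \<in> space (joint_law \<omega> \<sigma> x)"
      then show "(\<lambda>k. discount (1 / real (Suc k)) y p) \<longlonglongrightarrow> discount 0 y p"
      proof (rule z.discount_cases[where y = y])
        fix h assume h: "\<And>l. discount l y p = exp (- l * h)"
        have "(\<lambda>k. exp (- (1 / real (Suc k)) * h)) \<longlonglongrightarrow> exp (- 0 * h)"
          by (intro tendsto_intros LIMSEQ_Suc[OF lim_const_over_n])
        then show ?thesis unfolding h by simp
      qed simp
    qed
    show "AE p in joint_law \<omega> \<sigma> x. norm (discount (1 / real (Suc k)) y p) \<le> 1" for k
    proof (rule AE_I2)
      fix p assume "p \<in> space (joint_law \<omega> \<sigma> x)"
      then show "norm (discount (1 / real (Suc k)) y p) \<le> 1"
        by (rule z.discount_cases[where y = y]) auto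
    qed
  qed (use z.discount_meas environment.discount_meas[OF k] in auto)
qed

section \<open>Annealed estimates\<close>

text \<open>On a probability space the pointwise bound |x| \<le> 1 + |x|^p reduces the first moment
  to the p-th one.\<close>

lemma in_Lp_imp_integrable:
  assumes M: "prob_space M" and f: "in_Lp p M f" and p: "1 \<le> p"
  shows "AE w in M. \<bar>f w\<bar> \<noteq> \<infinity>" and "integrable M (\<lambda>w. real_of_ereal (f w))"
proof -
  interpret prob_space M by fact
  have [measurable]: "f \<in> borel_measurable M" using f by (simp add: in_Lp_def)
  have [measurable]: "(\<lambda>w. \<bar>f w\<bar> ^ n) \<in> borel_measurable M" for n by (induction n) auto
  have le: "e2ennreal \<bar>x\<bar> \<le> 1 + e2ennreal (\<bar>x\<bar> ^ p)" for x :: ereal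
  proof (cases x)
    case (real r)
    have "\<bar>r\<bar> \<le> 1 + \<bar>r\<bar> ^ p"
      using self_le_power[of "\<bar>r\<bar>" p] p zero_le_power[OF abs_ge_zero[of r], of p] by linarith
    then have "ennreal \<bar>r\<bar> \<le> ennreal (1 + \<bar>r\<bar> ^ p)" by (rule ennreal_leI)
    then have "ennreal \<bar>r\<bar> \<le> ennreal 1 + ennreal (\<bar>r\<bar> ^ p)"
      by (subst (asm) ennreal_plus) auto
    moreover have "\<bar>ereal r\<bar> ^ p = ereal (\<bar>r\<bar> ^ p)" by simp
    ultimately show ?thesis unfolding real by simp
  qed (use p in \<open>auto simp: e2ennreal_infty\<close>)
  have "(\<integral>\<^sup>+w. e2ennreal \<bar>f w\<bar> \<partial>M) \<le> (\<integral>\<^sup>+w. 1 + e2ennreal (\<bar>f w\<bar> ^ p) \<partial>M)"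
    by (intro nn_integral_mono le)
  also have "\<dots> = 1 + (\<integral>\<^sup>+w. e2ennreal (\<bar>f w\<bar> ^ p) \<partial>M)"
    by (subst nn_integral_add) (auto simp: emeasure_space_1)
  also have "\<dots> < \<infinity>" using f by (simp add: in_Lp_def)
  finally have fin: "(\<integral>\<^sup>+w. e2ennreal \<bar>f w\<bar> \<partial>M) < \<infinity>" .
  then have "AE w in M. e2ennreal \<bar>f w\<bar> \<noteq> \<infinity>"
    by (intro nn_integral_noteq_infinite) auto
  then show "AE w in M. \<bar>f w\<bar> \<noteq> \<infinity>"
    by eventually_elim (auto simp: e2ennreal_infty)
  show "integrable M (\<lambda>w. real_of_ereal (f w))"
  proof (rule integrableI_bounded)
    have "ennreal (norm (real_of_ereal x)) \<le> e2ennreal \<bar>x\<bar>" for x by (cases x) auto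
    then have "(\<integral>\<^sup>+w. ennreal (norm (real_of_ereal (f w))) \<partial>M) \<le> (\<integral>\<^sup>+w. e2ennreal \<bar>f w\<bar> \<partial>M)"
      by (intro nn_integral_mono)
    with fin show "(\<integral>\<^sup>+w. ennreal (norm (real_of_ereal (f w))) \<partial>M) < \<infinity>" by order
  qed measurable
qed

lemma expect_eq_integral:
  assumes AE: "AE w in M. f w = ereal (g w)" and g: "integrable M g" and nonneg: "AE w in M. 0 \<le> g w"
  shows "expect M f = ereal (integral\<^sup>L M g)"
proof -
  have "(\<integral>\<^sup>+w. e2ennreal (f w) \<partial>M) = (\<integral>\<^sup>+w. ennreal (g w) \<partial>M)"
    using AE by (intro nn_integral_cong_AE) auto
  also have "\<dots> = ennreal (integral\<^sup>L M g)" by (rule nn_integral_eq_integral[OF g nonneg])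
  finally have 1: "(\<integral>\<^sup>+w. e2ennreal (f w) \<partial>M) = ennreal (integral\<^sup>L M g)" .
  have "(\<integral>\<^sup>+w. e2ennreal (- f w) \<partial>M) = (\<integral>\<^sup>+w. 0 \<partial>M)"
    using AE nonneg by (intro nn_integral_cong_AE, eventually_elim) (simp add: ennreal_neg)
  with 1 show ?thesis using integral_nonneg_AE[OF nonneg] by (simp add: expect_def zero_ennreal.rep_eq)
qed

lemma distr_pair_snd:
  assumes "prob_space M" "prob_space N"
  shows "distr (M \<Otimes>\<^sub>M N) N snd = N"
proof (rule measure_eqI)
  interpret M: prob_space M by fact
  interpret N: prob_space N by fact
  fix A assume "A \<in> sets (distr (M \<Otimes>\<^sub>M N) N snd)"
  then have A: "A \<in> sets N" by simp
  have "emeasure (distr (M \<Otimes>\<^sub>M N) N snd) A = emeasure (M \<Otimes>\<^sub>M N) (space M \<times> A)"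
    using A sets.sets_into_space[OF A] by (auto simp: emeasure_distr space_pair_measure intro!: arg_cong[where f = "emeasure (M \<Otimes>\<^sub>M N)"])
  then show "emeasure (distr (M \<Otimes>\<^sub>M N) N snd) A = emeasure N A"
    by (simp add: N.emeasure_pair_measure_Times A M.emeasure_space_1)
qed simp

lemma (in environment) theta_nonneg: "0 \<le> theta lam \<sigma> x"
  using laplace_le_1[of x] laplace_pos[of x] by (simp add: theta_def laplace_def)

text \<open>Jensen's inequality through the tangent of exp at the mean: exp (- lam s) lies above exp
  (- m) (1 + m - lam s), and the latter integrates to exp (- m).\<close>

lemma (in environment) theta_le:
  assumes fin: "(\<integral>\<^sup>+s. ennreal s \<partial>\<sigma> x) \<noteq> \<infinity>"
  shows "theta lam \<sigma> x \<le> lam * enn2real (\<integral>\<^sup>+s. ennreal s \<partial>\<sigma> x)"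
proof -
  interpret prob_space "\<sigma> x" by (rule prob_space_sigma)
  have pos: "AE s in \<sigma> x. 0 \<le> s" by (rule AE_I2) (simp add: space_sigma)
  have meas: "(\<lambda>s. s) \<in> borel_measurable (\<sigma> x)" by (rule borel_sigma) simp
  have int: "integrable (\<sigma> x) (\<lambda>s. s)"
    using fin by (intro integrableI_nonneg meas pos) (simp add: less_top)
  define m where "m = lam * (\<integral>s. s \<partial>\<sigma> x)"
  have "exp (- m) = (\<integral>s. exp (- m) * (1 + m - lam * s) \<partial>\<sigma> x)"
    using int by (simp add: prob_space m_def)
  also have "\<dots> \<le> laplace lam \<sigma> x" unfolding laplace_def
  proof (rule integral_mono[OF _ exp_integrable])
    fix s
    have "exp (- m) * (1 + (m - lam * s)) \<le> exp (- m) * exp (m - lam * s)"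
      by (intro mult_left_mono exp_ge_add_one_self) simp
    then show "exp (- m) * (1 + m - lam * s) \<le> exp (- lam * s)"
      by (simp add: exp_add[symmetric] add_diff_eq)
  qed (use int in auto)
  finally have "ln (exp (- m)) \<le> ln (laplace lam \<sigma> x)" using laplace_pos by (subst ln_le_cancel_iff) auto
  moreover have "(\<integral>s. s \<partial>\<sigma> x) = enn2real (\<integral>\<^sup>+s. ennreal s \<partial>\<sigma> x)"
    by (rule integral_eq_nn_integral[OF meas pos])
  ultimately show ?thesis by (simp add: theta_def laplace_def m_def)
qed

definition elliptic :: "('d::finite site \<Rightarrow> 'd site measure) \<Rightarrow> bool" where
  "elliptic \<omega> \<longleftrightarrow> (\<forall>x. \<forall>e\<in>unit_steps. 0 < measure (\<omega> x) {e})"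

text \<open>Discarding the null set of non-elliptic environments makes \<open>a_fun\<close> real-valued and its triangle
  inequality valid everywhere.\<close>

definition cost :: "real \<Rightarrow> 'd::finite site \<Rightarrow> 'd site \<Rightarrow>
    ('d site \<Rightarrow> 'd site measure) \<times> ('d site \<Rightarrow> real measure) \<Rightarrow> real" where
  "cost lam x y = (\<lambda>(\<omega>, \<sigma>). if elliptic \<omega> then - ln (e_fun lam x y \<omega> \<sigma>) else 0)"

locale random_environment =
  fixes \<nu> :: "'d::finite site measure measure" and \<mu> :: "real measure measure"
  assumes nu: "\<nu> \<in> space (prob_algebra P1)" and mu: "\<mu> \<in> space (prob_algebra P2)"
    and log_Lp: "in_Lp CARD('d) (env_law \<nu>) (\<lambda>\<omega>. elog (MIN e\<in>unit_steps. measure (\<omega> 0) {e}))"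
    and mean_Lp: "in_Lp CARD('d) (hold_law \<mu> :: ('d site \<Rightarrow> real measure) measure)
           (\<lambda>\<sigma>. enn2ereal (\<integral>\<^sup>+s. ennreal s \<partial>\<sigma> 0))"
begin

abbreviation E :: "('d site \<Rightarrow> 'd site measure) measure" where "E \<equiv> env_law \<nu>"
abbreviation S :: "('d site \<Rightarrow> real measure) measure" where "S \<equiv> hold_law \<mu>"
abbreviation M :: "(('d site \<Rightarrow> 'd site measure) \<times> ('d site \<Rightarrow> real measure)) measure" where "M \<equiv> E \<Otimes>\<^sub>M S"
abbreviation T :: "'d site \<Rightarrow> ('d site \<Rightarrow> 'd site measure) \<times> ('d site \<Rightarrow> real measure)
    \<Rightarrow> ('d site \<Rightarrow> 'd site measure) \<times> ('d site \<Rightarrow> real measure)" where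
  "T z \<equiv> (\<lambda>(\<omega>, \<sigma>). (shift z \<omega>, shift z \<sigma>))"

lemma sets_nu: "sets \<nu> = sets P1" and prob_nu: "prob_space \<nu>"
  and sets_mu: "sets \<mu> = sets P2" and prob_mu: "prob_space \<mu>"
  using nu mu by (auto simp: space_prob_algebra)

lemma prob_E: "prob_space E" and prob_S: "prob_space S"
  unfolding env_law_def hold_law_def by (auto intro!: prob_space_PiM simp: prob_nu prob_mu)

sublocale E: prob_space E by (rule prob_E)
sublocale S: prob_space S by (rule prob_S)
sublocale M: pair_prob_space E S ..

lemma env_component [measurable]: "(\<lambda>\<omega>. \<omega> x) \<in> E \<rightarrow>\<^sub>M P1"
  unfolding env_law_def measurable_cong_sets[OF refl sets_nu, symmetric]
  by (rule measurable_component_singleton) simp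

lemma hold_component [measurable]: "(\<lambda>\<sigma>. \<sigma> x) \<in> S \<rightarrow>\<^sub>M P2"
  unfolding hold_law_def measurable_cong_sets[OF refl sets_mu, symmetric]
  by (rule measurable_component_singleton) simp

lemma environmentI: "(\<omega>, \<sigma>) \<in> space M \<Longrightarrow> 0 \<le> lam \<Longrightarrow> environment \<omega> \<sigma> lam"
  using measurable_space[OF env_component] measurable_space[OF hold_component]
  by unfold_locales (auto simp: space_pair_measure)

lemma step_meas [measurable]: "e \<in> unit_steps \<Longrightarrow> (\<lambda>\<omega>. measure (\<omega> x) {e}) \<in> borel_measurable E"
  by (rule measurable_compose[OF env_component]) (simp add: P1_def)

lemma laplace_meas [measurable]: "(\<lambda>\<sigma>. laplace lam \<sigma> x) \<in> borel_measurable S"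
proof -
  have "(\<lambda>N. \<integral>s. exp (- lam * s) \<partial>N) \<in> borel_measurable P2"
    unfolding P2_def prob_algebra_def
    by (intro measurable_restrict_space1 integral_measurable_subprob_algebra) measurable
  then show ?thesis unfolding laplace_def by (rule measurable_compose[OF hold_component])
qed

lemma hit_upto_meas: "(\<lambda>w. hit_upto lam (fst w) (snd w) y N x) \<in> borel_measurable M"
proof (induction N arbitrary: x)
  case (Suc N)
  have "(\<lambda>w. measure (fst w x) {e} * hit_upto lam (fst w) (snd w) y N (x + e)) \<in> borel_measurable M"
    if "e \<in> unit_steps" for e
    by (intro borel_measurable_times Suc measurable_compose[OF measurable_fst step_meas[OF that]])
  then have "(\<lambda>w. laplace lam (snd w) x * (\<Sum>e\<in>unit_steps. measure (fst w x) {e} * hit_upto lam (fst w) (snd w) y N (x + e)))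
      \<in> borel_measurable M"
    by (intro borel_measurable_times[OF measurable_compose[OF measurable_snd laplace_meas]] borel_measurable_sum)
  then show ?case by simp
qed simp

lemma e_fun_meas: "0 \<le> lam \<Longrightarrow> (\<lambda>w. e_fun lam x y (fst w) (snd w)) \<in> borel_measurable M"
  by (rule borel_measurable_LIMSEQ_real[OF _ hit_upto_meas])
     (auto intro!: environment.hit_upto_tendsto environmentI)

lemma elliptic_sets [measurable]: "{\<omega> \<in> space E. elliptic \<omega>} \<in> sets E"
proof -
  have "{\<omega> \<in> space E. 0 < measure (\<omega> x) {e}} \<in> sets E" if "e \<in> unit_steps" for x e
    using step_meas[OF that, of x] by measurable
  then have "{\<omega> \<in> space E. \<forall>e\<in>unit_steps. 0 < measure (\<omega> x) {e}} \<in> sets E" for x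
    by (intro sets.sets_Collect_finite_All finite_unit_steps)
  then show ?thesis unfolding elliptic_def by (intro sets.sets_Collect_countable_All)
qed

lemma cost_meas: "0 \<le> lam \<Longrightarrow> cost lam x y \<in> borel_measurable M"
proof -
  assume "0 \<le> lam"
  note [measurable] = e_fun_meas[OF this, of x y]
  have [measurable]: "{w \<in> space M. elliptic (fst w)} \<in> sets M"
  proof -
    have "{w \<in> space M. elliptic (fst w)} = fst -` {\<omega> \<in> space E. elliptic \<omega>} \<inter> space M"
      by (auto simp: space_pair_measure)
    then show ?thesis using measurable_sets[OF measurable_fst elliptic_sets, of S] by simp
  qed
  have "(\<lambda>w. if elliptic (fst w) then - ln (e_fun lam x y (fst w) (snd w)) else 0) \<in> borel_measurable M"
    by measurable
  then show ?thesis by (simp add: cost_def split_beta')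
qed

lemma AE_fst: assumes P: "AE \<omega> in E. P \<omega>" shows "AE w in M. P (fst w)"
proof -
  have "AE \<omega> in distr M E fst. P \<omega>" unfolding S.distr_pair_fst by (rule P)
  then show ?thesis by (rule AE_distrD[OF measurable_fst])
qed

lemma integral_fst': "h \<in> borel_measurable E \<Longrightarrow> (\<integral>w. h (fst w) \<partial>M) = (\<integral>\<omega>. (h \<omega> :: real) \<partial>E)"
  using integral_distr[of fst M E h] by (simp add: S.distr_pair_fst)

lemma integrable_fst': "integrable E h \<Longrightarrow> integrable M (\<lambda>w. h (fst w) :: real)"
  using integrable_distr_eq[of fst M E h] by (simp add: S.distr_pair_fst borel_measurable_integrable)

lemma integral_snd': "h \<in> borel_measurable S \<Longrightarrow> (\<integral>w. h (snd w) \<partial>M) = (\<integral>\<sigma>. (h \<sigma> :: real) \<partial>S)"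
  using integral_distr[of snd M S h] by (simp add: distr_pair_snd[OF prob_E prob_S])

lemma integrable_snd': "integrable S h \<Longrightarrow> integrable M (\<lambda>w. h (snd w) :: real)"
  using integrable_distr_eq[of snd M S h] by (simp add: distr_pair_snd[OF prob_E prob_S] borel_measurable_integrable)

text \<open>An almost surely finite logarithm of the minimum excludes zero probabilities, and the
  logarithm for one direction lies between that of the minimum and 0, which transfers
  integrability.\<close>

lemma
  shows AE_step_pos: "AE \<omega> in E. \<forall>e\<in>unit_steps. 0 < measure (\<omega> 0) {e}"
    and log_step_integrable: "e \<in> unit_steps \<Longrightarrow> integrable E (\<lambda>\<omega>. - ln (measure (\<omega> 0) {e}))"
proof -
  let ?m = "\<lambda>\<omega>. MIN e\<in>unit_steps. measure (\<omega> (0 :: 'd site)) {e :: 'd site}"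
  have "1 \<le> CARD('d)" by (simp add: Suc_leI)
  note L = in_Lp_imp_integrable[OF prob_E log_Lp this]
  have le: "?m \<omega> \<le> measure (\<omega> 0) {e}" if "e \<in> unit_steps" for \<omega> and e :: "'d site"
    using that finite_unit_steps by (intro Min_le) auto
  have "?m \<omega> \<in> (\<lambda>e. measure (\<omega> 0) {e}) ` unit_steps" for \<omega> :: "'d site \<Rightarrow> 'd site measure"
    using finite_unit_steps unit_steps_nonempty by (intro Min_in) auto
  then have nonneg: "0 \<le> ?m \<omega>" for \<omega> :: "'d site \<Rightarrow> 'd site measure" by (metis (no_types, lifting) imageE measure_nonneg)
  have AE_m: "AE \<omega> in E. 0 < ?m \<omega>"
    using L(1)
  proof (eventually_elim)
    case (elim \<omega>)
    then have "?m \<omega> \<noteq> 0" by (auto simp: elog_def)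
    with nonneg[of \<omega>] show ?case by linarith
  qed
  then show AE_pos: "AE \<omega> in E. \<forall>e\<in>unit_steps. 0 < measure (\<omega> 0) {e}"
    by eventually_elim (use le less_le_trans in blast)
  assume e: "e \<in> unit_steps"
  show "integrable E (\<lambda>\<omega>. - ln (measure (\<omega> 0) {e}))"
  proof (rule Bochner_Integration.integrable_bound[OF L(2)])
    show "(\<lambda>\<omega>. - ln (measure (\<omega> 0) {e})) \<in> borel_measurable E" using step_meas[OF e] by measurable
    show "AE \<omega> in E. norm (- ln (measure (\<omega> 0) {e})) \<le> norm (real_of_ereal (elog (?m \<omega>)))"
      using AE_m AE_space
    proof eventually_elim
      case (elim \<omega>)
      have "prob_space (\<omega> 0)"
        using measurable_space[OF env_component elim(2), of 0] by (simp add: P1_def space_prob_algebra)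
      then have "measure (\<omega> 0) {e} \<le> 1" by (rule prob_space.prob_le_1)
      moreover have "?m \<omega> \<le> measure (\<omega> 0) {e}" by (rule le[OF e])
      ultimately have "0 \<le> - ln (measure (\<omega> 0) {e})" "- ln (measure (\<omega> 0) {e}) \<le> - ln (?m \<omega>)"
        using elim(1) by auto
      then show ?case using elim(1) by (simp add: elog_def)
    qed
  qed
qed

lemma measure_preserving_T: "measure_preserving M (T z)"
proof -
  interpret A: measure_preserving E "shift z"
    unfolding env_law_def by (rule measure_preserving_shift[OF prob_nu])
  interpret B: measure_preserving S "shift z"
    unfolding hold_law_def by (rule measure_preserving_shift[OF prob_mu])
  show ?thesis
  proof
    show "distr M M (T z) = M"
      using pair_measure_distr[OF A.T_meas B.T_meas] by (simp add: A.distr_T B.distr_T S.sigma_finite_measure_axioms)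
  qed simp
qed

lemma mixing_map_T: "z \<noteq> 0 \<Longrightarrow> mixing_map M (T z)"
  using mixing_map_pair[OF mixing_map_shift[OF prob_nu] mixing_map_shift[OF prob_mu], of z z]
  by (simp add: env_law_def hold_law_def)

lemma T_iter: "(T z ^^ n) w = T (int n *s z) w"
proof -
  have "(T z ^^ n) (\<omega>, \<sigma>) = ((shift z ^^ n) \<omega>, (shift z ^^ n) \<sigma>)" for \<omega> \<sigma> by (induction n) auto
  then show ?thesis by (cases w) (simp add: shift_iter)
qed

text \<open>Translation carries the condition at the origin to every site, and there are countably
  many sites.\<close>

lemma AE_elliptic: "AE w in M. elliptic (fst w)"
proof (rule AE_fst)
  have "AE \<omega> in E. \<forall>e\<in>unit_steps. 0 < measure (\<omega> x) {e}" for x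
  proof -
    interpret A: measure_preserving E "shift x"
      unfolding env_law_def by (rule measure_preserving_shift[OF prob_nu])
    have "AE \<omega> in distr E E (shift x). \<forall>e\<in>unit_steps. 0 < measure (\<omega> 0) {e}"
      unfolding A.distr_T by (rule AE_step_pos)
    from AE_distrD[OF A.T_meas this] show ?thesis by (simp add: shift_def)
  qed
  then show "AE \<omega> in E. elliptic \<omega>" unfolding elliptic_def by (simp add: AE_all_countable)
qed

lemma theta_meas: "(\<lambda>\<sigma>. theta lam \<sigma> x) \<in> borel_measurable S"
  using laplace_meas[of lam x] unfolding theta_def laplace_def by measurable

text \<open>Facts about holding laws alone are stated in \<open>environment\<close>, which also asks
  for some \<omega>; any point of the nonempty space of \<open>E\<close> serves.\<close>

lemma environmentI_S: "\<sigma> \<in> space S \<Longrightarrow> 0 \<le> lam \<Longrightarrow> \<exists>\<omega>. environment \<omega> \<sigma> lam"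
  using E.not_empty environmentI by (fastforce simp: space_pair_measure)

lemma theta_integrable: assumes lam: "0 \<le> lam" shows "integrable S (\<lambda>\<sigma>. theta lam \<sigma> 0)"
proof -
  have "1 \<le> CARD('d)" by (simp add: Suc_leI)
  note L = in_Lp_imp_integrable[OF prob_S mean_Lp this]
  have "integrable S (\<lambda>\<sigma>. lam * real_of_ereal (enn2ereal (\<integral>\<^sup>+s. ennreal s \<partial>\<sigma> 0)))"
    using L(2) by simp
  then show ?thesis
  proof (rule Bochner_Integration.integrable_bound)
    show "AE \<sigma> in S. norm (theta lam \<sigma> 0) \<le> norm (lam * real_of_ereal (enn2ereal (\<integral>\<^sup>+s. ennreal s \<partial>\<sigma> 0)))"
      using L(1)[simplified] AE_space
    proof eventually_elim
      case (elim \<sigma>)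
      obtain \<omega> where "environment \<omega> \<sigma> lam" using environmentI_S[OF elim(2) lam] by blast
      then interpret environment \<omega> \<sigma> lam .
      have "(\<integral>\<^sup>+s. ennreal s \<partial>\<sigma> 0) \<noteq> \<infinity>" using elim(1) by auto
      from theta_le[OF this]
      have "theta lam \<sigma> 0 \<le> lam * real_of_ereal (enn2ereal (\<integral>\<^sup>+s. ennreal s \<partial>\<sigma> 0))"
        unfolding enn2real_def .
      then show ?case unfolding real_norm_def abs_of_nonneg[OF theta_nonneg] by (rule order_trans[OF _ abs_ge_self])
    qed
  qed (rule theta_meas)
qed

lemma e_pos: "(\<omega>, \<sigma>) \<in> space M \<Longrightarrow> 0 \<le> lam \<Longrightarrow> elliptic \<omega> \<Longrightarrow> 0 < e_fun lam x y \<omega> \<sigma>"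
  by (rule environment.e_fun_pos[OF environmentI]) (auto simp: elliptic_def)

lemma cost_nonneg: "w \<in> space M \<Longrightarrow> 0 \<le> lam \<Longrightarrow> 0 \<le> cost lam x y w"
  using environment.e_fun_le_1[OF environmentI, of "fst w" "snd w" lam x y] e_pos[of "fst w" "snd w" lam x y]
  by (cases w) (auto simp: cost_def)

lemma cost_self: "w \<in> space M \<Longrightarrow> 0 \<le> lam \<Longrightarrow> cost lam x x w = 0"
  using environment.e_fun_self[OF environmentI, of "fst w" "snd w" lam x]
  by (cases w) (simp add: cost_def)

lemma cost_triangle:
  assumes w: "w \<in> space M" and lam: "0 \<le> lam"
  shows "cost lam x z w \<le> cost lam x y w + cost lam y z w"
proof -
  obtain \<omega> \<sigma> where [simp]: "w = (\<omega>, \<sigma>)" by (cases w)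
  show ?thesis
  proof (cases "elliptic \<omega>")
    case True
    note pos = e_pos[OF w[simplified] lam True]
    have "ln (e_fun lam x y \<omega> \<sigma> * e_fun lam y z \<omega> \<sigma>) \<le> ln (e_fun lam x z \<omega> \<sigma>)"
      using environment.e_fun_supermult[OF environmentI[OF w[simplified] lam], of x y z] pos
      by (subst ln_le_cancel_iff) auto
    then show ?thesis using True pos[of x y] pos[of y z] by (simp add: cost_def ln_mult)
  qed (simp add: cost_def)
qed

lemma cost_shift:
  assumes w: "w \<in> space M" and lam: "0 \<le> lam"
  shows "cost lam (x + z) (y + z) w = cost lam x y (T z w)"
proof -
  obtain \<omega> \<sigma> where [simp]: "w = (\<omega>, \<sigma>)" by (cases w)
  have "elliptic (shift z \<omega>) \<longleftrightarrow> elliptic \<omega>"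
    unfolding elliptic_def shift_def by (metis diff_add_cancel)
  then show ?thesis
    using environment.e_fun_shift[OF environmentI[OF w[simplified] lam]] by (simp add: cost_def)
qed

lemma cost_step_le:
  assumes w: "(\<omega>, \<sigma>) \<in> space M" and lam: "0 \<le> lam" and ell: "elliptic \<omega>" and e: "e \<in> unit_steps"
  shows "cost lam 0 e (\<omega>, \<sigma>) \<le> - ln (measure (\<omega> 0) {e}) + theta lam \<sigma> 0"
proof -
  interpret environment \<omega> \<sigma> lam by (rule environmentI[OF w lam])
  have p: "0 < measure (\<omega> 0) {e}" using ell e by (simp add: elliptic_def)
  have "ln (laplace lam \<sigma> 0 * measure (\<omega> 0) {e}) \<le> ln (e_fun lam 0 e \<omega> \<sigma>)"
    using e_fun_step_ge[OF e, of 0] laplace_pos[of 0] p e_pos[OF w lam ell, of 0 e] by (subst ln_le_cancel_iff) auto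
  moreover have "theta lam \<sigma> 0 = - ln (laplace lam \<sigma> 0)" by (simp add: theta_def laplace_def)
  ultimately show ?thesis using ell p laplace_pos[of 0] by (simp add: cost_def ln_mult)
qed

text \<open>The coefficient of the upper bound. It is also a Lipschitz constant, in the l1 norm, for
  \<open>mean_cost\<close> and for the exponent.\<close>

definition step_bound :: "real \<Rightarrow> real" where
  "step_bound lam = (MAX e\<in>unit_steps. \<integral>\<omega>. - ln (measure (\<omega> 0) {e}) \<partial>E) + (\<integral>\<sigma>. theta lam \<sigma> 0 \<partial>S)"

definition mean_cost :: "real \<Rightarrow> 'd site \<Rightarrow> real" where
  "mean_cost lam z = (\<integral>w. cost lam 0 z w \<partial>M)"

lemma
  assumes lam: "0 \<le> lam" and e: "e \<in> unit_steps"
  shows cost_step_integrable: "integrable M (cost lam 0 e)"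
    and mean_cost_step_le: "mean_cost lam e \<le> step_bound lam"
proof -
  let ?b = "\<lambda>w. - ln (measure (fst w 0) {e}) + theta lam (snd w) 0"
  have b: "integrable M ?b"
    using integrable_fst'[OF log_step_integrable[OF e]] integrable_snd'[OF theta_integrable[OF lam]]
    by (rule Bochner_Integration.integrable_add)
  have le: "AE w in M. cost lam 0 e w \<le> ?b w"
    using AE_elliptic AE_space 
  proof eventually_elim
    case (elim w)
    then show ?case using cost_step_le[of "fst w" "snd w" lam e] lam e by simp
  qed
  show int: "integrable M (cost lam 0 e)"
  proof (rule Bochner_Integration.integrable_bound[OF b cost_meas[OF lam]])
    show "AE w in M. norm (cost lam 0 e w) \<le> norm (?b w)"
      using le AE_space by eventually_elim (use cost_nonneg[OF _ lam] in fastforce)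
  qed
  have "mean_cost lam e \<le> (\<integral>w. ?b w \<partial>M)"
    unfolding mean_cost_def by (rule integral_mono_AE[OF int b le])
  also have "\<dots> = (\<integral>\<omega>. - ln (measure (\<omega> 0) {e}) \<partial>E) + (\<integral>\<sigma>. theta lam \<sigma> 0 \<partial>S)"
    using integrable_fst'[OF log_step_integrable[OF e]] integrable_snd'[OF theta_integrable[OF lam]]
      integral_fst'[OF borel_measurable_integrable[OF log_step_integrable[OF e]]] integral_snd'[OF theta_meas]
    by (subst Bochner_Integration.integral_add) auto
  also have "\<dots> \<le> step_bound lam"
    unfolding step_bound_def using e finite_unit_steps by (intro add_right_mono Max_ge) auto
  finally show "mean_cost lam e \<le> step_bound lam" .
qed

text \<open>Induction along a shortest path: the last step is a one-step cost in a translated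
  environment, and translation does not change its expectation.\<close>

lemma
  assumes lam: "0 \<le> lam"
  shows cost_integrable: "integrable M (cost lam 0 z)"
    and mean_cost_le: "mean_cost lam z \<le> step_bound lam * site_norm z"
proof -
  have "integrable M (cost lam 0 z) \<and> mean_cost lam z \<le> step_bound lam * site_norm z"
  proof (induction "site_norm z" arbitrary: z)
    case 0
    then have z: "z = 0" by (simp add: site_norm_def vec_eq_iff)
    have "integrable M (\<lambda>w. 0 :: real)" by simp
    then have "integrable M (cost lam 0 0)"
      by (subst Bochner_Integration.integrable_cong[OF refl, where g = "\<lambda>_. 0"]) (auto simp: cost_self lam)
    moreover have "mean_cost lam 0 = (\<integral>w. 0 \<partial>M)"
      unfolding mean_cost_def by (rule Bochner_Integration.integral_cong) (auto simp: cost_self lam)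
    ultimately show ?case by (simp add: z)
  next
    case (Suc n)
    then obtain v e where z: "z = v + e" "site_norm v = n" "e \<in> unit_steps" by (metis site_norm_SucE)
    interpret T: measure_preserving M "T v" by (rule measure_preserving_T)
    note IH = Suc(1)[OF z(2)[symmetric]]
    have int1: "integrable M (\<lambda>w. cost lam 0 e (T v w))"
      using T.integrable_iter[OF cost_step_integrable[OF lam z(3)], of 1] by simp
    have le: "cost lam 0 z w \<le> cost lam 0 v w + cost lam 0 e (T v w)" if "w \<in> space M" for w
      using cost_triangle[OF that lam, of 0 z v] cost_shift[OF that lam, of 0 v e] by (simp add: z add.commute)
    have b: "integrable M (\<lambda>w. cost lam 0 v w + cost lam 0 e (T v w))"
      using IH int1 by (intro Bochner_Integration.integrable_add) auto
    have int: "integrable M (cost lam 0 z)"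
    proof (rule Bochner_Integration.integrable_bound[OF b cost_meas[OF lam]], rule AE_I2)
      fix w assume w: "w \<in> space M"
      show "norm (cost lam 0 z w) \<le> norm (cost lam 0 v w + cost lam 0 e (T v w))"
        using le[OF w] cost_nonneg[OF w lam, of 0 z] by simp
    qed
    have "mean_cost lam z \<le> (\<integral>w. cost lam 0 v w + cost lam 0 e (T v w) \<partial>M)"
      unfolding mean_cost_def by (rule integral_mono[OF int b le])
    also have "\<dots> = mean_cost lam v + mean_cost lam e"
      using IH int1 T.integral_iter[OF cost_meas[OF lam], of 0 e 1] unfolding mean_cost_def
      by (subst Bochner_Integration.integral_add) auto
    also have "\<dots> \<le> step_bound lam * site_norm v + step_bound lam"
      using IH mean_cost_step_le[OF lam z(3)] by simp
    also have "\<dots> = step_bound lam * site_norm z" using Suc(2) z(2) by (simp add: algebra_simps flip: Suc(2))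
    finally show ?case using int by simp
  qed
  then show "integrable M (cost lam 0 z)" "mean_cost lam z \<le> step_bound lam * site_norm z" by auto
qed

lemma mean_cost_nonneg: "0 \<le> lam \<Longrightarrow> 0 \<le> mean_cost lam z"
  unfolding mean_cost_def by (intro integral_nonneg_AE AE_I2 cost_nonneg)

lemma cost_add_le:
  assumes "w \<in> space M" "0 \<le> lam"
  shows "cost lam 0 (x + y) w \<le> cost lam 0 x w + cost lam 0 y (T x w)"
  using cost_triangle[OF assms, of 0 "x + y" x] cost_shift[OF assms, of 0 x y] by (simp add: add.commute)

lemma mean_cost_subadditive:
  assumes lam: "0 \<le> lam"
  shows "mean_cost lam (x + y) \<le> mean_cost lam x + mean_cost lam y"
proof -
  interpret T: measure_preserving M "T x" by (rule measure_preserving_T)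
  have int: "integrable M (\<lambda>w. cost lam 0 y (T x w))"
    using T.integrable_iter[OF cost_integrable[OF lam], of y 1] by simp
  have "mean_cost lam (x + y) \<le> (\<integral>w. cost lam 0 x w + cost lam 0 y (T x w) \<partial>M)"
    unfolding mean_cost_def
    using int by (intro integral_mono cost_integrable lam Bochner_Integration.integrable_add cost_add_le)
  also have "\<dots> = mean_cost lam x + mean_cost lam y"
    using int cost_integrable[OF lam] T.integral_iter[OF cost_meas[OF lam], of 0 y 1] unfolding mean_cost_def
    by (subst Bochner_Integration.integral_add) auto
  finally show ?thesis .
qed

end

section \<open>Lyapunov exponents\<close>

lemma l1norm_triangle: "l1norm (x + y) \<le> l1norm x + l1norm y"
  unfolding l1norm_def sum.distrib[symmetric] by (rule sum_mono) (simp add: abs_triangle_ineq)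

lemma l1norm_scaleR: "l1norm (c *\<^sub>R x) = \<bar>c\<bar> * l1norm x"
  by (simp add: l1norm_def abs_mult sum_distrib_left)

lemma l1norm_minus_commute: "l1norm (x - y) = l1norm (y - x)"
  by (simp add: l1norm_def abs_minus_commute)

lemma l1norm_nonneg: "0 \<le> l1norm x"
  by (simp add: l1norm_def sum_nonneg)

lemma l1norm_triangle_diff: "l1norm (x - z) \<le> l1norm (x - y) + l1norm (y - z)"
  using l1norm_triangle[of "x - y" "y - z"] by simp

lemma embed_add: "embed (x + y) = embed x + embed y" and embed_diff: "embed (x - y) = embed x - embed y"
  and embed_smult: "embed (int n *s x) = real n *\<^sub>R embed x"
  by (simp_all add: embed_def vec_eq_iff)

definition lattice_floor :: "nat \<Rightarrow> real ^ 'd \<Rightarrow> 'd::finite site" where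
  "lattice_floor n x = (\<chi> i. \<lfloor>real n * x $ i\<rfloor>)"

lemma l1norm_lattice_floor: "l1norm (embed (lattice_floor n x) - real n *\<^sub>R (x :: real ^ 'd::finite)) \<le> real CARD('d)"
proof -
  have "l1norm (embed (lattice_floor n x) - real n *\<^sub>R x) \<le> (\<Sum>i\<in>(UNIV :: 'd set). 1)"
    unfolding l1norm_def
  proof (rule sum_mono)
    fix i
    show "\<bar>(embed (lattice_floor n x) - real n *\<^sub>R x) $ i\<bar> \<le> 1"
      by (simp add: embed_def lattice_floor_def) linarith
  qed
  then show ?thesis by simp
qed

text \<open>Each coordinate of the rounding defect is 0 or 1.\<close>

lemma lattice_floor_add: "site_norm (lattice_floor (m + n) x - (lattice_floor m x + lattice_floor n x) :: 'd::finite site) \<le> CARD('d)"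
proof -
  have "nat \<bar>(lattice_floor (m + n) x - (lattice_floor m x + lattice_floor n x)) $ i\<bar> \<le> 1" for i
  proof -
    have "\<lfloor>real (m + n) * x $ i\<rfloor> - (\<lfloor>real m * x $ i\<rfloor> + \<lfloor>real n * x $ i\<rfloor>) \<in> {0, 1}"
      using floor_add[of "real m * x $ i" "real n * x $ i"] by (simp add: distrib_right)
    then show ?thesis by (auto simp: lattice_floor_def)
  qed
  then have "site_norm (lattice_floor (m + n) x - (lattice_floor m x + lattice_floor n x)) \<le> (\<Sum>i\<in>(UNIV :: 'd set). 1)"
    unfolding site_norm_def by (intro sum_mono)
  then show ?thesis by simp
qed

definition approximates :: "(nat \<Rightarrow> 'd::finite site) \<Rightarrow> real ^ 'd \<Rightarrow> bool" where
  "approximates z x \<longleftrightarrow> (\<lambda>n. l1norm (embed (z n) - real n *\<^sub>R x) / n) \<longlonglongrightarrow> 0"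

lemma approximatesI:
  assumes "\<And>n. l1norm (embed (z n) - real n *\<^sub>R x) \<le> C" shows "approximates z x"
  unfolding approximates_def
proof (rule tendsto_sandwich[OF _ _ tendsto_const])
  show "(\<lambda>n. C / real n) \<longlonglongrightarrow> 0" by (rule lim_const_over_n)
qed (auto intro!: always_eventually divide_right_mono assms simp: l1norm_nonneg)

lemma approximates_lattice_floor: "approximates (\<lambda>n. lattice_floor n x) x"
  by (rule approximatesI[OF l1norm_lattice_floor])

context random_environment
begin

lemma step_bound_nonneg: "0 \<le> lam \<Longrightarrow> 0 \<le> step_bound lam"
  using unit_steps_nonempty mean_cost_nonneg mean_cost_step_le order_trans by blast

lemma mean_cost_diff_le:
  assumes "0 \<le> lam"
  shows "\<bar>mean_cost lam z - mean_cost lam w\<bar> \<le> step_bound lam * l1norm (embed z - embed w)"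
proof -
  have "mean_cost lam z \<le> mean_cost lam w + step_bound lam * l1norm (embed z - embed w)" for z w
    using mean_cost_subadditive[OF assms, of w "z - w"] mean_cost_le[OF assms, of "z - w"]
    by (simp add: embed_diff[symmetric] l1norm_embed)
  from this[of z w] this[of w z] show ?thesis by (simp add: l1norm_minus_commute[of "embed w"])
qed

lemma mean_cost_0 [simp]: "0 \<le> lam \<Longrightarrow> mean_cost lam 0 = 0"
  using mean_cost_le[of lam 0] mean_cost_nonneg[of lam 0] by simp

definition lyapunov :: "real \<Rightarrow> real ^ 'd \<Rightarrow> real" where
  "lyapunov lam x = lim (\<lambda>n. mean_cost lam (lattice_floor n x) / n)"

text \<open>Rounding spoils subadditivity by at most the mean cost of the rounding defect, which is
  bounded by \<open>step_bound lam * CARD('d)\<close>. The inequality for fixed \<open>n\<close>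
  will give continuity at parameter 0.\<close>

lemma
  assumes lam: "0 \<le> lam"
  shows lyapunov_tendsto: "(\<lambda>n. mean_cost lam (lattice_floor n x) / n) \<longlonglongrightarrow> lyapunov lam x"
    and lyapunov_le: "1 \<le> n \<Longrightarrow> lyapunov lam x \<le> (mean_cost lam (lattice_floor n x) + step_bound lam * CARD('d)) / n"
proof -
  let ?h = "\<lambda>n. mean_cost lam (lattice_floor n x)" and ?K = "step_bound lam * CARD('d)"
  have sub: "?h (m + n) \<le> ?h m + ?h n + ?K" for m n
  proof -
    let ?r = "lattice_floor (m + n) x - (lattice_floor m x + lattice_floor n x)"
    have "?h (m + n) \<le> mean_cost lam (lattice_floor m x + lattice_floor n x) + mean_cost lam ?r"
      using mean_cost_subadditive[OF lam, of "lattice_floor m x + lattice_floor n x" ?r] by simp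
    also have "mean_cost lam (lattice_floor m x + lattice_floor n x) \<le> ?h m + ?h n"
      by (rule mean_cost_subadditive[OF lam])
    also have "mean_cost lam ?r \<le> step_bound lam * site_norm ?r" by (rule mean_cost_le[OF lam])
    also have "\<dots> \<le> ?K" using lattice_floor_add step_bound_nonneg[OF lam] by (intro mult_left_mono) auto
    finally show ?thesis by simp
  qed
  have K: "0 \<le> ?K" using step_bound_nonneg[OF lam] by simp
  note lim = almost_subadditive_tendsto[of ?h ?K, OF sub mean_cost_nonneg[OF lam] K]
  have eq: "lyapunov lam x = (INF n\<in>{1..}. (?h n + ?K) / real n)"
    unfolding lyapunov_def by (rule limI[OF lim])
  show "(\<lambda>n. ?h n / n) \<longlonglongrightarrow> lyapunov lam x" unfolding eq by (rule lim)
  show "lyapunov lam x \<le> (?h n + ?K) / n" if "1 \<le> n"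
    unfolding eq by (rule cINF_lower) (use that K mean_cost_nonneg[OF lam] in \<open>auto intro!: bdd_belowI2[of _ 0]\<close>)
qed

text \<open>Two sequences approximating the same point differ by o(n), and \<open>mean_cost\<close>
  is Lipschitz.\<close>

lemma mean_cost_tendsto:
  assumes lam: "0 \<le> lam" and z: "approximates z x"
  shows "(\<lambda>n. mean_cost lam (z n) / n) \<longlonglongrightarrow> lyapunov lam x"
proof -
  let ?f = "\<lambda>n. lattice_floor n x"
  have "(\<lambda>n. mean_cost lam (z n) / n - mean_cost lam (?f n) / n) \<longlonglongrightarrow> 0"
  proof (rule Lim_null_comparison)
    show "(\<lambda>n. step_bound lam * (l1norm (embed (z n) - real n *\<^sub>R x) / n + l1norm (embed (?f n) - real n *\<^sub>R x) / n)) \<longlonglongrightarrow> 0"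
      using z approximates_lattice_floor[of x] unfolding approximates_def
      by (intro tendsto_mult_right_zero tendsto_add_zero)
    show "\<forall>\<^sub>F n in sequentially. norm (mean_cost lam (z n) / n - mean_cost lam (?f n) / n) \<le>
      step_bound lam * (l1norm (embed (z n) - real n *\<^sub>R x) / n + l1norm (embed (?f n) - real n *\<^sub>R x) / n)"
    proof (rule always_eventually, rule allI)
      fix n
      have "norm (mean_cost lam (z n) / n - mean_cost lam (?f n) / n) = \<bar>mean_cost lam (z n) - mean_cost lam (?f n)\<bar> / n"
        by (simp add: diff_divide_distrib[symmetric])
      also have "\<dots> \<le> step_bound lam * l1norm (embed (z n) - embed (?f n)) / n"
        by (intro divide_right_mono mean_cost_diff_le lam) simp
      also have "\<dots> \<le> step_bound lam * (l1norm (embed (z n) - real n *\<^sub>R x) + l1norm (real n *\<^sub>R x - embed (?f n))) / n"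
        by (intro divide_right_mono mult_left_mono l1norm_triangle_diff step_bound_nonneg lam) simp
      finally show "norm (mean_cost lam (z n) / n - mean_cost lam (?f n) / n) \<le>
        step_bound lam * (l1norm (embed (z n) - real n *\<^sub>R x) / n + l1norm (embed (?f n) - real n *\<^sub>R x) / n)"
        by (simp add: add_divide_distrib[symmetric] l1norm_minus_commute[of "embed (?f n)"])
    qed
  qed
  from tendsto_add[OF this lyapunov_tendsto[OF lam, of x]] show ?thesis by simp
qed

lemma lyapunov_nonneg: "0 \<le> lam \<Longrightarrow> 0 \<le> lyapunov lam x"
  by (rule LIMSEQ_le_const[OF lyapunov_tendsto]) (auto simp: mean_cost_nonneg)

text \<open>With \<open>k n\<close> the integer part of \<open>n q\<close>, the points
  \<open>lattice_floor (k n) x\<close> approximate \<open>q x\<close>; their costs over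
  \<open>n\<close> are the defining ratios for \<open>x\<close> at index \<open>k n\<close>,
  multiplied by \<open>k n / n\<close>.\<close>

lemma lyapunov_scaleR:
  assumes lam: "0 \<le> lam" and q: "0 < q"
  shows "lyapunov lam (q *\<^sub>R x) = q * lyapunov lam x"
proof -
  define k where "k n = nat \<lfloor>real n * q\<rfloor>" for n :: nat
  have k: "\<bar>real (k n) - real n * q\<bar> \<le> 1" for n
  proof -
    have "0 \<le> real n * q" using q by simp
    then show ?thesis unfolding k_def by linarith
  qed
  have kq: "(\<lambda>n. real (k n) / n) \<longlonglongrightarrow> q"
  proof -
    have "(\<lambda>n. real (k n) / n - q) \<longlonglongrightarrow> 0"
    proof (rule Lim_null_comparison[OF _ lim_const_over_n[of 1]])
      show "\<forall>\<^sub>F n in sequentially. norm (real (k n) / n - q) \<le> 1 / real n"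
        using eventually_gt_at_top[of 0]
      proof eventually_elim
        case (elim n)
        then have "real (k n) / n - q = (real (k n) - real n * q) / n" by (simp add: field_simps)
        then show ?case using k[of n] elim by (simp add: divide_right_mono)
      qed
    qed
    from tendsto_add[OF this tendsto_const[of q]] show ?thesis by simp
  qed
  have kinf: "filterlim k at_top sequentially"
  proof -
    have "filterlim (\<lambda>n. real n * q) at_top sequentially"
      using filterlim_tendsto_pos_mult_at_top[OF tendsto_const q filterlim_real_sequentially] by (simp add: mult.commute)
    then show ?thesis unfolding k_def
      by (intro filterlim_compose[OF filterlim_nat_sequentially] filterlim_compose[OF filterlim_floor_sequentially])
  qed
  have "approximates (\<lambda>n. lattice_floor (k n) x) (q *\<^sub>R x)"
  proof (rule approximatesI)
    fix n
    have "l1norm (embed (lattice_floor (k n) x) - real n *\<^sub>R q *\<^sub>R x) \<le>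
        l1norm (embed (lattice_floor (k n) x) - real (k n) *\<^sub>R x) + l1norm (real (k n) *\<^sub>R x - real n *\<^sub>R q *\<^sub>R x)"
      by (rule l1norm_triangle_diff)
    also have "real (k n) *\<^sub>R x - real n *\<^sub>R q *\<^sub>R x = (real (k n) - real n * q) *\<^sub>R x"
      by (simp add: scaleR_diff_left)
    also have "l1norm \<dots> \<le> 1 * l1norm x" unfolding l1norm_scaleR by (intro mult_right_mono k l1norm_nonneg)
    finally show "l1norm (embed (lattice_floor (k n) x) - real n *\<^sub>R q *\<^sub>R x) \<le> real CARD('d) + l1norm x"
      using l1norm_lattice_floor[of "k n" x] by simp
  qed
  from mean_cost_tendsto[OF lam this]
  have "(\<lambda>n. mean_cost lam (lattice_floor (k n) x) / n) \<longlonglongrightarrow> lyapunov lam (q *\<^sub>R x)" .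
  moreover have "(\<lambda>n. (mean_cost lam (lattice_floor (k n) x) / k n) * (real (k n) / n)) \<longlonglongrightarrow> lyapunov lam x * q"
    by (intro tendsto_mult kq filterlim_compose[OF lyapunov_tendsto[OF lam] kinf])
  \<comment> \<open>When \<open>k n = 0\<close> the quotient is 0 by the convention for division, in
    agreement with the zero cost of staying at the origin.\<close>
  moreover have "(mean_cost lam (lattice_floor (k n) x) / k n) * (real (k n) / n) = mean_cost lam (lattice_floor (k n) x) / n" for n
  proof (cases "k n = 0")
    case True
    have "lattice_floor 0 x = 0" by (simp add: lattice_floor_def vec_eq_iff)
    then show ?thesis using True lam by simp
  qed simp
  ultimately show ?thesis using LIMSEQ_unique by (simp add: mult.commute)
qed

lemma lyapunov_subadditive:
  assumes lam: "0 \<le> lam"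
  shows "lyapunov lam (x + y) \<le> lyapunov lam x + lyapunov lam y"
proof -
  have "approximates (\<lambda>n. lattice_floor n x + lattice_floor n y) (x + y)"
  proof (rule approximatesI)
    fix n
    have "embed (lattice_floor n x + lattice_floor n y) - real n *\<^sub>R (x + y) =
        (embed (lattice_floor n x) - real n *\<^sub>R x) + (embed (lattice_floor n y) - real n *\<^sub>R y)"
      by (simp add: embed_add scaleR_add_right)
    then show "l1norm (embed (lattice_floor n x + lattice_floor n y) - real n *\<^sub>R (x + y)) \<le> real CARD('d) + real CARD('d)"
      by (simp only: order_trans[OF l1norm_triangle add_mono[OF l1norm_lattice_floor l1norm_lattice_floor]])
  qed
  from mean_cost_tendsto[OF lam this] tendsto_add[OF lyapunov_tendsto[OF lam, of x] lyapunov_tendsto[OF lam, of y]]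
  show ?thesis
    by (rule LIMSEQ_le)
      (auto intro!: divide_right_mono mean_cost_subadditive lam simp: add_divide_distrib[symmetric])
qed

lemma l1norm_lattice_floor_tendsto: "(\<lambda>n. l1norm (embed (lattice_floor n x)) / n) \<longlonglongrightarrow> l1norm x"
proof -
  have "(\<lambda>n. l1norm (embed (lattice_floor n x)) / n - l1norm x) \<longlonglongrightarrow> 0"
  proof (rule Lim_null_comparison[OF _ approximates_lattice_floor[unfolded approximates_def, of x]])
    show "\<forall>\<^sub>F n in sequentially. norm (l1norm (embed (lattice_floor n x)) / n - l1norm x) \<le>
        l1norm (embed (lattice_floor n x) - real n *\<^sub>R x) / n"
      using eventually_gt_at_top[of 0]
    proof eventually_elim
      case (elim n)
      have "\<bar>l1norm (embed (lattice_floor n x)) - real n * l1norm x\<bar> \<le> l1norm (embed (lattice_floor n x) - real n *\<^sub>R x)"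
        using l1norm_triangle[of "embed (lattice_floor n x) - real n *\<^sub>R x" "real n *\<^sub>R x"]
          l1norm_triangle[of "real n *\<^sub>R x - embed (lattice_floor n x)" "embed (lattice_floor n x)"]
        by (simp add: l1norm_scaleR l1norm_minus_commute[of "real n *\<^sub>R x"])
      moreover have "l1norm (embed (lattice_floor n x)) / n - l1norm x = (l1norm (embed (lattice_floor n x)) - real n * l1norm x) / n"
        using elim by (simp add: field_simps)
      ultimately show ?case using elim by (simp add: divide_right_mono)
    qed
  qed
  from tendsto_add[OF this tendsto_const[of "l1norm x"]] show ?thesis by simp
qed

lemma lyapunov_upper: assumes lam: "0 \<le> lam" shows "lyapunov lam x \<le> l1norm x * step_bound lam"
proof (rule LIMSEQ_le[OF lyapunov_tendsto[OF lam] tendsto_mult_right[OF l1norm_lattice_floor_tendsto]])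
  show "\<exists>N. \<forall>n\<ge>N. mean_cost lam (lattice_floor n x) / n \<le> l1norm (embed (lattice_floor n x)) / n * step_bound lam"
  proof (intro exI allI impI)
    fix n
    have "mean_cost lam (lattice_floor n x) / n \<le> step_bound lam * site_norm (lattice_floor n x) / n"
      by (intro divide_right_mono mean_cost_le lam) simp
    then show "mean_cost lam (lattice_floor n x) / n \<le> l1norm (embed (lattice_floor n x)) / n * step_bound lam"
      by (simp add: l1norm_embed mult.commute)
  qed
qed

text \<open>Homogeneity brings \<open>n\<close> inside. Multiples of a lattice point are subadditive
  with no rounding, so the exponent at \<open>int n *s x\<close> is at most a single mean cost,
  without an additive constant.\<close>

lemma lyapunov_embed_le:
  assumes lam: "0 \<le> lam" and n: "1 \<le> n"
  shows "lyapunov lam (embed x) \<le> mean_cost lam (int n *s x) / n"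
proof -
  have mult: "mean_cost lam (int m *s y) \<le> m * mean_cost lam y" for m y
  proof (induction m)
    case 0
    have "int 0 *s y = 0" by (simp add: vec_eq_iff)
    with lam show ?case by simp
  next
    case (Suc m)
    have "int (Suc m) *s y = int m *s y + y" by (simp add: vec_eq_iff algebra_simps)
    then show ?case using mean_cost_subadditive[OF lam, of "int m *s y" y] Suc by (simp add: algebra_simps)
  qed
  have "approximates (\<lambda>m. int m *s (int n *s x)) (real n *\<^sub>R embed x)"
    by (rule approximatesI[where C = 0], unfold embed_smult) (simp add: l1norm_def)
  from mean_cost_tendsto[OF lam this] have "lyapunov lam (real n *\<^sub>R embed x) \<le> mean_cost lam (int n *s x)"
  proof (rule LIMSEQ_le_const2)
    show "\<exists>N. \<forall>m\<ge>N. mean_cost lam (int m *s (int n *s x)) / m \<le> mean_cost lam (int n *s x)"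
      using mult[of _ "int n *s x"] by (intro exI[of _ 1]) (auto simp: field_simps)
  qed
  then show ?thesis using lyapunov_scaleR[OF lam, of "real n" "embed x"] n by (simp add: field_simps)
qed

text \<open>The ergodic theorem provides some limit, and comparison of the means identifies it with
  the exponent. The origin is treated apart because mixing was established for nonzero
  shifts.\<close>

lemma cost_converges:
  fixes x :: "'d site"
  assumes lam: "0 \<le> lam"
  shows mean_cost_multiple_tendsto: "(\<lambda>n. mean_cost lam (int n *s x) / n) \<longlonglongrightarrow> lyapunov lam (embed x)"
    and cost_AE_tendsto: "AE w in M. (\<lambda>n. cost lam 0 (int n *s x) w / n) \<longlonglongrightarrow> lyapunov lam (embed x)"
    and cost_L1_tendsto: "(\<lambda>n. \<integral>w. \<bar>cost lam 0 (int n *s x) w / n - lyapunov lam (embed x)\<bar> \<partial>M) \<longlonglongrightarrow> 0"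
proof -
  have "approximates (\<lambda>n. int n *s x) (embed x)"
    by (rule approximatesI[where C = 0]) (simp add: embed_smult l1norm_def)
  from mean_cost_tendsto[OF lam this]
  show mean: "(\<lambda>n. mean_cost lam (int n *s x) / n) \<longlonglongrightarrow> lyapunov lam (embed x)" .
  have "(AE w in M. (\<lambda>n. cost lam 0 (int n *s x) w / n) \<longlonglongrightarrow> lyapunov lam (embed x)) \<and>
     (\<lambda>n. \<integral>w. \<bar>cost lam 0 (int n *s x) w / n - lyapunov lam (embed x)\<bar> \<partial>M) \<longlonglongrightarrow> 0"
  proof (cases "x = 0")
    case True
    then have z: "int n *s x = 0" for n by (simp add: vec_eq_iff)
    have "lyapunov lam (embed x) = 0" using mean lam by (simp add: z LIMSEQ_const_iff)
    moreover have "(\<integral>w. \<bar>cost lam 0 0 w / real n - 0\<bar> \<partial>M) = (\<integral>w. 0 \<partial>M)" for n :: nat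
      by (rule Bochner_Integration.integral_cong) (auto simp: cost_self lam)
    then have "(\<lambda>n. \<integral>w. \<bar>cost lam 0 0 w / real n - 0\<bar> \<partial>M) \<longlonglongrightarrow> 0" by (simp only: Bochner_Integration.integral_zero tendsto_const)
    moreover have "AE w in M. (\<lambda>n. cost lam 0 0 w / real n) \<longlonglongrightarrow> 0"
      by (rule AE_I2) (simp add: cost_self lam)
    ultimately show ?thesis unfolding z by simp
  next
    case False
    interpret mixing_map M "T x" by (rule mixing_map_T[OF False])
    let ?g = "\<lambda>n. cost lam 0 (int n *s x)"
    have 0: "?g 0 w = 0" if "w \<in> space M" for w
    proof -
      have "int 0 *s x = 0" by (simp add: vec_eq_iff)
      then show ?thesis using cost_self[OF that lam] by simp
    qed
    have sub: "?g (m + n) w \<le> ?g m w + ?g n ((T x ^^ m) w)" if "w \<in> space M" for m n w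
    proof -
      have "int (m + n) *s x = int m *s x + int n *s x" by (simp add: vec_eq_iff algebra_simps)
      then show ?thesis unfolding T_iter using cost_add_le[OF that lam, of "int m *s x" "int n *s x"] by simp
    qed
    let ?L = "INF n\<in>{1..}. M.expectation (?g n) / real n"
    have "AE w in M. (\<lambda>n. ?g n w / n) \<longlonglongrightarrow> ?L"
      by (rule subadditive_ergodic(1)) (use 0 sub cost_nonneg cost_integrable lam in auto)
    moreover have "(\<lambda>n. M.expectation (?g n) / n) \<longlonglongrightarrow> ?L"
      by (rule subadditive_ergodic(2)) (use 0 sub cost_nonneg cost_integrable lam in auto)
    moreover have "(\<lambda>n. \<integral>w. \<bar>?g n w / n - ?L\<bar> \<partial>M) \<longlonglongrightarrow> 0"
      by (rule subadditive_ergodic(3)) (use 0 sub cost_nonneg cost_integrable lam in auto)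
    ultimately have erg: "AE w in M. (\<lambda>n. ?g n w / n) \<longlonglongrightarrow> ?L"
      "(\<lambda>n. M.expectation (?g n) / n) \<longlonglongrightarrow> ?L"
      "(\<lambda>n. \<integral>w. \<bar>?g n w / n - ?L\<bar> \<partial>M) \<longlonglongrightarrow> 0" by blast+
    have "lyapunov lam (embed x) = ?L"
      by (rule LIMSEQ_unique[OF mean[unfolded mean_cost_def] erg(2)])
    with erg(1,3) show ?thesis by simp
  qed
  then show "AE w in M. (\<lambda>n. cost lam 0 (int n *s x) w / n) \<longlonglongrightarrow> lyapunov lam (embed x)"
    "(\<lambda>n. \<integral>w. \<bar>cost lam 0 (int n *s x) w / n - lyapunov lam (embed x)\<bar> \<partial>M) \<longlonglongrightarrow> 0" by auto
qed

end

section \<open>Lower bound: collecting factors from distinct sites\<close>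

lemma (in environment) laplace_antimono: "lam \<le> lam' \<Longrightarrow> laplace lam' \<sigma> x \<le> laplace lam \<sigma> x"
proof -
  assume le: "lam \<le> lam'"
  interpret e': environment \<omega> \<sigma> lam' by unfold_locales (use omega sigma lam le in auto)
  show ?thesis unfolding laplace_def
    by (rule integral_mono[OF e'.exp_integrable exp_integrable]) (auto simp: space_sigma le)
qed

context random_environment
begin

definition mean_laplace :: "real \<Rightarrow> real" where
  "mean_laplace lam = (\<integral>\<sigma>. laplace lam \<sigma> 0 \<partial>S)"

lemma
  assumes "\<sigma> \<in> space S" "0 \<le> lam"
  shows laplace_pos': "0 < laplace lam \<sigma> x" and laplace_le_1': "laplace lam \<sigma> x \<le> 1"
  using environmentI_S[OF assms] environment.laplace_pos environment.laplace_le_1 by blast+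

lemma laplace_integrable: "0 \<le> lam \<Longrightarrow> integrable S (\<lambda>\<sigma>. laplace lam \<sigma> x)"
  by (rule S.integrable_const_bound[of _ 1])
    (auto intro!: AE_I2 laplace_le_1' simp: abs_of_pos laplace_pos')

lemma mean_laplace_pos: "0 \<le> lam \<Longrightarrow> 0 < mean_laplace lam"
  using S.integral_less_AE_space[of "\<lambda>_. 0" "\<lambda>\<sigma>. laplace lam \<sigma> 0"] S.emeasure_space_1
  by (simp add: mean_laplace_def laplace_integrable laplace_pos')

lemma mean_laplace_le_1: "0 \<le> lam \<Longrightarrow> mean_laplace lam \<le> 1"
  using integral_mono[OF laplace_integrable, of lam "\<lambda>_. 1" 0] by (simp add: mean_laplace_def laplace_le_1' S.prob_space)

text \<open>Laws at distinct sites are independent; writing the factor as a function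
  \<open>F\<close> of the law at one site gives the form that \<open>nn_integral_PiM_prod\<close>
  asks for.\<close>

lemma nn_integral_prod_laplace:
  assumes lam: "0 \<le> lam" and A: "finite A"
  shows "(\<integral>\<^sup>+\<sigma>. ennreal (\<Prod>s\<in>A. laplace lam \<sigma> s) \<partial>S) = ennreal (mean_laplace lam ^ card A)"
proof -
  define F where "F N = ennreal (\<integral>s. exp (- lam * s) \<partial>N)" for N :: "real measure"
  have "(\<lambda>N. \<integral>s. exp (- lam * s) \<partial>N) \<in> borel_measurable P2"
    unfolding P2_def prob_algebra_def
    by (intro measurable_restrict_space1 integral_measurable_subprob_algebra) measurable
  then have F: "F \<in> borel_measurable \<mu>"
    unfolding F_def by (simp add: measurable_cong_sets[OF sets_mu refl])
  have prod: "(\<integral>\<^sup>+\<sigma>. ennreal (\<Prod>s\<in>B. laplace lam \<sigma> s) \<partial>S) = (\<integral>\<^sup>+N. F N \<partial>\<mu>) ^ card B"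
    if B: "finite B" for B :: "'d site set"
  proof -
    have "(\<integral>\<^sup>+\<sigma>. ennreal (\<Prod>s\<in>B. laplace lam \<sigma> s) \<partial>S) = (\<integral>\<^sup>+\<sigma>. (\<Prod>s\<in>B. F (\<sigma> s)) \<partial>S)"
    proof (rule nn_integral_cong)
      fix \<sigma> assume "\<sigma> \<in> space S"
      then have "ennreal (\<Prod>s\<in>B. laplace lam \<sigma> s) = (\<Prod>s\<in>B. ennreal (laplace lam \<sigma> s))"
        by (intro prod_ennreal[symmetric] less_imp_le laplace_pos' lam)
      then show "ennreal (\<Prod>s\<in>B. laplace lam \<sigma> s) = (\<Prod>s\<in>B. F (\<sigma> s))" by (simp add: F_def laplace_def)
    qed
    also have "\<dots> = (\<Prod>s\<in>B. \<integral>\<^sup>+N. F N \<partial>\<mu>)"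
      unfolding hold_law_def by (rule nn_integral_PiM_prod) (auto simp: prob_mu B F)
    finally show ?thesis by simp
  qed
  have "ennreal (mean_laplace lam) = (\<integral>\<^sup>+\<sigma>. ennreal (laplace lam \<sigma> 0) \<partial>S)"
    unfolding mean_laplace_def using laplace_integrable[OF lam, of 0]
    by (intro nn_integral_eq_integral[symmetric]) (auto intro!: AE_I2 less_imp_le laplace_pos' lam)
  also have "\<dots> = (\<integral>\<^sup>+N. F N \<partial>\<mu>)" using prod[of "{0}"] by simp
  finally show ?thesis unfolding prod[OF A]
    by (simp add: ennreal_power less_imp_le[OF mean_laplace_pos[OF lam]] flip: ennreal_power)
qed

text \<open>Each visited site contributes at least one factor \<open>laplace lam \<sigma> s\<close>; the induction keeps the set \<open>A\<close>
  of sites whose factor has been collected, which meets every \<open>l\<^sup>1\<close>-sphere inside the one of \<open>x\<close>.\<close>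

lemma nn_integral_hit_upto_le:
  assumes w: "\<omega> \<in> space E" and lam: "0 \<le> lam" and A: "finite A" "{0..<site_norm x} \<subseteq> site_norm ` A"
  shows "(\<integral>\<^sup>+\<sigma>. ennreal ((\<Prod>s\<in>A. laplace lam \<sigma> s) * hit_upto lam \<omega> \<sigma> z N x) \<partial>S) \<le> ennreal (mean_laplace lam ^ site_norm z)"
  using A
proof (induction N arbitrary: A x)
  case 0
  show ?case
  proof (cases "x = z")
    case True
    \<comment> \<open>\<open>A\<close> meets every sphere of radius below
      \<open>site_norm z\<close>, so it has at least that many points; the base of the power is at
      most 1.\<close>
    have "site_norm z \<le> card A"
      using card_mono[OF finite_imageI[OF 0(1)] 0(2)] card_image_le[OF 0(1), of site_norm] True by simp
    then have "mean_laplace lam ^ card A \<le> mean_laplace lam ^ site_norm z"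
      by (intro power_decreasing mean_laplace_le_1 lam less_imp_le[OF mean_laplace_pos])
    then show ?thesis using True nn_integral_prod_laplace[OF lam 0(1)] by (simp add: ennreal_leI)
  qed simp
next
  case (Suc N)
  have env: "environment \<omega> \<sigma> lam" if "\<sigma> \<in> space S" for \<sigma>
    using that w by (intro environmentI lam) (simp add: space_pair_measure)
  show ?case
  proof (cases "x = z")
    case True
    have "site_norm z \<le> card A"
      using card_mono[OF finite_imageI[OF Suc.prems(1)] Suc.prems(2)] card_image_le[OF Suc.prems(1), of site_norm] True by simp
    then have "mean_laplace lam ^ card A \<le> mean_laplace lam ^ site_norm z"
      by (intro power_decreasing mean_laplace_le_1 lam less_imp_le[OF mean_laplace_pos])
    then show ?thesis using True nn_integral_prod_laplace[OF lam Suc.prems(1)] by (simp add: ennreal_leI)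
  next
    case False
    \<comment> \<open>The present site joins the collection before the walk moves on.\<close>
    let ?B = "insert x A"
    let ?f = "\<lambda>e \<sigma>. (\<Prod>s\<in>?B. laplace lam \<sigma> s) * hit_upto lam \<omega> \<sigma> z N (x + e)"
    obtain \<sigma>0 where "\<sigma>0 \<in> space S" using S.not_empty by blast
    interpret e0: environment \<omega> \<sigma>0 lam by (rule env) fact
    have f0: "0 \<le> ?f e \<sigma>" if "\<sigma> \<in> space S" for e \<sigma>
      using that by (intro mult_nonneg_nonneg prod_nonneg environment.hit_upto_nonneg[OF env] less_imp_le laplace_pos' lam)
    have hm: "(\<lambda>\<sigma>. hit_upto lam \<omega> \<sigma> z N y) \<in> borel_measurable S" for y
      using measurable_compose[OF measurable_Pair1'[OF w, of S] hit_upto_meas[of lam z N y]] by simp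
    have fm: "?f e \<in> borel_measurable S" for e
      by (intro borel_measurable_times borel_measurable_prod laplace_meas hm)
    have IH: "(\<integral>\<^sup>+\<sigma>. ennreal (?f e \<sigma>) \<partial>S) \<le> ennreal (mean_laplace lam ^ site_norm z)" if e: "e \<in> unit_steps" for e
    proof (rule Suc.IH)
      have "site_norm (x + e) \<le> Suc (site_norm x)" using site_norm_add[of x e] e by (simp add: unit_steps_iff)
      \<comment> \<open>A step raises the norm by at most one, and the sphere through
        \<open>x\<close> is now represented by \<open>x\<close> itself.\<close>
      then have "{0..<site_norm (x + e)} \<subseteq> insert (site_norm x) {0..<site_norm x}" by auto
      then show "{0..<site_norm (x + e)} \<subseteq> site_norm ` ?B" using Suc.prems(2) by auto
    qed (use Suc.prems in simp)
    have "(\<integral>\<^sup>+\<sigma>. ennreal ((\<Prod>s\<in>A. laplace lam \<sigma> s) * hit_upto lam \<omega> \<sigma> z (Suc N) x) \<partial>S)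
      \<le> (\<integral>\<^sup>+\<sigma>. (\<Sum>e\<in>unit_steps. ennreal (measure (\<omega> x) {e}) * ennreal (?f e \<sigma>)) \<partial>S)"
    proof (rule nn_integral_mono)
      fix \<sigma> assume s: "\<sigma> \<in> space S"
      let ?h = "\<Sum>e\<in>unit_steps. measure (\<omega> x) {e} * hit_upto lam \<omega> \<sigma> z N (x + e)"
      have h0: "0 \<le> ?h" by (intro sum_nonneg mult_nonneg_nonneg environment.hit_upto_nonneg[OF env[OF s]]) auto
      \<comment> \<open>A new site hands its factor to the product; at a site already collected the
        extra factor is at most 1 and is dropped.\<close>
      have "(\<Prod>s\<in>A. laplace lam \<sigma> s) * laplace lam \<sigma> x \<le> (\<Prod>s\<in>?B. laplace lam \<sigma> s)"
      proof (cases "x \<in> A")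
        case True
        then show ?thesis using laplace_le_1'[OF s lam, of x] laplace_pos'[OF s lam]
          by (simp add: insert_absorb mult_left_le prod_nonneg less_imp_le)
      qed (use Suc.prems(1) in \<open>simp add: mult.commute\<close>)
      then have "(\<Prod>s\<in>A. laplace lam \<sigma> s) * laplace lam \<sigma> x * ?h \<le> (\<Prod>s\<in>?B. laplace lam \<sigma> s) * ?h"
        using h0 by (rule mult_right_mono)
      also have "\<dots> = (\<Sum>e\<in>unit_steps. measure (\<omega> x) {e} * ?f e \<sigma>)"
        unfolding sum_distrib_left by (rule sum.cong) (simp_all only: mult_ac)
      finally have "(\<Prod>s\<in>A. laplace lam \<sigma> s) * hit_upto lam \<omega> \<sigma> z (Suc N) x \<le> (\<Sum>e\<in>unit_steps. measure (\<omega> x) {e} * ?f e \<sigma>)"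
        using False by (simp add: mult.assoc)
      then have "ennreal ((\<Prod>s\<in>A. laplace lam \<sigma> s) * hit_upto lam \<omega> \<sigma> z (Suc N) x) \<le> ennreal (\<Sum>e\<in>unit_steps. measure (\<omega> x) {e} * ?f e \<sigma>)"
        by (rule ennreal_leI)
      also have "\<dots> = (\<Sum>e\<in>unit_steps. ennreal (measure (\<omega> x) {e} * ?f e \<sigma>))"
        by (rule sum_ennreal[symmetric]) (rule mult_nonneg_nonneg[OF measure_nonneg f0[OF s]])
      also have "\<dots> = (\<Sum>e\<in>unit_steps. ennreal (measure (\<omega> x) {e}) * ennreal (?f e \<sigma>))"
        by (rule sum.cong[OF refl], rule ennreal_mult[OF measure_nonneg f0[OF s]])
      finally show "ennreal ((\<Prod>s\<in>A. laplace lam \<sigma> s) * hit_upto lam \<omega> \<sigma> z (Suc N) x)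
        \<le> (\<Sum>e\<in>unit_steps. ennreal (measure (\<omega> x) {e}) * ennreal (?f e \<sigma>))" .
    qed
    also have "\<dots> = (\<Sum>e\<in>unit_steps. \<integral>\<^sup>+\<sigma>. ennreal (measure (\<omega> x) {e}) * ennreal (?f e \<sigma>) \<partial>S)"
      by (rule nn_integral_sum) (intro borel_measurable_times_ennreal borel_measurable_const measurable_compose[OF fm measurable_ennreal])
    also have "\<dots> = (\<Sum>e\<in>unit_steps. ennreal (measure (\<omega> x) {e}) * (\<integral>\<^sup>+\<sigma>. ennreal (?f e \<sigma>) \<partial>S))"
      by (rule sum.cong[OF refl], rule nn_integral_cmult, rule measurable_compose[OF fm measurable_ennreal])
    also have "\<dots> \<le> (\<Sum>e\<in>unit_steps. ennreal (measure (\<omega> x) {e}) * ennreal (mean_laplace lam ^ site_norm z))"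
      by (intro sum_mono mult_left_mono IH) auto
    also have "\<dots> = ennreal (\<Sum>e\<in>unit_steps. measure (\<omega> x) {e}) * ennreal (mean_laplace lam ^ site_norm z)"
      unfolding sum_distrib_right[symmetric] by (subst sum_ennreal) auto
    also have "\<dots> = ennreal (mean_laplace lam ^ site_norm z)" by (simp add: e0.sum_omega)
    finally show ?thesis .
  qed
qed

text \<open>The preceding bound, started at 0 with nothing collected, is uniform in \<omega>, so
  averaging over \<omega> preserves it; the truncation at \<open>N\<close> is removed by dominated
  convergence.\<close>

lemma integral_e_fun_le:
  assumes lam: "0 \<le> lam"
  shows "(\<integral>w. e_fun lam 0 z (fst w) (snd w) \<partial>M) \<le> mean_laplace lam ^ site_norm z"
proof -
  have env: "environment (fst w) (snd w) lam" if "w \<in> space M" for w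
    using that by (intro environmentI lam) simp
  have bound: "\<bar>hit_upto lam (fst w) (snd w) z N 0\<bar> \<le> 1" if "w \<in> space M" for w N
    using environment.hit_upto_nonneg[OF env[OF that], of z N 0] environment.hit_upto_le_1[OF env[OF that], of z N 0] by simp
  have int: "integrable M (\<lambda>w. hit_upto lam (fst w) (snd w) z N 0)" for N
    by (rule M.integrable_const_bound[of _ 1]) (auto intro!: AE_I2 bound hit_upto_meas)
  have le: "(\<integral>w. hit_upto lam (fst w) (snd w) z N 0 \<partial>M) \<le> mean_laplace lam ^ site_norm z" for N
  proof -
    have "ennreal (\<integral>w. hit_upto lam (fst w) (snd w) z N 0 \<partial>M) = (\<integral>\<^sup>+w. ennreal (hit_upto lam (fst w) (snd w) z N 0) \<partial>M)"
      using int by (intro nn_integral_eq_integral[symmetric]) (auto intro!: AE_I2 environment.hit_upto_nonneg[OF env])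
    also have "\<dots> = (\<integral>\<^sup>+\<omega>. \<integral>\<^sup>+\<sigma>. ennreal (hit_upto lam (fst (\<omega>, \<sigma>)) (snd (\<omega>, \<sigma>)) z N 0) \<partial>S \<partial>E)"
      by (rule S.nn_integral_fst[symmetric]) (rule measurable_compose[OF hit_upto_meas measurable_ennreal])
    also have "\<dots> \<le> (\<integral>\<^sup>+\<omega>. ennreal (mean_laplace lam ^ site_norm z) \<partial>E)"
      using nn_integral_hit_upto_le[OF _ lam, of _ "{}" 0 z N] by (intro nn_integral_mono) simp
    also have "\<dots> = ennreal (mean_laplace lam ^ site_norm z)" by (simp add: E.emeasure_space_1)
    finally show ?thesis
      using mean_laplace_pos[OF lam] by (subst (asm) ennreal_le_iff) (auto simp: less_imp_le)
  qed
  have "(\<lambda>N. \<integral>w. hit_upto lam (fst w) (snd w) z N 0 \<partial>M) \<longlonglongrightarrow> (\<integral>w. e_fun lam 0 z (fst w) (snd w) \<partial>M)"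
    by (rule integral_dominated_convergence[where w = "\<lambda>_. 1"])
      (auto intro!: AE_I2 environment.hit_upto_tendsto[OF env] bound hit_upto_meas e_fun_meas lam)
  then show ?thesis by (rule LIMSEQ_le_const2) (use le in blast)
qed

text \<open>Jensen's inequality in tangent form: - ln e \<ge> - ln q + 1 - e / q, where
  \<open>q\<close> is the upper bound just obtained for the mean of e.\<close>

lemma mean_cost_ge:
  assumes lam: "0 \<le> lam"
  shows "- ln (mean_laplace lam) * site_norm z \<le> mean_cost lam z"
proof -
  define q where "q = mean_laplace lam ^ site_norm z"
  have q: "0 < q" using mean_laplace_pos[OF lam] by (simp add: q_def)
  let ?e = "\<lambda>w. e_fun lam 0 z (fst w) (snd w)"
  have env: "environment (fst w) (snd w) lam" if "w \<in> space M" for w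
    using that by (intro environmentI lam) simp
  have eint: "integrable M ?e"
    by (rule M.integrable_const_bound[of _ 1])
      (auto intro!: AE_I2 e_fun_meas lam environment.e_fun_le_1[OF env] simp: abs_of_nonneg environment.e_fun_nonneg[OF env])
  have "- ln q \<le> - ln q + 1 - (\<integral>w. ?e w \<partial>M) / q"
    using integral_e_fun_le[OF lam, of z] q by (simp add: q_def)
  also have "\<dots> = (\<integral>w. - ln q + 1 - ?e w / q \<partial>M)"
    using eint by (simp add: M.prob_space)
  also have "\<dots> \<le> mean_cost lam z" unfolding mean_cost_def
  proof (rule integral_mono_AE)
    show "AE w in M. - ln q + 1 - ?e w / q \<le> cost lam 0 z w"
      using AE_elliptic AE_space
    proof eventually_elim
      case (elim w)
      have e: "0 < ?e w" using e_pos[of "fst w" "snd w" lam 0 z] elim lam by simp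
      have "ln (?e w / q) \<le> ?e w / q - 1" using e q by (intro ln_le_minus_one) simp
      then show ?case using e q elim by (simp add: cost_def split_beta ln_div)
    qed
  qed (use eint cost_integrable[OF lam] in auto)
  finally show ?thesis using mean_laplace_pos[OF lam] by (simp add: q_def ln_realpow mult.commute)
qed

lemma lyapunov_lower: assumes lam: "0 \<le> lam" shows "l1norm x * - ln (mean_laplace lam) \<le> lyapunov lam x"
proof (rule LIMSEQ_le[OF tendsto_mult_right[OF l1norm_lattice_floor_tendsto] lyapunov_tendsto[OF lam]])
  show "\<exists>N. \<forall>n\<ge>N. l1norm (embed (lattice_floor n x)) / n * - ln (mean_laplace lam) \<le> mean_cost lam (lattice_floor n x) / n"
  proof (intro exI allI impI)
    fix n
    have "- ln (mean_laplace lam) * site_norm (lattice_floor n x) / n \<le> mean_cost lam (lattice_floor n x) / n"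
      by (intro divide_right_mono mean_cost_ge lam) simp
    then show "l1norm (embed (lattice_floor n x)) / n * - ln (mean_laplace lam) \<le> mean_cost lam (lattice_floor n x) / n"
      by (simp add: l1norm_embed mult.commute)
  qed
qed

section \<open>Monotonicity, concavity, convexity and continuity of the exponent\<close>

lemma cost_mono:
  assumes "w \<in> space M" "0 \<le> l" "l \<le> m"
  shows "cost l x y w \<le> cost m x y w"
proof -
  obtain \<omega> \<sigma> where w: "w = (\<omega>, \<sigma>)" by (cases w)
  have env: "environment \<omega> \<sigma> l" "environment \<omega> \<sigma> m" using assms by (auto intro!: environmentI simp: w)
  show ?thesis
  proof (cases "elliptic \<omega>")
    case True
    have "0 < e_fun m x y \<omega> \<sigma>" using assms True by (intro e_pos) (auto simp: w)
    with e_fun_antimono[OF env assms(3), of x y] have "ln (e_fun m x y \<omega> \<sigma>) \<le> ln (e_fun l x y \<omega> \<sigma>)"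
      by (subst ln_le_cancel_iff) auto
    then show ?thesis by (simp add: cost_def w)
  qed (simp add: cost_def w)
qed

lemma mean_cost_mono: "0 \<le> l \<Longrightarrow> l \<le> m \<Longrightarrow> mean_cost l z \<le> mean_cost m z"
  unfolding mean_cost_def by (intro integral_mono cost_integrable cost_mono) auto

lemma step_bound_mono: "0 \<le> l \<Longrightarrow> l \<le> m \<Longrightarrow> step_bound l \<le> step_bound m"
proof -
  assume l: "0 \<le> l" "l \<le> m"
  have "(\<integral>\<sigma>. theta l \<sigma> (0 :: 'd site) \<partial>S) \<le> (\<integral>\<sigma>. theta m \<sigma> (0 :: 'd site) \<partial>S)"
  proof (intro integral_mono theta_integrable)
    fix \<sigma> assume s: "\<sigma> \<in> space S"
    obtain \<omega> where "environment \<omega> \<sigma> l" using environmentI_S[OF s l(1)] by blast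
    then have "laplace m \<sigma> 0 \<le> laplace l \<sigma> 0" using l by (intro environment.laplace_antimono)
    then show "theta l \<sigma> 0 \<le> theta m \<sigma> 0"
      using laplace_pos'[OF s, of m 0] l by (simp add: theta_def laplace_def)
  qed (use l in auto)
  then show ?thesis by (simp add: step_bound_def)
qed

lemma mean_cost_concave:
  assumes l: "0 \<le> l" and m: "0 \<le> m" and u: "0 \<le> u" "0 \<le> v" "u + v = 1"
  shows "u * mean_cost l z + v * mean_cost m z \<le> mean_cost (u * l + v * m) z"
proof -
  have k: "0 \<le> u * l + v * m" using assms by simp
  have "u * mean_cost l z + v * mean_cost m z = (\<integral>w. u * cost l 0 z w + v * cost m 0 z w \<partial>M)"
    unfolding mean_cost_def using cost_integrable l m by simp
  also have "\<dots> \<le> mean_cost (u * l + v * m) z" unfolding mean_cost_def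
  proof (rule integral_mono)
    fix w assume w: "w \<in> space M"
    obtain \<omega> \<sigma> where ws: "w = (\<omega>, \<sigma>)" by (cases w)
    show "u * cost l 0 z w + v * cost m 0 z w \<le> cost (u * l + v * m) 0 z w"
    proof (cases "elliptic \<omega>")
      case True
      have "ln (e_fun (u * l + v * m) 0 z \<omega> \<sigma>) \<le> u * ln (e_fun l 0 z \<omega> \<sigma>) + v * ln (e_fun m 0 z \<omega> \<sigma>)"
        using w True l m k by (intro ln_e_fun_convex u e_pos environmentI) (auto simp: ws)
      then show ?thesis by (simp add: cost_def ws)
    qed (simp add: cost_def ws)
  qed (use cost_integrable l m k in auto)
  finally show ?thesis .
qed

text \<open>The cost increases with the parameter and all parameters here are at most 1, so
  \<open>cost 1 0 z\<close> dominates.\<close>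

lemma mean_cost_tendsto_0: "(\<lambda>k. mean_cost (1 / real (Suc k)) z) \<longlonglongrightarrow> mean_cost 0 z"
  unfolding mean_cost_def
proof (rule integral_dominated_convergence[where w = "cost 1 0 z"])
  show "AE w in M. (\<lambda>k. cost (1 / real (Suc k)) 0 z w) \<longlonglongrightarrow> cost 0 0 z w"
  proof (rule AE_I2)
    fix w assume w: "w \<in> space M"
    obtain \<omega> \<sigma> where ws: "w = (\<omega>, \<sigma>)" by (cases w)
    show "(\<lambda>k. cost (1 / real (Suc k)) 0 z w) \<longlonglongrightarrow> cost 0 0 z w"
    proof (cases "elliptic \<omega>")
      case True
      have "0 < e_fun 0 0 z \<omega> \<sigma>" using w True by (intro e_pos) (auto simp: ws)
      moreover have "environment \<omega> \<sigma> 0" using w by (intro environmentI) (auto simp: ws)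
      ultimately have "(\<lambda>k. - ln (e_fun (1 / real (Suc k)) 0 z \<omega> \<sigma>)) \<longlonglongrightarrow> - ln (e_fun 0 0 z \<omega> \<sigma>)"
        by (intro tendsto_minus tendsto_ln e_fun_tendsto_0) auto
      then show ?thesis using True by (simp add: cost_def ws)
    qed (simp add: cost_def ws)
  qed
  show "AE w in M. norm (cost (1 / real (Suc k)) 0 z w) \<le> cost 1 0 z w" for k
  proof (rule AE_I2)
    fix w assume w: "w \<in> space M"
    have "cost (1 / real (Suc k)) 0 z w \<le> cost 1 0 z w" by (rule cost_mono[OF w]) auto
    moreover have "0 \<le> cost (1 / real (Suc k)) 0 z w" by (rule cost_nonneg[OF w]) simp
    ultimately show "norm (cost (1 / real (Suc k)) 0 z w) \<le> cost 1 0 z w" by simp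
  qed
qed (use cost_meas[of 0] cost_meas[of "1 / real (Suc _)"] cost_integrable[of 1] in auto)

lemma lyapunov_mono: "0 \<le> l \<Longrightarrow> l \<le> m \<Longrightarrow> lyapunov l x \<le> lyapunov m x"
  by (rule LIMSEQ_le[OF lyapunov_tendsto lyapunov_tendsto]) (auto intro!: divide_right_mono mean_cost_mono)

lemma lyapunov_concave: "concave_on {0..} (\<lambda>lam. lyapunov lam x)"
  unfolding concave_on_iff
proof (intro conjI ballI allI impI)
  fix l m u v :: real
  assume *: "l \<in> {0..}" "m \<in> {0..}" "0 \<le> u" "0 \<le> v" "u + v = 1"
  have "(\<lambda>n. u * (mean_cost l (lattice_floor n x) / n) + v * (mean_cost m (lattice_floor n x) / n)) \<longlonglongrightarrow> u * lyapunov l x + v * lyapunov m x"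
    using * by (intro tendsto_intros lyapunov_tendsto) auto
  moreover have "(\<lambda>n. mean_cost (u * l + v * m) (lattice_floor n x) / n) \<longlonglongrightarrow> lyapunov (u * l + v * m) x"
    using * by (intro lyapunov_tendsto) auto
  ultimately have "u * lyapunov l x + v * lyapunov m x \<le> lyapunov (u * l + v * m) x"
  proof (rule LIMSEQ_le)
    show "\<exists>N. \<forall>n\<ge>N. u * (mean_cost l (lattice_floor n x) / n) + v * (mean_cost m (lattice_floor n x) / n) \<le> mean_cost (u * l + v * m) (lattice_floor n x) / n"
      using mean_cost_concave[of l m u v] * by (auto intro!: divide_right_mono simp: add_divide_distrib[symmetric])
  qed
  then show "u * lyapunov l x + v * lyapunov m x \<le> lyapunov (u *\<^sub>R l + v *\<^sub>R m) x" by simp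
qed simp

lemma lyapunov_convex: assumes lam: "0 \<le> lam" shows "convex_on UNIV (lyapunov lam)"
proof -
  have "approximates (\<lambda>_. 0) (0 :: real ^ 'd)"
    by (rule approximatesI[where C = 0]) (simp add: l1norm_def embed_def)
  from mean_cost_tendsto[OF lam this] have z: "lyapunov lam 0 = 0" using lam by (simp add: LIMSEQ_const_iff)
  have sc: "lyapunov lam (q *\<^sub>R x) = q * lyapunov lam x" if "0 \<le> q" for q x
    using that lyapunov_scaleR[OF lam, of q x] z by (cases "q = 0") auto
  show ?thesis
  proof (rule convex_onI)
    fix t :: real and x y assume t: "0 < t" "t < 1"
    show "lyapunov lam ((1 - t) *\<^sub>R x + t *\<^sub>R y) \<le> (1 - t) * lyapunov lam x + t * lyapunov lam y"
      using lyapunov_subadditive[OF lam, of "(1 - t) *\<^sub>R x" "t *\<^sub>R y"] t by (simp add: sc)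
  qed simp
qed

lemma lyapunov_Lipschitz:
  assumes lam: "0 \<le> lam" shows "\<bar>lyapunov lam x - lyapunov lam y\<bar> \<le> l1norm (x - y) * step_bound lam"
proof -
  have "lyapunov lam x \<le> lyapunov lam y + l1norm (x - y) * step_bound lam" for x y
    using lyapunov_subadditive[OF lam, of y "x - y"] lyapunov_upper[OF lam, of "x - y"] by simp
  from this[of x y] this[of y x] show ?thesis by (simp add: l1norm_minus_commute[of y])
qed

text \<open>Concavity gives continuity only on the open half-line.  At \<open>0\<close> use that \<open>lyapunov lam x\<close> is an
  infimum over \<open>n\<close> of quantities that are right-continuous in \<open>lam\<close>.\<close>

lemma lyapunov_continuous_parameter: "continuous_on {0..} (\<lambda>lam. lyapunov lam x)"
  unfolding continuous_on_eq_continuous_within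
proof
  fix l :: real assume l: "l \<in> {0..}"
  show "continuous (at l within {0..}) (\<lambda>lam. lyapunov lam x)"
  proof (cases "l = 0")
    case False
    have "concave_on {0<..} (\<lambda>lam. lyapunov lam x)"
      using lyapunov_concave[of x] unfolding concave_on_def by (rule convex_on_subset) auto
    then have "continuous_on {0<..} (\<lambda>lam. - lyapunov lam x)"
      unfolding concave_on_def by (rule convex_on_continuous[OF open_greaterThan])
    then have "continuous_on {0<..} (\<lambda>lam. - (- lyapunov lam x))" by (rule continuous_on_minus)
    then have "isCont (\<lambda>lam. lyapunov lam x) l"
      using False l by (simp add: continuous_on_eq_continuous_at)
    then show ?thesis by (rule continuous_at_imp_continuous_within)
  next
    case True
    have "((\<lambda>lam. lyapunov lam x) \<longlongrightarrow> lyapunov 0 x) (at 0 within {0..})"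
    proof (rule tendstoI)
      fix e :: real assume e: "0 < e"
      \<comment> \<open>Taken at parameter 1, so that one additive constant serves all parameters
        \<open>1 / real (Suc k)\<close>.\<close>
      let ?K = "step_bound 1 * CARD('d)"
      have "(\<lambda>n. mean_cost 0 (lattice_floor n x) / n + ?K / n) \<longlonglongrightarrow> lyapunov 0 x + 0"
        by (intro tendsto_add lyapunov_tendsto lim_const_over_n) simp
      then have "\<forall>\<^sub>F n in sequentially. mean_cost 0 (lattice_floor n x) / n + ?K / n < lyapunov 0 x + e"
        using e by (intro order_tendstoD(2)) auto
      \<comment> \<open>First \<open>n\<close> is fixed so that the bound at parameter 0 is within
        \<open>e\<close> of the exponent; only then is the parameter made small for this
        \<open>n\<close>.\<close>
      then obtain n where n: "1 \<le> n" "mean_cost 0 (lattice_floor n x) / n + ?K / n < lyapunov 0 x + e"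
        using eventually_conj[OF _ eventually_ge_at_top[of 1]] eventually_happens'[OF sequentially_bot] by (smt (verit) eventually_conj)
      have "(\<lambda>k. mean_cost (1 / real (Suc k)) (lattice_floor n x) / n + ?K / n) \<longlonglongrightarrow> mean_cost 0 (lattice_floor n x) / n + ?K / n"
        using n(1) by (intro tendsto_intros mean_cost_tendsto_0) auto
      from order_tendstoD(2)[OF this n(2)] obtain k
        where k: "mean_cost (1 / real (Suc k)) (lattice_floor n x) / n + ?K / n < lyapunov 0 x + e"
        by (auto simp: eventually_sequentially)
      have up: "lyapunov (1 / real (Suc k)) x < lyapunov 0 x + e"
      proof -
        have "lyapunov (1 / real (Suc k)) x \<le> (mean_cost (1 / real (Suc k)) (lattice_floor n x) + step_bound (1 / real (Suc k)) * CARD('d)) / n"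
          by (rule lyapunov_le) (use n in auto)
        also have "\<dots> \<le> (mean_cost (1 / real (Suc k)) (lattice_floor n x) + ?K) / n"
          by (intro divide_right_mono add_left_mono mult_right_mono step_bound_mono) auto
        finally show ?thesis using k by (simp add: add_divide_distrib)
      qed
      \<comment> \<open>By monotonicity the estimate at the one parameter
        \<open>1 / real (Suc k)\<close> holds on the whole right neighbourhood below it.\<close>
      have "\<forall>\<^sub>F lam in at 0 within {0..}. lam < 1 / real (Suc k)"
        by (rule order_tendstoD(2)[OF tendsto_ident_at]) simp
      moreover have "\<forall>\<^sub>F lam in at 0 within {0..}. lam \<in> {0 :: real..}"
        by (simp add: eventually_at_filter)
      ultimately show "\<forall>\<^sub>F lam in at 0 within {0..}. dist (lyapunov lam x) (lyapunov 0 x) < e"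
      proof eventually_elim
        case (elim lam)
        then have "lyapunov 0 x \<le> lyapunov lam x" "lyapunov lam x \<le> lyapunov (1 / real (Suc k)) x"
          by (auto intro!: lyapunov_mono)
        then show ?case using up by (simp add: dist_real_def)
      qed
    qed
    then show ?thesis by (simp add: True continuous_within)
  qed
qed

text \<open>Near \<open>l\<close> all parameters share the Lipschitz constant
  \<open>step_bound (l + 1)\<close> in the space variable; what remains is continuity in the
  parameter at a fixed point.\<close>

lemma lyapunov_continuous: "continuous_on ({0..} \<times> UNIV) (\<lambda>(lam, x). lyapunov lam x)"
  unfolding continuous_on_def
proof
  fix p :: "real \<times> (real ^ 'd)" assume "p \<in> {0..} \<times> UNIV"
  then obtain l x where p: "p = (l, x)" and l: "0 \<le> l" by auto
  let ?F = "at (l, x) within {0..} \<times> UNIV"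
  have f: "(fst \<longlongrightarrow> l) ?F" and s: "(snd \<longlongrightarrow> x) ?F"
    using tendsto_fst[OF tendsto_ident_at[of "(l, x)" "{0..} \<times> UNIV"]] tendsto_snd[OF tendsto_ident_at[of "(l, x)" "{0..} \<times> UNIV"]] by simp_all
  have mem: "\<forall>\<^sub>F p in ?F. fst p \<in> {0..}" by (auto simp: eventually_at_filter mem_Times_iff intro!: always_eventually)
  have "((\<lambda>p. lyapunov (fst p) x) \<longlongrightarrow> lyapunov l x) ?F"
    by (rule continuous_on_tendsto_compose[OF lyapunov_continuous_parameter f]) (use l mem in auto)
  moreover have "((\<lambda>p. lyapunov (fst p) (snd p) - lyapunov (fst p) x) \<longlongrightarrow> 0) ?F"
  proof (rule Lim_null_comparison)
    have "((\<lambda>p. \<Sum>i\<in>UNIV. \<bar>(snd p - x) $ i\<bar>) \<longlongrightarrow> (\<Sum>i\<in>UNIV. \<bar>(x - x) $ i\<bar>)) ?F"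
      by (intro tendsto_intros s)
    then have "((\<lambda>p. l1norm (snd p - x)) \<longlongrightarrow> 0) ?F" by (simp add: l1norm_def)
    then show "((\<lambda>p. l1norm (snd p - x) * step_bound (l + 1)) \<longlongrightarrow> 0) ?F" by (rule tendsto_mult_left_zero)
    have "\<forall>\<^sub>F p in ?F. fst p < l + 1" by (rule order_tendstoD(2)[OF f]) simp
    with mem show "\<forall>\<^sub>F p in ?F. norm (lyapunov (fst p) (snd p) - lyapunov (fst p) x) \<le> l1norm (snd p - x) * step_bound (l + 1)"
    proof eventually_elim
      case (elim p)
      have "norm (lyapunov (fst p) (snd p) - lyapunov (fst p) x) \<le> l1norm (snd p - x) * step_bound (fst p)"
        using lyapunov_Lipschitz[of "fst p"] elim by simp
      also have "\<dots> \<le> l1norm (snd p - x) * step_bound (l + 1)"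
        using elim by (intro mult_left_mono step_bound_mono l1norm_nonneg) auto
      finally show ?case .
    qed
  qed
  ultimately have "((\<lambda>p. lyapunov (fst p) (snd p) - lyapunov (fst p) x + lyapunov (fst p) x) \<longlongrightarrow> 0 + lyapunov l x) ?F"
    by (intro tendsto_add)
  then show "((\<lambda>(lam, x). lyapunov lam x) \<longlongrightarrow> (case p of (lam, x) \<Rightarrow> lyapunov lam x)) (at p within {0..} \<times> UNIV)"
    by (simp add: p split_beta')
qed

section \<open>Return to the extended-real quantities of the theorem\<close>

lemma AE_a_fun:
  assumes lam: "0 \<le> lam"
  shows "AE w in M. \<forall>z. (\<lambda>(\<omega>, \<sigma>). a_fun lam 0 z \<omega> \<sigma>) w = ereal (cost lam 0 z w)"
  using AE_elliptic AE_space
proof eventually_elim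
  case (elim w)
  \<comment> \<open>Ellipticity does not refer to \<open>z\<close>, so one null set serves all
    targets.\<close>
  have "0 < e_fun lam 0 z (fst w) (snd w)" for z using e_pos[of "fst w" "snd w" lam 0 z] elim lam by simp
  then show ?case using elim by (auto simp: a_fun_def elog_def cost_def split_beta less_le)
qed

lemma a_fun_meas: "0 \<le> lam \<Longrightarrow> (\<lambda>(\<omega>, \<sigma>). a_fun lam 0 z \<omega> \<sigma>) \<in> borel_measurable M"
proof -
  assume lam: "0 \<le> lam"
  have "elog \<in> borel_measurable borel" unfolding elog_def by measurable
  then have "(\<lambda>p. - elog p) \<in> borel_measurable borel" by simp
  from measurable_compose[OF e_fun_meas[OF lam] this] show ?thesis by (simp add: a_fun_def split_beta')
qed

lemma expect_a_fun:
  assumes lam: "0 \<le> lam"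
  shows "expect M (\<lambda>(\<omega>, \<sigma>). a_fun lam 0 z \<omega> \<sigma>) = ereal (mean_cost lam z)"
  unfolding mean_cost_def
proof (rule expect_eq_integral[OF _ cost_integrable[OF lam]])
  show "AE w in M. (\<lambda>(\<omega>, \<sigma>). a_fun lam 0 z \<omega> \<sigma>) w = ereal (cost lam 0 z w)"
    using AE_a_fun[OF lam] by eventually_elim blast
  show "AE w in M. 0 \<le> cost lam 0 z w" by (rule AE_I2) (rule cost_nonneg[OF _ lam])
qed

lemma a_fun_AE_tendsto:
  assumes lam: "0 \<le> lam"
  shows "AE w in M. (\<lambda>n. ereal (1 / real n) * (\<lambda>(\<omega>, \<sigma>). a_fun lam 0 (int n *s x) \<omega> \<sigma>) w) \<longlonglongrightarrow> ereal (lyapunov lam (embed x))"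
  using AE_a_fun[OF lam] cost_AE_tendsto[OF lam, of x]
proof eventually_elim
  case (elim w)
  then show ?case by (simp add: mult.commute)
qed

lemma a_fun_L1_tendsto:
  assumes lam: "0 \<le> lam"
  shows "tendsto_L1 M (\<lambda>n w. ereal (1 / real n) * (\<lambda>(\<omega>, \<sigma>). a_fun lam 0 (int n *s x) \<omega> \<sigma>) w) (\<lambda>_. ereal (lyapunov lam (embed x)))"
    (is "tendsto_L1 M ?f (\<lambda>_. ereal ?L)")
  unfolding tendsto_L1_def
proof (intro conjI allI)
  have AE: "AE w in M. ?f n w = ereal (cost lam 0 (int n *s x) w / n)" for n
    using AE_a_fun[OF lam] by eventually_elim (simp add: mult.commute)
  show "in_Lp 1 M (?f n)" for n
    unfolding in_Lp_def
  proof
    show "?f n \<in> borel_measurable M"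
      by (intro borel_measurable_ereal_times borel_measurable_const a_fun_meas lam)
    have "(\<integral>\<^sup>+w. e2ennreal (\<bar>?f n w\<bar> ^ 1) \<partial>M) = (\<integral>\<^sup>+w. ennreal (norm (cost lam 0 (int n *s x) w / n)) \<partial>M)"
      using AE[of n] by (intro nn_integral_cong_AE, eventually_elim) simp
    also have "\<dots> < \<infinity>"
      using cost_integrable[OF lam, of "int n *s x"] integrable_iff_bounded[of M "\<lambda>w. cost lam 0 (int n *s x) w / n"]
      by simp
    finally show "(\<integral>\<^sup>+w. e2ennreal (\<bar>?f n w\<bar> ^ 1) \<partial>M) < \<infinity>" .
  qed
  show "in_Lp 1 M (\<lambda>_. ereal ?L)" by (simp add: in_Lp_def M.emeasure_space_1)
  have "(\<integral>\<^sup>+w. e2ennreal \<bar>?f n w - ereal ?L\<bar> \<partial>M) = ennreal (\<integral>w. \<bar>cost lam 0 (int n *s x) w / n - ?L\<bar> \<partial>M)" for n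
  proof -
    have "(\<integral>\<^sup>+w. e2ennreal \<bar>?f n w - ereal ?L\<bar> \<partial>M) = (\<integral>\<^sup>+w. ennreal \<bar>cost lam 0 (int n *s x) w / n - ?L\<bar> \<partial>M)"
      using AE[of n] by (intro nn_integral_cong_AE, eventually_elim) simp
    also have "\<dots> = ennreal (\<integral>w. \<bar>cost lam 0 (int n *s x) w / n - ?L\<bar> \<partial>M)"
      using cost_integrable[OF lam] by (intro nn_integral_eq_integral) auto
    finally show ?thesis .
  qed
  then show "(\<lambda>n. \<integral>\<^sup>+w. e2ennreal \<bar>?f n w - ereal ?L\<bar> \<partial>M) \<longlonglongrightarrow> 0"
    using tendsto_ennrealI[OF cost_L1_tendsto[OF lam, of x]] by simp
qed

lemma expect_a_fun_tendsto:
  assumes lam: "0 \<le> lam"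
  shows "(\<lambda>n. ereal (1 / real n) * expect M (\<lambda>(\<omega>, \<sigma>). a_fun lam 0 (int n *s x) \<omega> \<sigma>)) \<longlonglongrightarrow> ereal (lyapunov lam (embed x))"
  unfolding expect_a_fun[OF lam] using mean_cost_multiple_tendsto[OF lam, of x] by (simp add: mult.commute)

text \<open>\<open>lyapunov_embed_le\<close> makes the exponent a lower bound, and it is the
  greatest one because the terms themselves converge to it.\<close>

lemma INF_expect_a_fun:
  assumes lam: "0 \<le> lam"
  shows "(INF n\<in>{1..}. ereal (1 / real n) * expect M (\<lambda>(\<omega>, \<sigma>). a_fun lam 0 (int n *s x) \<omega> \<sigma>)) = ereal (lyapunov lam (embed x))"
proof (rule INF_eqI)
  fix n :: nat assume "n \<in> {1..}"
  then show "ereal (lyapunov lam (embed x)) \<le> ereal (1 / real n) * expect M (\<lambda>(\<omega>, \<sigma>). a_fun lam 0 (int n *s x) \<omega> \<sigma>)"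
    unfolding expect_a_fun[OF lam] using lyapunov_embed_le[OF lam, of n x] by (simp add: mult.commute)
next
  fix y assume "\<And>n. n \<in> {1..} \<Longrightarrow> y \<le> ereal (1 / real n) * expect M (\<lambda>(\<omega>, \<sigma>). a_fun lam 0 (int n *s x) \<omega> \<sigma>)"
  then show "y \<le> ereal (lyapunov lam (embed x))"
    by (intro LIMSEQ_le_const[OF expect_a_fun_tendsto[OF lam]]) auto
qed

text \<open>All expectations involved are finite and their integrands almost surely nonnegative, so
  \<open>expect\<close> reduces to ordinary integrals; the maximum commutes with the monotone map
  \<open>ereal\<close>.\<close>

lemma expect_step_bound:
  assumes lam: "0 \<le> lam"
  shows "(MAX e\<in>unit_steps. expect E (\<lambda>\<omega>. - elog (measure (\<omega> 0) {e}))) + expect S (\<lambda>\<sigma>. ereal (theta lam \<sigma> 0))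
    = ereal (step_bound lam)"
proof -
  let ?c = "\<lambda>e. \<integral>\<omega>. - ln (measure (\<omega> 0) {e}) \<partial>E"
  have "expect E (\<lambda>\<omega>. - elog (measure (\<omega> 0) {e})) = ereal (?c e)" if e: "e \<in> unit_steps" for e
  proof (rule expect_eq_integral[OF _ log_step_integrable[OF e]])
    show "AE \<omega> in E. - elog (measure (\<omega> 0) {e}) = ereal (- ln (measure (\<omega> 0) {e}))"
      using AE_step_pos by eventually_elim (use e in \<open>auto simp: elog_def\<close>)
    show "AE \<omega> in E. 0 \<le> - ln (measure (\<omega> 0) {e})"
      using AE_step_pos AE_space
    proof eventually_elim
      case (elim \<omega>)
      have "prob_space (\<omega> 0)"
        using measurable_space[OF env_component elim(2), of 0] by (simp add: P1_def space_prob_algebra)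
      then show ?case using prob_space.prob_le_1[of "\<omega> 0" "{e}"] elim(1) e by simp
    qed
  qed
  then have "(\<lambda>e. expect E (\<lambda>\<omega>. - elog (measure (\<omega> 0) {e}))) ` unit_steps = ereal ` ?c ` unit_steps"
    by (auto simp: image_image)
  moreover have "Max (ereal ` ?c ` unit_steps) = ereal (Max (?c ` unit_steps))"
    by (rule mono_Max_commute[symmetric]) (auto simp: mono_def finite_unit_steps unit_steps_nonempty)
  moreover have "expect S (\<lambda>\<sigma>. ereal (theta lam \<sigma> (0 :: 'd site))) = ereal (\<integral>\<sigma>. theta lam \<sigma> 0 \<partial>S)"
  proof (rule expect_eq_integral[OF _ theta_integrable[OF lam]])
    show "AE \<sigma> in S. 0 \<le> theta lam \<sigma> 0"
      by (rule AE_I2) (use environmentI_S[OF _ lam] environment.theta_nonneg in blast)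
  qed simp
  ultimately show ?thesis by (simp add: step_bound_def)
qed

lemma elog_mean_laplace:
  assumes lam: "0 \<le> lam"
  shows "- elog (\<integral>\<sigma>. exp (- theta lam \<sigma> (0 :: 'd site)) \<partial>S) = ereal (- ln (mean_laplace lam))"
proof -
  have "(\<integral>\<sigma>. exp (- theta lam \<sigma> (0 :: 'd site)) \<partial>S) = mean_laplace lam"
    unfolding mean_laplace_def
  proof (rule Bochner_Integration.integral_cong)
    fix \<sigma> assume "\<sigma> \<in> space S"
    then show "exp (- theta lam \<sigma> 0) = laplace lam \<sigma> 0"
      using laplace_pos'[of \<sigma> lam 0] lam by (simp add: theta_def laplace_def)
  qed simp
  then show ?thesis using mean_laplace_pos[OF lam] by (simp add: elog_def)
qed

end

theorem mainTheorem1: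
  fixes \<nu> :: "'d::finite site measure measure" and \<mu> :: "real measure measure"
  assumes "\<nu> \<in> space (prob_algebra P1)"
    and "\<mu> \<in> space (prob_algebra P2)"
    and "in_Lp CARD('d) (env_law \<nu>) (\<lambda>\<omega>. elog (MIN e\<in>unit_steps. measure (\<omega> 0) {e}))"
    and "in_Lp CARD('d) (hold_law \<mu> :: ('d site \<Rightarrow> real measure) measure)
           (\<lambda>\<sigma>. enn2ereal (\<integral>\<^sup>+s. ennreal s \<partial>\<sigma> 0))"
    and "0 \<in> convex hull (msupport (distr (env_law \<nu>) borel drift))"
  shows "\<exists>\<alpha> :: real \<Rightarrow> real ^ 'd \<Rightarrow> real.
    (\<forall>lam\<ge>0. \<forall>x. 0 \<le> \<alpha> lam x) \<and>
    (\<forall>lam\<ge>0. \<forall>x :: 'd site.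
      (let M = env_law \<nu> \<Otimes>\<^sub>M (hold_law \<mu> :: ('d site \<Rightarrow> real measure) measure);
           a = (\<lambda>n (\<omega>, \<sigma>). a_fun lam 0 (int n *s x) \<omega> \<sigma>)
       in
        (AE w in M. (\<lambda>n. ereal (1 / real n) * a n w) \<longlonglongrightarrow> ereal (\<alpha> lam (embed x))) \<and>
        tendsto_L1 M (\<lambda>n w. ereal (1 / real n) * a n w) (\<lambda>_. ereal (\<alpha> lam (embed x))) \<and>
        (\<lambda>n. ereal (1 / real n) * expect M (a n)) \<longlonglongrightarrow> ereal (\<alpha> lam (embed x)) \<and>
        (INF n\<in>{1..}. ereal (1 / real n) * expect M (a n)) = ereal (\<alpha> lam (embed x)))) \<and>
    (\<forall>lam\<ge>0. \<forall>q>0. \<forall>x. \<alpha> lam (q *\<^sub>R x) = q * \<alpha> lam x) \<and>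
    (\<forall>lam\<ge>0. \<forall>x y. \<alpha> lam (x + y) \<le> \<alpha> lam x + \<alpha> lam y) \<and>
    (\<forall>lam\<ge>0. \<forall>x.
      ereal (l1norm x) * (- elog (\<integral>\<sigma>. exp (- theta lam \<sigma> (0 :: 'd site)) \<partial>hold_law \<mu>)) \<le> ereal (\<alpha> lam x) \<and>
      ereal (\<alpha> lam x) \<le> ereal (l1norm x) *
        ((MAX e\<in>unit_steps. expect (env_law \<nu>) (\<lambda>\<omega>. - elog (measure (\<omega> 0) {e})))
          + expect (hold_law \<mu> :: ('d site \<Rightarrow> real measure) measure) (\<lambda>\<sigma>. ereal (theta lam \<sigma> 0)))) \<and>
    (\<forall>x. concave_on {0..} (\<lambda>lam. \<alpha> lam x)) \<and>
    (\<forall>x. mono_on {0..} (\<lambda>lam. \<alpha> lam x)) \<and>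
    (\<forall>lam\<ge>0. convex_on UNIV (\<alpha> lam)) \<and>
    continuous_on ({0..} \<times> UNIV) (\<lambda>(lam, x). \<alpha> lam x)"
proof -
  interpret random_environment \<nu> \<mu>
    by (rule random_environment.intro) (fact assms)+
  show ?thesis
  proof (intro exI[of _ lyapunov] conjI allI impI ballI)
    fix lam :: real assume lam: "0 \<le> lam"
    show "0 \<le> lyapunov lam x" for x by (rule lyapunov_nonneg[OF lam])
    show "let M = env_law \<nu> \<Otimes>\<^sub>M (hold_law \<mu> :: ('d site \<Rightarrow> real measure) measure);
           a = (\<lambda>n (\<omega>, \<sigma>). a_fun lam 0 (int n *s x) \<omega> \<sigma>)
       in
        (AE w in M. (\<lambda>n. ereal (1 / real n) * a n w) \<longlonglongrightarrow> ereal (lyapunov lam (embed x))) \<and>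
        tendsto_L1 M (\<lambda>n w. ereal (1 / real n) * a n w) (\<lambda>_. ereal (lyapunov lam (embed x))) \<and>
        (\<lambda>n. ereal (1 / real n) * expect M (a n)) \<longlonglongrightarrow> ereal (lyapunov lam (embed x)) \<and>
        (INF n\<in>{1..}. ereal (1 / real n) * expect M (a n)) = ereal (lyapunov lam (embed x))" for x :: "'d site"
      unfolding Let_def
      by (intro conjI a_fun_AE_tendsto a_fun_L1_tendsto expect_a_fun_tendsto INF_expect_a_fun lam)
    show "lyapunov lam (q *\<^sub>R x) = q * lyapunov lam x" if "0 < q" for q x
      by (rule lyapunov_scaleR[OF lam that])
    show "lyapunov lam (x + y) \<le> lyapunov lam x + lyapunov lam y" for x y
      by (rule lyapunov_subadditive[OF lam])
    show "ereal (l1norm x) * (- elog (\<integral>\<sigma>. exp (- theta lam \<sigma> (0 :: 'd site)) \<partial>hold_law \<mu>)) \<le> ereal (lyapunov lam x)" for x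
      unfolding elog_mean_laplace[OF lam] using lyapunov_lower[OF lam, of x] by simp
    show "ereal (lyapunov lam x) \<le> ereal (l1norm x) *
        ((MAX e\<in>unit_steps. expect (env_law \<nu>) (\<lambda>\<omega>. - elog (measure (\<omega> 0) {e})))
          + expect (hold_law \<mu> :: ('d site \<Rightarrow> real measure) measure) (\<lambda>\<sigma>. ereal (theta lam \<sigma> 0)))" for x
      unfolding expect_step_bound[OF lam] using lyapunov_upper[OF lam, of x] by simp
    show "convex_on UNIV (lyapunov lam)" by (rule lyapunov_convex[OF lam])
  next
    show "concave_on {0..} (\<lambda>lam. lyapunov lam x)" for x by (rule lyapunov_concave)
    show "mono_on {0..} (\<lambda>lam. lyapunov lam x)" for x by (auto intro!: mono_onI lyapunov_mono)
    show "continuous_on ({0..} \<times> UNIV) (\<lambda>(lam, x). lyapunov lam x)" by (rule lyapunov_continuous)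
  qed
qed

end
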